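(* Let $L,H$ be functional causal models in a Markov category $\mathcal C$ with endogenous variables $V_L,V_H$. A counterfactual abstraction $L\to H$ is equivalent to a downward abstraction $(\pi,\tau)\colon(\mathrm{CF}(V_L),L)\to(\mathrm{CF}(V_H),H)$ of counterfactual queries such that $$\pi\big([Y_1|_{X_1},\dots,Y_m|_{X_m}]\big)=[\pi(Y_1)|_{\pi(X_1)},\dots,\pi(Y_m)|_{\pi(X_m)}]$$ for all subsets $X_j,Y_j\subseteq V_H$. That is, restricting $\pi$ and $\tau$ to variables gives a bijection from such downward abstractions to counterfactual abstractions $L\to H$.
   Context: **Categories.** A Markov category is a symmetric monoidal category with terminal unit $I$ in which each object has a commutative comonoid structure (copy, discard) compatible with $\otimes$. Morphisms are called channels; $f$ is deterministic if $\mathrm{copy}\circ f=(f\otimes f)\circ\mathrm{copy}$. Functors are strong symmetric monoidal, copy-preserving, with deterministic structure isomorphisms; natural transformations are monoidal with deterministic components; "epic" means all components are epic. **Functional causal models (FCMs).** An FCM $M$ in $\mathcal C$ consists of a finite acyclic directed graph on variables $V\cup U$ with $V=\{X_1,\dots,X_n\}$ (endogenous) and $U=\{U_1,\dots,U_n\}$ (exogenous), where each $U_i$ has no parents and each $X_i$ has parents $\mathrm{Pa}'(X_i)\cup\{U_i\}$ with $\mathrm{Pa}'(X_i)\subseteq V$; an object of $\mathcal C$ for each variable; a state $\lambda_i\colon I\to U_i$ for each $i$; and a deterministic channel $f_i\colon\mathrm{Pa}'(X_i)\otimes U_i\to X_i$ for each $i$. It has no inputs, and outputs $V$. A set of variables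 is also used for the list of its elements (lists of distinct variables considered up to permutation) and for the tensor of the corresponding objects. Let $\lambda=\bigotimes_i\lambda_i\colon I\to U$. Let $F$ be the deterministic part of $M$: the causal model with inputs $U$ and mechanisms $f_i$. For $X,Y\subseteq V$ let $F_{\mathrm{Do}(X)}^{Y}\colon U\otimes X\to Y$ be the channel obtained by deleting the mechanisms $f_i$ of the variables in $X$, making $X$ into inputs, wiring the remaining mechanisms together with copy maps, and outputting (copies of) the variables in $Y$, discarding everything else. **Counterfactual queries.** A query signature $Q$ is a set of objects (types) and a set of generators (queries), each with finite lists of input and output types; it freely generates a Markov category $\mathbf Q$. A model of $Q$ in $\mathcal C$ is a functor $[\![-]\!]\colon\mathbf Q\to\mathcal C$. The signature $\mathrm{CF}(V)$ has types $V$ and, for all choices of subsets $X_j,Y_j\subseteq V$, $j=1,\dots,m$, a query $[Y_1|_{X_1},\dots,Y_m|_{X_m}]$ with inputs $X_1,\dots,X_m$ and outputs $Y_1,\dots,Y_m$. An FCM $M$ with endogenous variables $V$ models it by $$[\![\,[Y_1|_{X_1},\dots,Y_m|_{X_m}]\,]\!]_M=\big(F_{\mathrm{Do}(X_1)}^{Y_1}\otimes\dots\otimes F_{\mathrm{Do}(X_m)}^{Y_m}\big)\circ\big((\mathrm{copy}^{(m)}_U\circ\lambda)\otimes\mathrm{id}_{X_1\otimes\dots\otimes X_m}\big),$$ where $\mathrm{copy}^{(m)}_U\colon U\to U^{\otimes m}$ is the $m$-fold copy and the $j$-th copy of $U$ together with $X_j$ is fed (after permuting wires) into the $j$-th factor.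 **Downward abstraction** $(\pi,\tau)\colon(Q_L,L)\to(Q_H,H)$: a functor $\pi\colon\mathbf Q_H\to\mathbf Q_L$ sending each query of $Q_H$ to a query (generator) of $Q_L$, and an epic natural transformation $\tau\colon[\![-]\!]_L\circ\pi\Rightarrow[\![-]\!]_H$. **Counterfactual abstraction** $L\to H$: a family of pairwise disjoint subsets $\pi(X)\subseteq V_L$, $X\in V_H$ (with $\pi(S)=\bigcup_{X\in S}\pi(X)$), and epic deterministic channels $\tau_X\colon\pi(X)\to X$ in $\mathcal C$ (with $\tau_S=\bigotimes_{X\in S}\tau_X$; all tensor products of the $\tau_X$ are also required to be epic), such that for all queries $[Y_1|_{X_1},\dots,Y_m|_{X_m}]$ of $\mathrm{CF}(V_H)$, $$(\tau_{Y_1}\otimes\dots\otimes\tau_{Y_m})\circ[\![\,[\pi(Y_1)|_{\pi(X_1)},\dots,\pi(Y_m)|_{\pi(X_m)}]\,]\!]_L=[\![\,[Y_1|_{X_1},\dots,Y_m|_{X_m}]\,]\!]_H\circ(\tau_{X_1}\otimes\dots\otimes\tau_{X_m}).$$ *)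

theory Defs
  imports "HOL-Library.FuncSet"
begin

text \<open>
  Symmetric monoidal categories are not assumed strict.  The composite \<open>g \<cdot> f\<close> means "first \<open>f\<close>,
  then \<open>g\<close>"; \<open>\<otimes>\<close> acts on objects and \<open>\<boxtimes>\<close> on morphisms.  The inverses of the associator and
  of the unitors are part of the data so that all laws are equations.
\<close>

record ('o, 'm) mcat =
  Obj :: "'o set"
  Arr :: "'m set"
  src :: "'m \<Rightarrow> 'o"
  tgt :: "'m \<Rightarrow> 'o"
  idt :: "'o \<Rightarrow> 'm"
  cmp :: "'m \<Rightarrow> 'm \<Rightarrow> 'm"  (infixr "\<cdot>\<index>" 65)
  ten :: "'o \<Rightarrow> 'o \<Rightarrow> 'o"  (infixr "\<otimes>\<index>" 70)
  tenm :: "'m \<Rightarrow> 'm \<Rightarrow> 'm"  (infixr "\<boxtimes>\<index>" 70)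
  unt :: "'o"
  asc :: "'o \<Rightarrow> 'o \<Rightarrow> 'o \<Rightarrow> 'm"
  asci :: "'o \<Rightarrow> 'o \<Rightarrow> 'o \<Rightarrow> 'm"
  lun :: "'o \<Rightarrow> 'm"
  luni :: "'o \<Rightarrow> 'm"
  run :: "'o \<Rightarrow> 'm"
  runi :: "'o \<Rightarrow> 'm"
  swp :: "'o \<Rightarrow> 'o \<Rightarrow> 'm"
  cpy :: "'o \<Rightarrow> 'm"
  dsc :: "'o \<Rightarrow> 'm"

definition hom :: "('o, 'm) mcat \<Rightarrow> 'o \<Rightarrow> 'o \<Rightarrow> 'm set" where
  "hom C a b = {f \<in> Arr C. src C f = a \<and> tgt C f = b}"

text \<open>The middle-four exchange \<open>(a \<otimes> b) \<otimes> (c \<otimes> d) \<rightarrow> (a \<otimes> c) \<otimes> (b \<otimes> d)\<close>.\<close>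

definition mid :: "('o, 'm) mcat \<Rightarrow> 'o \<Rightarrow> 'o \<Rightarrow> 'o \<Rightarrow> 'o \<Rightarrow> 'm" where
  "mid C a b c d =
     asci C a c (b \<otimes>\<^bsub>C\<^esub> d) \<cdot>\<^bsub>C\<^esub>
     (idt C a \<boxtimes>\<^bsub>C\<^esub>
       (asc C c b d \<cdot>\<^bsub>C\<^esub> (swp C b c \<boxtimes>\<^bsub>C\<^esub> idt C d) \<cdot>\<^bsub>C\<^esub> asci C b c d)) \<cdot>\<^bsub>C\<^esub>
     asc C a b (c \<otimes>\<^bsub>C\<^esub> d)"

text \<open>
  The laws of a Markov category, holding up to a congruence \<open>\<approx>\<close> on the morphisms.  With equality for
  \<open>\<approx>\<close> this is the notion of a Markov category; the congruence is used to construct the free one.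
\<close>

locale markov_upto =
  fixes C :: "('o, 'm) mcat" (structure)
    and E :: "'m \<Rightarrow> 'm \<Rightarrow> bool" (infix "\<approx>" 50)
  assumes src_obj: "f \<in> Arr C \<Longrightarrow> src C f \<in> Obj C"
    and tgt_obj: "f \<in> Arr C \<Longrightarrow> tgt C f \<in> Obj C"
    and unt_obj: "unt C \<in> Obj C"
    and ten_obj: "a \<in> Obj C \<Longrightarrow> b \<in> Obj C \<Longrightarrow> a \<otimes> b \<in> Obj C"
    and idt_hom: "a \<in> Obj C \<Longrightarrow> idt C a \<in> hom C a a"
    and cmp_hom: "f \<in> hom C a b \<Longrightarrow> g \<in> hom C b c \<Longrightarrow> g \<cdot> f \<in> hom C a c"
    and tenm_hom: "f \<in> hom C a b \<Longrightarrow> g \<in> hom C c d \<Longrightarrow> f \<boxtimes> g \<in> hom C (a \<otimes> c) (b \<otimes> d)"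
    and asc_hom: "a \<in> Obj C \<Longrightarrow> b \<in> Obj C \<Longrightarrow> c \<in> Obj C \<Longrightarrow>
      asc C a b c \<in> hom C ((a \<otimes> b) \<otimes> c) (a \<otimes> (b \<otimes> c))"
    and asci_hom: "a \<in> Obj C \<Longrightarrow> b \<in> Obj C \<Longrightarrow> c \<in> Obj C \<Longrightarrow>
      asci C a b c \<in> hom C (a \<otimes> (b \<otimes> c)) ((a \<otimes> b) \<otimes> c)"
    and lun_hom: "a \<in> Obj C \<Longrightarrow> lun C a \<in> hom C (unt C \<otimes> a) a"
    and luni_hom: "a \<in> Obj C \<Longrightarrow> luni C a \<in> hom C a (unt C \<otimes> a)"
    and run_hom: "a \<in> Obj C \<Longrightarrow> run C a \<in> hom C (a \<otimes> unt C) a"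
    and runi_hom: "a \<in> Obj C \<Longrightarrow> runi C a \<in> hom C a (a \<otimes> unt C)"
    and swp_hom: "a \<in> Obj C \<Longrightarrow> b \<in> Obj C \<Longrightarrow> swp C a b \<in> hom C (a \<otimes> b) (b \<otimes> a)"
    and cpy_hom: "a \<in> Obj C \<Longrightarrow> cpy C a \<in> hom C a (a \<otimes> a)"
    and dsc_hom: "a \<in> Obj C \<Longrightarrow> dsc C a \<in> hom C a (unt C)"
    and E_refl: "f \<in> Arr C \<Longrightarrow> f \<approx> f"
    and E_sym: "f \<approx> g \<Longrightarrow> g \<approx> f"
    and E_trans: "f \<approx> g \<Longrightarrow> g \<approx> h \<Longrightarrow> f \<approx> h"
    and E_parallel: "f \<approx> g \<Longrightarrow> f \<in> hom C a b \<Longrightarrow> g \<in> hom C a b"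
    and E_cmp: "f \<approx> f' \<Longrightarrow> g \<approx> g' \<Longrightarrow> f \<in> hom C a b \<Longrightarrow> g \<in> hom C b c \<Longrightarrow> g \<cdot> f \<approx> g' \<cdot> f'"
    and E_tenm: "f \<approx> f' \<Longrightarrow> g \<approx> g' \<Longrightarrow> f \<in> Arr C \<Longrightarrow> g \<in> Arr C \<Longrightarrow> f \<boxtimes> g \<approx> f' \<boxtimes> g'"
    and idt_left: "f \<in> hom C a b \<Longrightarrow> idt C b \<cdot> f \<approx> f"
    and idt_right: "f \<in> hom C a b \<Longrightarrow> f \<cdot> idt C a \<approx> f"
    and cmp_assoc: "f \<in> hom C a b \<Longrightarrow> g \<in> hom C b c \<Longrightarrow> h \<in> hom C c d \<Longrightarrow>
      (h \<cdot> g) \<cdot> f \<approx> h \<cdot> (g \<cdot> f)"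
    and tenm_idt: "a \<in> Obj C \<Longrightarrow> b \<in> Obj C \<Longrightarrow> idt C a \<boxtimes> idt C b \<approx> idt C (a \<otimes> b)"
    and tenm_cmp: "f \<in> hom C a b \<Longrightarrow> g \<in> hom C b c \<Longrightarrow> f' \<in> hom C a' b' \<Longrightarrow> g' \<in> hom C b' c' \<Longrightarrow>
      (g \<cdot> f) \<boxtimes> (g' \<cdot> f') \<approx> (g \<boxtimes> g') \<cdot> (f \<boxtimes> f')"
    and asc_asci: "a \<in> Obj C \<Longrightarrow> b \<in> Obj C \<Longrightarrow> c \<in> Obj C \<Longrightarrow>
      asc C a b c \<cdot> asci C a b c \<approx> idt C (a \<otimes> (b \<otimes> c))"
    and asci_asc: "a \<in> Obj C \<Longrightarrow> b \<in> Obj C \<Longrightarrow> c \<in> Obj C \<Longrightarrow>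
      asci C a b c \<cdot> asc C a b c \<approx> idt C ((a \<otimes> b) \<otimes> c)"
    and lun_luni: "a \<in> Obj C \<Longrightarrow> lun C a \<cdot> luni C a \<approx> idt C a"
    and luni_lun: "a \<in> Obj C \<Longrightarrow> luni C a \<cdot> lun C a \<approx> idt C (unt C \<otimes> a)"
    and run_runi: "a \<in> Obj C \<Longrightarrow> run C a \<cdot> runi C a \<approx> idt C a"
    and runi_run: "a \<in> Obj C \<Longrightarrow> runi C a \<cdot> run C a \<approx> idt C (a \<otimes> unt C)"
    and asc_natural: "f \<in> hom C a a' \<Longrightarrow> g \<in> hom C b b' \<Longrightarrow> h \<in> hom C c c' \<Longrightarrow>
      asc C a' b' c' \<cdot> ((f \<boxtimes> g) \<boxtimes> h) \<approx> (f \<boxtimes> (g \<boxtimes> h)) \<cdot> asc C a b c"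
    and lun_natural: "f \<in> hom C a b \<Longrightarrow> lun C b \<cdot> (idt C (unt C) \<boxtimes> f) \<approx> f \<cdot> lun C a"
    and run_natural: "f \<in> hom C a b \<Longrightarrow> run C b \<cdot> (f \<boxtimes> idt C (unt C)) \<approx> f \<cdot> run C a"
    and pentagon: "a \<in> Obj C \<Longrightarrow> b \<in> Obj C \<Longrightarrow> c \<in> Obj C \<Longrightarrow> d \<in> Obj C \<Longrightarrow>
      asc C a b (c \<otimes> d) \<cdot> asc C (a \<otimes> b) c d \<approx>
      (idt C a \<boxtimes> asc C b c d) \<cdot> asc C a (b \<otimes> c) d \<cdot> (asc C a b c \<boxtimes> idt C d)"
    and triangle: "a \<in> Obj C \<Longrightarrow> b \<in> Obj C \<Longrightarrow>
      (idt C a \<boxtimes> lun C b) \<cdot> asc C a (unt C) b \<approx> run C a \<boxtimes> idt C b"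
    and swp_natural: "f \<in> hom C a a' \<Longrightarrow> g \<in> hom C b b' \<Longrightarrow>
      swp C a' b' \<cdot> (f \<boxtimes> g) \<approx> (g \<boxtimes> f) \<cdot> swp C a b"
    and swp_swp: "a \<in> Obj C \<Longrightarrow> b \<in> Obj C \<Longrightarrow> swp C b a \<cdot> swp C a b \<approx> idt C (a \<otimes> b)"
    and hexagon: "a \<in> Obj C \<Longrightarrow> b \<in> Obj C \<Longrightarrow> c \<in> Obj C \<Longrightarrow>
      asc C b c a \<cdot> swp C a (b \<otimes> c) \<cdot> asc C a b c \<approx>
      (idt C b \<boxtimes> swp C a c) \<cdot> asc C b a c \<cdot> (swp C a b \<boxtimes> idt C c)"
    and terminal: "f \<in> hom C a (unt C) \<Longrightarrow> f \<approx> dsc C a"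
    \<comment> \<open>compatibility of \<open>dsc\<close> with \<open>\<otimes>\<close> follows from \<open>terminal\<close>\<close>
    and cpy_coassoc: "a \<in> Obj C \<Longrightarrow>
      asc C a a a \<cdot> (cpy C a \<boxtimes> idt C a) \<cdot> cpy C a \<approx> (idt C a \<boxtimes> cpy C a) \<cdot> cpy C a"
    and cpy_counit_left: "a \<in> Obj C \<Longrightarrow> lun C a \<cdot> (dsc C a \<boxtimes> idt C a) \<cdot> cpy C a \<approx> idt C a"
    and cpy_counit_right: "a \<in> Obj C \<Longrightarrow> run C a \<cdot> (idt C a \<boxtimes> dsc C a) \<cdot> cpy C a \<approx> idt C a"
    and cpy_cocomm: "a \<in> Obj C \<Longrightarrow> swp C a a \<cdot> cpy C a \<approx> cpy C a"
    and cpy_unt: "cpy C (unt C) \<approx> luni C (unt C)"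
    and cpy_ten: "a \<in> Obj C \<Longrightarrow> b \<in> Obj C \<Longrightarrow>
      cpy C (a \<otimes> b) \<approx> mid C a a b b \<cdot> (cpy C a \<boxtimes> cpy C b)"

definition markov_category :: "('o, 'm) mcat \<Rightarrow> bool" where
  "markov_category C \<longleftrightarrow> markov_upto C (=)"

definition deterministic :: "('o, 'm) mcat \<Rightarrow> 'm \<Rightarrow> bool" where
  "deterministic C f \<longleftrightarrow>
     cpy C (tgt C f) \<cdot>\<^bsub>C\<^esub> f = (f \<boxtimes>\<^bsub>C\<^esub> f) \<cdot>\<^bsub>C\<^esub> cpy C (src C f)"

definition iso_arr :: "('o, 'm) mcat \<Rightarrow> 'm \<Rightarrow> bool" where
  "iso_arr C f \<longleftrightarrow> (\<exists>g \<in> hom C (tgt C f) (src C f).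
     g \<cdot>\<^bsub>C\<^esub> f = idt C (src C f) \<and> f \<cdot>\<^bsub>C\<^esub> g = idt C (tgt C f))"

definition epic :: "('o, 'm) mcat \<Rightarrow> 'm \<Rightarrow> bool" where
  "epic C f \<longleftrightarrow> (\<forall>c. \<forall>g \<in> hom C (tgt C f) c. \<forall>h \<in> hom C (tgt C f) c.
     g \<cdot>\<^bsub>C\<^esub> f = h \<cdot>\<^bsub>C\<^esub> f \<longrightarrow> g = h)"

text \<open>
  A strong monoidal functor consists of its action on objects and morphisms and of the structure
  isomorphisms \<open>fmu a b : F a \<otimes> F b \<rightarrow> F (a \<otimes> b)\<close> and \<open>fnu : I \<rightarrow> F I\<close>.  All functions are
  \<open>undefined\<close> outside their domains, so that equality of functors is equality of records.
  Compatibility with discarding follows from terminality of the unit.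
\<close>

record ('o, 'm, 'p, 'n) mfun =
  fob :: "'o \<Rightarrow> 'p"
  far :: "'m \<Rightarrow> 'n"
  fmu :: "'o \<Rightarrow> 'o \<Rightarrow> 'n"
  fnu :: "'n"

locale markov_functor =
  fixes C :: "('o, 'm) mcat" and D :: "('p, 'n) mcat" and F :: "('o, 'm, 'p, 'n) mfun"
  assumes fob_ext: "fob F \<in> extensional (Obj C)"
    and far_ext: "far F \<in> extensional (Arr C)"
    and fmu_ext: "\<not> (a \<in> Obj C \<and> b \<in> Obj C) \<Longrightarrow> fmu F a b = undefined"
    and fob_obj: "a \<in> Obj C \<Longrightarrow> fob F a \<in> Obj D"
    and far_hom: "f \<in> hom C a b \<Longrightarrow> far F f \<in> hom D (fob F a) (fob F b)"
    and far_idt: "a \<in> Obj C \<Longrightarrow> far F (idt C a) = idt D (fob F a)"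
    and far_cmp: "f \<in> hom C a b \<Longrightarrow> g \<in> hom C b c \<Longrightarrow>
      far F (g \<cdot>\<^bsub>C\<^esub> f) = far F g \<cdot>\<^bsub>D\<^esub> far F f"
    and fmu_hom: "a \<in> Obj C \<Longrightarrow> b \<in> Obj C \<Longrightarrow>
      fmu F a b \<in> hom D (fob F a \<otimes>\<^bsub>D\<^esub> fob F b) (fob F (a \<otimes>\<^bsub>C\<^esub> b))"
    and fmu_iso: "a \<in> Obj C \<Longrightarrow> b \<in> Obj C \<Longrightarrow> iso_arr D (fmu F a b)"
    and fmu_det: "a \<in> Obj C \<Longrightarrow> b \<in> Obj C \<Longrightarrow> deterministic D (fmu F a b)"
    and fnu_hom: "fnu F \<in> hom D (unt D) (fob F (unt C))"
    and fnu_iso: "iso_arr D (fnu F)"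
    and fnu_det: "deterministic D (fnu F)"
    and fmu_natural: "f \<in> hom C a a' \<Longrightarrow> g \<in> hom C b b' \<Longrightarrow>
      fmu F a' b' \<cdot>\<^bsub>D\<^esub> (far F f \<boxtimes>\<^bsub>D\<^esub> far F g) = far F (f \<boxtimes>\<^bsub>C\<^esub> g) \<cdot>\<^bsub>D\<^esub> fmu F a b"
    and fmu_asc: "a \<in> Obj C \<Longrightarrow> b \<in> Obj C \<Longrightarrow> c \<in> Obj C \<Longrightarrow>
      far F (asc C a b c) \<cdot>\<^bsub>D\<^esub> fmu F (a \<otimes>\<^bsub>C\<^esub> b) c \<cdot>\<^bsub>D\<^esub> (fmu F a b \<boxtimes>\<^bsub>D\<^esub> idt D (fob F c)) =
      fmu F a (b \<otimes>\<^bsub>C\<^esub> c) \<cdot>\<^bsub>D\<^esub> (idt D (fob F a) \<boxtimes>\<^bsub>D\<^esub> fmu F b c) \<cdot>\<^bsub>D\<^esub>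
        asc D (fob F a) (fob F b) (fob F c)"
    and fmu_lun: "a \<in> Obj C \<Longrightarrow>
      far F (lun C a) \<cdot>\<^bsub>D\<^esub> fmu F (unt C) a \<cdot>\<^bsub>D\<^esub> (fnu F \<boxtimes>\<^bsub>D\<^esub> idt D (fob F a)) = lun D (fob F a)"
    and fmu_run: "a \<in> Obj C \<Longrightarrow>
      far F (run C a) \<cdot>\<^bsub>D\<^esub> fmu F a (unt C) \<cdot>\<^bsub>D\<^esub> (idt D (fob F a) \<boxtimes>\<^bsub>D\<^esub> fnu F) = run D (fob F a)"
    and fmu_swp: "a \<in> Obj C \<Longrightarrow> b \<in> Obj C \<Longrightarrow>
      far F (swp C a b) \<cdot>\<^bsub>D\<^esub> fmu F a b = fmu F b a \<cdot>\<^bsub>D\<^esub> swp D (fob F a) (fob F b)"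
    and far_cpy: "a \<in> Obj C \<Longrightarrow> far F (cpy C a) = fmu F a a \<cdot>\<^bsub>D\<^esub> cpy D (fob F a)"

definition strict_functor ::
  "('o, 'm) mcat \<Rightarrow> ('p, 'n) mcat \<Rightarrow> ('o, 'm, 'p, 'n) mfun \<Rightarrow> bool" where
  "strict_functor C D F \<longleftrightarrow>
     (\<forall>a \<in> Obj C. \<forall>b \<in> Obj C. fob F (a \<otimes>\<^bsub>C\<^esub> b) = fob F a \<otimes>\<^bsub>D\<^esub> fob F b \<and>
        fmu F a b = idt D (fob F a \<otimes>\<^bsub>D\<^esub> fob F b)) \<and>
     fob F (unt C) = unt D \<and> fnu F = idt D (unt D)"

definition fcomp :: "('o, 'm) mcat \<Rightarrow> ('r, 'k) mcat \<Rightarrow> ('p, 'n, 'r, 'k) mfun \<Rightarrow>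
    ('o, 'm, 'p, 'n) mfun \<Rightarrow> ('o, 'm, 'r, 'k) mfun" where
  "fcomp C B G F = \<lparr>
     fob = restrict (\<lambda>a. fob G (fob F a)) (Obj C),
     far = restrict (\<lambda>f. far G (far F f)) (Arr C),
     fmu = (\<lambda>a b. if a \<in> Obj C \<and> b \<in> Obj C
                  then far G (fmu F a b) \<cdot>\<^bsub>B\<^esub> fmu G (fob F a) (fob F b) else undefined),
     fnu = far G (fnu F) \<cdot>\<^bsub>B\<^esub> fnu G\<rparr>"

locale markov_nat =
  fixes C :: "('o, 'm) mcat" and D :: "('p, 'n) mcat"
    and F G :: "('o, 'm, 'p, 'n) mfun" and \<tau> :: "'o \<Rightarrow> 'n"
  assumes nat_ext: "\<tau> \<in> extensional (Obj C)"
    and nat_hom: "a \<in> Obj C \<Longrightarrow> \<tau> a \<in> hom D (fob F a) (fob G a)"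
    and nat_natural: "f \<in> hom C a b \<Longrightarrow> \<tau> b \<cdot>\<^bsub>D\<^esub> far F f = far G f \<cdot>\<^bsub>D\<^esub> \<tau> a"
    and nat_fmu: "a \<in> Obj C \<Longrightarrow> b \<in> Obj C \<Longrightarrow>
      \<tau> (a \<otimes>\<^bsub>C\<^esub> b) \<cdot>\<^bsub>D\<^esub> fmu F a b = fmu G a b \<cdot>\<^bsub>D\<^esub> (\<tau> a \<boxtimes>\<^bsub>D\<^esub> \<tau> b)"
    and nat_fnu: "\<tau> (unt C) \<cdot>\<^bsub>D\<^esub> fnu F = fnu G"
    and nat_det: "a \<in> Obj C \<Longrightarrow> deterministic D (\<tau> a)"

record ('t, 'g) qsig =
  types :: "'t set"
  gens :: "'g set"
  ins :: "'g \<Rightarrow> 't list"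
  outs :: "'g \<Rightarrow> 't list"

text \<open>
  Objects of the free Markov category are formal tensor words of types; a list of types is read as the
  right-nested word ending in the unit.
\<close>

datatype 't word = WUnit | WVar 't | WTen "'t word" "'t word"

definition wlist :: "'t list \<Rightarrow> 't word" where
  "wlist ts = foldr WTen (map WVar ts) WUnit"

datatype ('t, 'g) mterm =
    TGen 'g
  | TIdt "'t word"
  | TCmp "('t, 'g) mterm" "('t, 'g) mterm"
  | TTen "('t, 'g) mterm" "('t, 'g) mterm"
  | TAsc "'t word" "'t word" "'t word"
  | TAsci "'t word" "'t word" "'t word"
  | TLun "'t word"
  | TLuni "'t word"
  | TRun "'t word"
  | TRuni "'t word"
  | TSwp "'t word" "'t word"
  | TCpy "'t word"
  | TDsc "'t word"

fun tsrc :: "('t, 'g) qsig \<Rightarrow> ('t, 'g) mterm \<Rightarrow> 't word" where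
  "tsrc S (TGen q) = wlist (ins S q)"
| "tsrc S (TIdt a) = a"
| "tsrc S (TCmp g f) = tsrc S f"
| "tsrc S (TTen f g) = WTen (tsrc S f) (tsrc S g)"
| "tsrc S (TAsc a b c) = WTen (WTen a b) c"
| "tsrc S (TAsci a b c) = WTen a (WTen b c)"
| "tsrc S (TLun a) = WTen WUnit a"
| "tsrc S (TLuni a) = a"
| "tsrc S (TRun a) = WTen a WUnit"
| "tsrc S (TRuni a) = a"
| "tsrc S (TSwp a b) = WTen a b"
| "tsrc S (TCpy a) = a"
| "tsrc S (TDsc a) = a"

fun ttgt :: "('t, 'g) qsig \<Rightarrow> ('t, 'g) mterm \<Rightarrow> 't word" where
  "ttgt S (TGen q) = wlist (outs S q)"
| "ttgt S (TIdt a) = a"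
| "ttgt S (TCmp g f) = ttgt S g"
| "ttgt S (TTen f g) = WTen (ttgt S f) (ttgt S g)"
| "ttgt S (TAsc a b c) = WTen a (WTen b c)"
| "ttgt S (TAsci a b c) = WTen (WTen a b) c"
| "ttgt S (TLun a) = a"
| "ttgt S (TLuni a) = WTen WUnit a"
| "ttgt S (TRun a) = a"
| "ttgt S (TRuni a) = WTen a WUnit"
| "ttgt S (TSwp a b) = WTen b a"
| "ttgt S (TCpy a) = WTen a a"
| "ttgt S (TDsc a) = WUnit"

definition words :: "('t, 'g) qsig \<Rightarrow> 't word set" where
  "words S = {w. set_word w \<subseteq> types S}"

fun wf_term :: "('t, 'g) qsig \<Rightarrow> ('t, 'g) mterm \<Rightarrow> bool" where
  "wf_term S (TGen q) \<longleftrightarrow> q \<in> gens S \<and> set (ins S q) \<subseteq> types S \<and> set (outs S q) \<subseteq> types S"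
| "wf_term S (TCmp g f) \<longleftrightarrow> wf_term S g \<and> wf_term S f \<and> ttgt S f = tsrc S g"
| "wf_term S (TTen f g) \<longleftrightarrow> wf_term S f \<and> wf_term S g"
| "wf_term S t \<longleftrightarrow> tsrc S t \<in> words S"

definition term_cat :: "('t, 'g) qsig \<Rightarrow> ('t word, ('t, 'g) mterm) mcat" where
  "term_cat S = \<lparr>
     Obj = words S, Arr = {t. wf_term S t}, src = tsrc S, tgt = ttgt S,
     idt = TIdt, cmp = TCmp, ten = WTen, tenm = TTen, unt = WUnit,
     asc = TAsc, asci = TAsci, lun = TLun, luni = TLuni, run = TRun, runi = TRuni,
     swp = TSwp, cpy = TCpy, dsc = TDsc\<rparr>"

text \<open>
  The least congruence on terms for which the laws of a Markov category hold; it is contained in the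
  relation of being parallel, which is itself such a congruence.  The free Markov category is the
  quotient of the terms by it.
\<close>

definition free_eq :: "('t, 'g) qsig \<Rightarrow> ('t, 'g) mterm \<Rightarrow> ('t, 'g) mterm \<Rightarrow> bool" where
  "free_eq S t u \<longleftrightarrow> (\<forall>E. markov_upto (term_cat S) E \<longrightarrow> E t u)"

definition tcls :: "('t, 'g) qsig \<Rightarrow> ('t, 'g) mterm \<Rightarrow> ('t, 'g) mterm set" where
  "tcls S t = {u. wf_term S u \<and> free_eq S t u}"

definition trep :: "('t, 'g) mterm set \<Rightarrow> ('t, 'g) mterm" where
  "trep K = (SOME t. t \<in> K)"

definition free_markov :: "('t, 'g) qsig \<Rightarrow> ('t word, ('t, 'g) mterm set) mcat" where
  "free_markov S = \<lparr>
     Obj = words S, Arr = tcls S ` {t. wf_term S t},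
     src = (\<lambda>K. tsrc S (trep K)), tgt = (\<lambda>K. ttgt S (trep K)),
     idt = (\<lambda>a. tcls S (TIdt a)),
     cmp = (\<lambda>K K'. tcls S (TCmp (trep K) (trep K'))),
     ten = WTen,
     tenm = (\<lambda>K K'. tcls S (TTen (trep K) (trep K'))),
     unt = WUnit,
     asc = (\<lambda>a b c. tcls S (TAsc a b c)), asci = (\<lambda>a b c. tcls S (TAsci a b c)),
     lun = (\<lambda>a. tcls S (TLun a)), luni = (\<lambda>a. tcls S (TLuni a)),
     run = (\<lambda>a. tcls S (TRun a)), runi = (\<lambda>a. tcls S (TRuni a)),
     swp = (\<lambda>a b. tcls S (TSwp a b)),
     cpy = (\<lambda>a. tcls S (TCpy a)), dsc = (\<lambda>a. tcls S (TDsc a))\<rparr>"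

definition gen_arr :: "('t, 'g) qsig \<Rightarrow> 'g \<Rightarrow> ('t, 'g) mterm set" where
  "gen_arr S q = tcls S (TGen q)"

primrec weval :: "('o, 'm) mcat \<Rightarrow> ('t \<Rightarrow> 'o) \<Rightarrow> 't word \<Rightarrow> 'o" where
  "weval C ob WUnit = unt C"
| "weval C ob (WVar x) = ob x"
| "weval C ob (WTen v w) = weval C ob v \<otimes>\<^bsub>C\<^esub> weval C ob w"

primrec wevalm :: "('o, 'm) mcat \<Rightarrow> ('t \<Rightarrow> 'm) \<Rightarrow> 't word \<Rightarrow> 'm" where
  "wevalm C t WUnit = idt C (unt C)"
| "wevalm C t (WVar x) = t x"
| "wevalm C t (WTen v w) = wevalm C t v \<boxtimes>\<^bsub>C\<^esub> wevalm C t w"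

primrec teval :: "('o, 'm) mcat \<Rightarrow> ('t \<Rightarrow> 'o) \<Rightarrow> ('g \<Rightarrow> 'm) \<Rightarrow> ('t, 'g) mterm \<Rightarrow> 'm" where
  "teval C ob ch (TGen q) = ch q"
| "teval C ob ch (TIdt a) = idt C (weval C ob a)"
| "teval C ob ch (TCmp g f) = teval C ob ch g \<cdot>\<^bsub>C\<^esub> teval C ob ch f"
| "teval C ob ch (TTen f g) = teval C ob ch f \<boxtimes>\<^bsub>C\<^esub> teval C ob ch g"
| "teval C ob ch (TAsc a b c) = asc C (weval C ob a) (weval C ob b) (weval C ob c)"
| "teval C ob ch (TAsci a b c) = asci C (weval C ob a) (weval C ob b) (weval C ob c)"
| "teval C ob ch (TLun a) = lun C (weval C ob a)"
| "teval C ob ch (TLuni a) = luni C (weval C ob a)"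
| "teval C ob ch (TRun a) = run C (weval C ob a)"
| "teval C ob ch (TRuni a) = runi C (weval C ob a)"
| "teval C ob ch (TSwp a b) = swp C (weval C ob a) (weval C ob b)"
| "teval C ob ch (TCpy a) = cpy C (weval C ob a)"
| "teval C ob ch (TDsc a) = dsc C (weval C ob a)"

definition model_of :: "('t, 'g) qsig \<Rightarrow> ('o, 'm) mcat \<Rightarrow> ('t \<Rightarrow> 'o) \<Rightarrow> ('g \<Rightarrow> 'm) \<Rightarrow>
    ('t word, ('t, 'g) mterm set, 'o, 'm) mfun" where
  "model_of S C ob ch = \<lparr>
     fob = restrict (weval C ob) (words S),
     far = restrict (\<lambda>K. teval C ob ch (trep K)) (Arr (free_markov S)),
     fmu = (\<lambda>a b. if a \<in> words S \<and> b \<in> words S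
                  then idt C (weval C ob a \<otimes>\<^bsub>C\<^esub> weval C ob b) else undefined),
     fnu = idt C (unt C)\<rparr>"

definition tens :: "('o, 'm) mcat \<Rightarrow> 'o list \<Rightarrow> 'o" where
  "tens C as = foldr (ten C) as (unt C)"

definition tensm :: "('o, 'm) mcat \<Rightarrow> 'm list \<Rightarrow> 'm" where
  "tensm C fs = foldr (tenm C) fs (idt C (unt C))"

text \<open>\<open>join : tens as \<otimes> tens bs \<rightarrow> tens (as @ bs)\<close>, and its inverse.\<close>

primrec join :: "('o, 'm) mcat \<Rightarrow> 'o list \<Rightarrow> 'o list \<Rightarrow> 'm" where
  "join C [] bs = lun C (tens C bs)"
| "join C (a # as) bs =
     (idt C a \<boxtimes>\<^bsub>C\<^esub> join C as bs) \<cdot>\<^bsub>C\<^esub> asc C a (tens C as) (tens C bs)"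

primrec unjoin :: "('o, 'm) mcat \<Rightarrow> 'o list \<Rightarrow> 'o list \<Rightarrow> 'm" where
  "unjoin C [] bs = luni C (tens C bs)"
| "unjoin C (a # as) bs =
     asci C a (tens C as) (tens C bs) \<cdot>\<^bsub>C\<^esub> (idt C a \<boxtimes>\<^bsub>C\<^esub> unjoin C as bs)"

text \<open>\<open>flat : tens (map tens ass) \<rightarrow> tens (concat ass)\<close>, and its inverse.\<close>

primrec flat :: "('o, 'm) mcat \<Rightarrow> 'o list list \<Rightarrow> 'm" where
  "flat C [] = idt C (unt C)"
| "flat C (as # ass) =
     join C as (concat ass) \<cdot>\<^bsub>C\<^esub> (idt C (tens C as) \<boxtimes>\<^bsub>C\<^esub> flat C ass)"

primrec unflat :: "('o, 'm) mcat \<Rightarrow> 'o list list \<Rightarrow> 'm" where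
  "unflat C [] = idt C (unt C)"
| "unflat C (as # ass) =
     (idt C (tens C as) \<boxtimes>\<^bsub>C\<^esub> unflat C ass) \<cdot>\<^bsub>C\<^esub> unjoin C as (concat ass)"

text \<open>
  Wires labelled by the distinct elements of \<open>xs\<close>, the wire \<open>x\<close> carrying the object \<open>ob x\<close>: \<open>proj xs y\<close>
  selects the wire \<open>y\<close>, and \<open>wire xs ys\<close> outputs a copy of each wire in \<open>ys\<close> and discards the rest.
  If \<open>ys\<close> is a permutation of \<open>xs\<close>, then \<open>wire xs ys\<close> is the corresponding permutation of wires.
\<close>

primrec proj :: "('o, 'm) mcat \<Rightarrow> ('x \<Rightarrow> 'o) \<Rightarrow> 'x list \<Rightarrow> 'x \<Rightarrow> 'm" where
  "proj C ob [] y = undefined"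
| "proj C ob (x # xs) y =
     (if x = y then run C (ob x) \<cdot>\<^bsub>C\<^esub> (idt C (ob x) \<boxtimes>\<^bsub>C\<^esub> dsc C (tens C (map ob xs)))
      else lun C (ob y) \<cdot>\<^bsub>C\<^esub> (dsc C (ob x) \<boxtimes>\<^bsub>C\<^esub> proj C ob xs y))"

primrec wire :: "('o, 'm) mcat \<Rightarrow> ('x \<Rightarrow> 'o) \<Rightarrow> 'x list \<Rightarrow> 'x list \<Rightarrow> 'm" where
  "wire C ob xs [] = dsc C (tens C (map ob xs))"
| "wire C ob xs (y # ys) =
     (proj C ob xs y \<boxtimes>\<^bsub>C\<^esub> wire C ob xs ys) \<cdot>\<^bsub>C\<^esub> cpy C (tens C (map ob xs))"

text \<open>
  \<open>regroup xs yss : tens xs \<rightarrow> tens (map tens yss)\<close>: the wiring of the labels, bracketed into blocks.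
  If \<open>concat yss\<close> is a permutation of \<open>xs\<close>, this is a permutation of wires.
\<close>

primrec regroup :: "('o, 'm) mcat \<Rightarrow> ('x \<Rightarrow> 'o) \<Rightarrow> 'x list \<Rightarrow> 'x list list \<Rightarrow> 'm" where
  "regroup C ob xs [] = dsc C (tens C (map ob xs))"
| "regroup C ob xs (ys # yss) =
     (wire C ob xs ys \<boxtimes>\<^bsub>C\<^esub> regroup C ob xs yss) \<cdot>\<^bsub>C\<^esub> cpy C (tens C (map ob xs))"

text \<open>The tensor of states \<open>I \<rightarrow> a\<^sub>i\<close>, with domain \<open>I\<close>.\<close>

primrec states :: "('o, 'm) mcat \<Rightarrow> 'm list \<Rightarrow> 'm" where
  "states C [] = idt C (unt C)"
| "states C (s # ss) = (s \<boxtimes>\<^bsub>C\<^esub> states C ss) \<cdot>\<^bsub>C\<^esub> luni C (unt C)"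

text \<open>\<open>ncopy m a : a \<rightarrow> tens (replicate m a)\<close>.\<close>

primrec ncopy :: "('o, 'm) mcat \<Rightarrow> nat \<Rightarrow> 'o \<Rightarrow> 'm" where
  "ncopy C 0 a = dsc C a"
| "ncopy C (Suc m) a = (idt C a \<boxtimes>\<^bsub>C\<^esub> ncopy C m a) \<cdot>\<^bsub>C\<^esub> cpy C a"

text \<open>
  For \<open>as\<close> and \<open>bs\<close> of equal length, the permutation
  \<open>tens as \<otimes> tens bs \<rightarrow> tens (map2 (\<otimes>) as bs)\<close>.
\<close>

fun zipten :: "('o, 'm) mcat \<Rightarrow> 'o list \<Rightarrow> 'o list \<Rightarrow> 'm" where
  "zipten C (a # as) (b # bs) =
     (idt C (a \<otimes>\<^bsub>C\<^esub> b) \<boxtimes>\<^bsub>C\<^esub> zipten C as bs) \<cdot>\<^bsub>C\<^esub> mid C a (tens C as) b (tens C bs)"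
| "zipten C _ _ = lun C (unt C)"

text \<open>
  The list \<open>vars\<close> enumerates the endogenous variables (the enumeration also fixes the order in which a
  set of variables is listed), \<open>pa x\<close> is the set of endogenous parents of \<open>x\<close>,
  and \<open>uob x\<close>, \<open>lam x\<close> are the object and the state of the exogenous parent of \<open>x\<close>.
\<close>

record ('v, 'o, 'm) fcm =
  vars :: "'v list"
  pa :: "'v \<Rightarrow> 'v set"
  vob :: "'v \<Rightarrow> 'o"
  uob :: "'v \<Rightarrow> 'o"
  lam :: "'v \<Rightarrow> 'm"
  mech :: "'v \<Rightarrow> 'm"

abbreviation V :: "('v, 'o, 'm) fcm \<Rightarrow> 'v set" where
  "V M \<equiv> set (vars M)"

definition lst :: "('v, 'o, 'm) fcm \<Rightarrow> 'v set \<Rightarrow> 'v list" where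
  "lst M X = filter (\<lambda>x. x \<in> X) (vars M)"

definition vtens :: "('o, 'm) mcat \<Rightarrow> ('v, 'o, 'm) fcm \<Rightarrow> 'v set \<Rightarrow> 'o" where
  "vtens C M X = tens C (map (vob M) (lst M X))"

definition utens :: "('o, 'm) mcat \<Rightarrow> ('v, 'o, 'm) fcm \<Rightarrow> 'o" where
  "utens C M = tens C (map (uob M) (vars M))"

definition functional_causal_model :: "('o, 'm) mcat \<Rightarrow> ('v, 'o, 'm) fcm \<Rightarrow> bool" where
  "functional_causal_model C M \<longleftrightarrow>
     distinct (vars M) \<and>
     acyclic {(y, x). x \<in> V M \<and> y \<in> pa M x} \<and>
     (\<forall>x \<in> V M.
        pa M x \<subseteq> V M \<and> vob M x \<in> Obj C \<and> uob M x \<in> Obj C \<and>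
        lam M x \<in> hom C (unt C) (uob M x) \<and>
        mech M x \<in> hom C (vtens C M (pa M x) \<otimes>\<^bsub>C\<^esub> uob M x) (vob M x) \<and>
        deterministic C (mech M x))"

datatype 'v node = Endo 'v | Exo 'v

primrec nob :: "('v, 'o, 'm) fcm \<Rightarrow> 'v node \<Rightarrow> 'o" where
  "nob M (Endo x) = vob M x"
| "nob M (Exo x) = uob M x"

text \<open>
  The network of mechanisms is evaluated along a topological ordering of the variables (the result
  does not depend on the choice).  \<open>ctx\<close> lists the wires available so far; processing \<open>x\<close> copies the
  wires of the parents of \<open>x\<close>, feeds them into the mechanism of \<open>x\<close>, and adds its output to \<open>ctx\<close>.
\<close>

definition topo_order :: "('v, 'o, 'm) fcm \<Rightarrow> 'v list" where
  "topo_order M = (SOME xs. distinct xs \<and> set xs = V M \<and>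
     (\<forall>i < length xs. pa M (xs ! i) \<subseteq> set (take i xs)))"

primrec run_mechs :: "('o, 'm) mcat \<Rightarrow> ('v, 'o, 'm) fcm \<Rightarrow> 'v node list \<Rightarrow> 'v list \<Rightarrow> 'm" where
  "run_mechs C M ctx [] = idt C (tens C (map (nob M) ctx))"
| "run_mechs C M ctx (x # xs) =
     run_mechs C M (Endo x # ctx) xs \<cdot>\<^bsub>C\<^esub>
     ((mech M x \<cdot>\<^bsub>C\<^esub>
        (wire C (nob M) ctx (map Endo (lst M (pa M x))) \<boxtimes>\<^bsub>C\<^esub> proj C (nob M) ctx (Exo x)) \<cdot>\<^bsub>C\<^esub>
        cpy C (tens C (map (nob M) ctx)))
      \<boxtimes>\<^bsub>C\<^esub> idt C (tens C (map (nob M) ctx))) \<cdot>\<^bsub>C\<^esub>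
     cpy C (tens C (map (nob M) ctx))"

text \<open>The channel \<open>F_Do(X)^Y : U \<otimes> X \<rightarrow> Y\<close>.\<close>

definition do_channel :: "('o, 'm) mcat \<Rightarrow> ('v, 'o, 'm) fcm \<Rightarrow> 'v set \<Rightarrow> 'v set \<Rightarrow> 'm" where
  "do_channel C M X Y =
     (let ctx = map Exo (vars M) @ map Endo (lst M X);
          xs = filter (\<lambda>x. x \<notin> X) (topo_order M)
      in wire C (nob M) (rev (map Endo xs) @ ctx) (map Endo (lst M Y)) \<cdot>\<^bsub>C\<^esub>
         run_mechs C M ctx xs \<cdot>\<^bsub>C\<^esub>
         join C (map (uob M) (vars M)) (map (vob M) (lst M X)))"

text \<open>
  The query \<open>[Y1|X1, \<dots>, Ym|Xm]\<close> is the list of the pairs \<open>(Y\<^sub>j, X\<^sub>j)\<close>.  As inputs (outputs) in the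
  signature it has the concatenation of the lists of the \<open>X\<^sub>j\<close> (of the \<open>Y\<^sub>j\<close>).
\<close>

type_synonym 'v query = "('v set \<times> 'v set) list"

definition blocks_in :: "('v, 'o, 'm) fcm \<Rightarrow> 'v query \<Rightarrow> 'v list list" where
  "blocks_in M q = map (\<lambda>(Y, X). lst M X) q"

definition blocks_out :: "('v, 'o, 'm) fcm \<Rightarrow> 'v query \<Rightarrow> 'v list list" where
  "blocks_out M q = map (\<lambda>(Y, X). lst M Y) q"

definition CF :: "('v, 'o, 'm) fcm \<Rightarrow> ('v, 'v query) qsig" where
  "CF M = \<lparr>
     types = V M,
     gens = {q. \<forall>(Y, X) \<in> set q. Y \<subseteq> V M \<and> X \<subseteq> V M},
     ins = (\<lambda>q. concat (blocks_in M q)),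
     outs = (\<lambda>q. concat (blocks_out M q))\<rparr>"

text \<open>The channel of a query, from \<open>X\<^sub>1 \<otimes> \<dots> \<otimes> X\<^sub>m\<close> to \<open>Y\<^sub>1 \<otimes> \<dots> \<otimes> Y\<^sub>m\<close>.\<close>

definition cf_channel :: "('o, 'm) mcat \<Rightarrow> ('v, 'o, 'm) fcm \<Rightarrow> 'v query \<Rightarrow> 'm" where
  "cf_channel C M q =
     (let m = length q;
          U = utens C M;
          Xs = map (\<lambda>(Y, X). vtens C M X) q
      in tensm C (map (\<lambda>(Y, X). do_channel C M X Y) q) \<cdot>\<^bsub>C\<^esub>
         zipten C (replicate m U) Xs \<cdot>\<^bsub>C\<^esub>
         ((ncopy C m U \<cdot>\<^bsub>C\<^esub> states C (map (lam M) (vars M))) \<boxtimes>\<^bsub>C\<^esub> idt C (tens C Xs)) \<cdot>\<^bsub>C\<^esub>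
         luni C (tens C Xs))"

definition fcm_model :: "('o, 'm) mcat \<Rightarrow> ('v, 'o, 'm) fcm \<Rightarrow>
    ('v word, ('v, 'v query) mterm set, 'o, 'm) mfun" where
  "fcm_model C M = model_of (CF M) C (vob M)
     (\<lambda>q. flat C (map (map (vob M)) (blocks_out M q)) \<cdot>\<^bsub>C\<^esub> cf_channel C M q \<cdot>\<^bsub>C\<^esub>
          unflat C (map (map (vob M)) (blocks_in M q)))"

text \<open>
  Since \<open>\<pi>\<close> is strong monoidal, \<open>\<pi>\<close> of a list of types is only isomorphic to a list of types; hence
  "sending a query to a query" is understood up to deterministic isomorphisms of the domain and the
  codomain.
\<close>

definition downward_abstraction ::
  "('o, 'm) mcat \<Rightarrow>
   ('t, 'g) qsig \<Rightarrow> ('t word, ('t, 'g) mterm set, 'o, 'm) mfun \<Rightarrow>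
   ('s, 'h) qsig \<Rightarrow> ('s word, ('s, 'h) mterm set, 'o, 'm) mfun \<Rightarrow>
   ('s word, ('s, 'h) mterm set, 't word, ('t, 'g) mterm set) mfun \<times> ('s word \<Rightarrow> 'm) \<Rightarrow> bool" where
  "downward_abstraction C QL L QH H = (\<lambda>(\<pi>, \<tau>).
     markov_functor (free_markov QL) C L \<and>
     markov_functor (free_markov QH) C H \<and>
     markov_functor (free_markov QH) (free_markov QL) \<pi> \<and>
     (\<forall>q \<in> gens QH. \<exists>q' \<in> gens QL.
        \<exists>a \<in> hom (free_markov QL) (fob \<pi> (wlist (ins QH q))) (wlist (ins QL q')).
        \<exists>b \<in> hom (free_markov QL) (wlist (outs QL q')) (fob \<pi> (wlist (outs QH q))).
          iso_arr (free_markov QL) a \<and> deterministic (free_markov QL) a \<and>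
          iso_arr (free_markov QL) b \<and> deterministic (free_markov QL) b \<and>
          far \<pi> (gen_arr QH q) =
            b \<cdot>\<^bsub>free_markov QL\<^esub> gen_arr QL q' \<cdot>\<^bsub>free_markov QL\<^esub> a) \<and>
     markov_nat (free_markov QH) C (fcomp (free_markov QH) C L \<pi>) H \<tau> \<and>
     (\<forall>w \<in> Obj (free_markov QH). epic C (\<tau> w)))"

text \<open>
  The canonical isomorphism \<open>tens (map F as) \<rightarrow> F (tens as)\<close> of a strong monoidal functor \<open>F : C \<rightarrow> D\<close>.
\<close>

primrec fcoh :: "('o, 'm) mcat \<Rightarrow> ('p, 'n) mcat \<Rightarrow> ('o, 'm, 'p, 'n) mfun \<Rightarrow> 'o list \<Rightarrow> 'n" where
  "fcoh C D F [] = fnu F"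
| "fcoh C D F (a # as) =
     fmu F a (tens C as) \<cdot>\<^bsub>D\<^esub> (idt D (fob F a) \<boxtimes>\<^bsub>D\<^esub> fcoh C D F as)"

definition img :: "('w \<Rightarrow> 'v set) \<Rightarrow> 'w set \<Rightarrow> 'v set" where
  "img P S = (\<Union>x \<in> S. P x)"

definition img_query :: "('w \<Rightarrow> 'v set) \<Rightarrow> 'w query \<Rightarrow> 'v query" where
  "img_query P q = map (\<lambda>(Y, X). (img P Y, img P X)) q"

text \<open>
  For blocks of variables \<open>S\<^sub>1, \<dots>, S\<^sub>m\<close> of \<open>H\<close>, the canonical isomorphism from the list
  \<open>\<pi>(S\<^sub>1), \<dots>, \<pi>(S\<^sub>m)\<close> of variables of \<open>L\<close> to the image under \<open>\<pi>\<close> of the list \<open>S\<^sub>1, \<dots>, S\<^sub>m\<close>: permute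
  the wires of each \<open>\<pi>(S\<^sub>j)\<close> into the blocks \<open>\<pi>(x)\<close>, \<open>x \<in> S\<^sub>j\<close>, then apply the structure
  isomorphisms of \<open>\<pi>\<close>.
\<close>

definition img_iso :: "('v, 'o, 'm) fcm \<Rightarrow> ('w, 'o, 'm) fcm \<Rightarrow> ('w \<Rightarrow> 'v set) \<Rightarrow>
    ('w word, ('w, 'w query) mterm set, 'v word, ('v, 'v query) mterm set) mfun \<Rightarrow>
    'w list list \<Rightarrow> ('v, 'v query) mterm set" where
  "img_iso L H P \<pi> Ss =
     (let QL = free_markov (CF L); QH = free_markov (CF H);
          low = (\<lambda>S. lst L (img P (set S)))
      in fcoh QH QL \<pi> (map WVar (concat Ss)) \<cdot>\<^bsub>QL\<^esub>
         flat QL (map (map (\<lambda>x. fob \<pi> (WVar x))) Ss) \<cdot>\<^bsub>QL\<^esub>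
         tensm QL (map (\<lambda>S. regroup QL WVar (low S) (map (\<lambda>x. lst L (P x)) S)) Ss) \<cdot>\<^bsub>QL\<^esub>
         unflat QL (map (\<lambda>S. map WVar (low S)) Ss))"

text \<open>
  The condition \<open>\<pi>([Y1|X1, \<dots>, Ym|Xm]) = [\<pi>(Y1)|\<pi>(X1), \<dots>, \<pi>(Ym)|\<pi>(Xm)]\<close>: each \<open>\<pi>(x)\<close> is (the list of) a set \<open>P x\<close> of
  variables, for each set \<open>S\<close> the list \<open>\<pi>(S)\<close> has distinct elements and so is a set of variables up to
  permutation, and the two queries agree along the canonical isomorphisms.
\<close>

definition preserves_cf_queries :: "('v, 'o, 'm) fcm \<Rightarrow> ('w, 'o, 'm) fcm \<Rightarrow> ('w \<Rightarrow> 'v set) \<Rightarrow>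
    ('w word, ('w, 'w query) mterm set, 'v word, ('v, 'v query) mterm set) mfun \<Rightarrow> bool" where
  "preserves_cf_queries L H P \<pi> \<longleftrightarrow>
     (\<forall>x \<in> V H. P x \<subseteq> V L \<and> fob \<pi> (WVar x) = wlist (lst L (P x))) \<and>
     (\<forall>S \<subseteq> V H. distinct (concat (map (\<lambda>x. lst L (P x)) (lst H S)))) \<and>
     (\<forall>q \<in> gens (CF H).
        far \<pi> (gen_arr (CF H) q) \<cdot>\<^bsub>free_markov (CF L)\<^esub> img_iso L H P \<pi> (blocks_in H q) =
        img_iso L H P \<pi> (blocks_out H q) \<cdot>\<^bsub>free_markov (CF L)\<^esub>
          gen_arr (CF L) (img_query P q))"

definition cf_downward_abstractions :: "('o, 'm) mcat \<Rightarrow> ('v, 'o, 'm) fcm \<Rightarrow> ('w, 'o, 'm) fcm \<Rightarrow>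
    (('w word, ('w, 'w query) mterm set, 'v word, ('v, 'v query) mterm set) mfun \<times>
     ('w word \<Rightarrow> 'm)) set" where
  "cf_downward_abstractions C L H = {(\<pi>, \<tau>).
     downward_abstraction C (CF L) (fcm_model C L) (CF H) (fcm_model C H) (\<pi>, \<tau>) \<and>
     (\<exists>P. preserves_cf_queries L H P \<pi>)}"

text \<open>
  Two downward abstractions are identified if they differ by a monoidal natural isomorphism between
  the functors which is the identity on variables and compatible with the transformations \<open>\<tau>\<close>.
\<close>

definition same_abstraction :: "('o, 'm) mcat \<Rightarrow> ('v, 'o, 'm) fcm \<Rightarrow> ('w, 'o, 'm) fcm \<Rightarrow>
    ('w word, ('w, 'w query) mterm set, 'v word, ('v, 'v query) mterm set) mfun \<times>
      ('w word \<Rightarrow> 'm) \<Rightarrow>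
    ('w word, ('w, 'w query) mterm set, 'v word, ('v, 'v query) mterm set) mfun \<times>
      ('w word \<Rightarrow> 'm) \<Rightarrow> bool" where
  "same_abstraction C L H = (\<lambda>(\<pi>, \<tau>) (\<pi>', \<tau>').
     \<exists>\<alpha>. markov_nat (free_markov (CF H)) (free_markov (CF L)) \<pi> \<pi>' \<alpha> \<and>
         (\<forall>w \<in> Obj (free_markov (CF H)). iso_arr (free_markov (CF L)) (\<alpha> w)) \<and>
         (\<forall>x \<in> V H. \<alpha> (WVar x) = idt (free_markov (CF L)) (fob \<pi> (WVar x))) \<and>
         (\<forall>w \<in> Obj (free_markov (CF H)). \<tau>' w \<cdot>\<^bsub>C\<^esub> far (fcm_model C L) (\<alpha> w) = \<tau> w))"

text \<open>\<open>\<tau>\<^sub>S : \<pi>(S) \<rightarrow> S\<close>, the tensor of the \<open>\<tau>\<^sub>x\<close> for \<open>x \<in> S\<close>.\<close>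

definition tau_set :: "('o, 'm) mcat \<Rightarrow> ('v, 'o, 'm) fcm \<Rightarrow> ('w, 'o, 'm) fcm \<Rightarrow>
    ('w \<Rightarrow> 'v set) \<Rightarrow> ('w \<Rightarrow> 'm) \<Rightarrow> 'w set \<Rightarrow> 'm" where
  "tau_set C L H P t S =
     tensm C (map t (lst H S)) \<cdot>\<^bsub>C\<^esub>
     regroup C (vob L) (lst L (img P S)) (map (\<lambda>x. lst L (P x)) (lst H S))"

definition cf_abstractions :: "('o, 'm) mcat \<Rightarrow> ('v, 'o, 'm) fcm \<Rightarrow> ('w, 'o, 'm) fcm \<Rightarrow>
    (('w \<Rightarrow> 'v set) \<times> ('w \<Rightarrow> 'm)) set" where
  "cf_abstractions C L H = {(P, t).
     P \<in> extensional (V H) \<and> t \<in> extensional (V H) \<and>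
     (\<forall>x \<in> V H. P x \<subseteq> V L) \<and>
     (\<forall>x \<in> V H. \<forall>y \<in> V H. x \<noteq> y \<longrightarrow> P x \<inter> P y = {}) \<and>
     (\<forall>x \<in> V H. t x \<in> hom C (vtens C L (P x)) (vob H x) \<and> deterministic C (t x)) \<and>
     (\<forall>w. set_word w \<subseteq> V H \<longrightarrow> epic C (wevalm C t w)) \<and>
     (\<forall>q \<in> gens (CF H).
        tensm C (map (\<lambda>(Y, X). tau_set C L H P t Y) q) \<cdot>\<^bsub>C\<^esub> cf_channel C L (img_query P q) =
        cf_channel C H q \<cdot>\<^bsub>C\<^esub> tensm C (map (\<lambda>(Y, X). tau_set C L H P t X) q))}"

text \<open>
  The restriction of \<open>(\<pi>, \<tau>)\<close> to variables: \<open>\<pi>(x)\<close> is recorded as the set of variables occurring in it.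
\<close>

definition restrict_to_vars :: "('w, 'o, 'm) fcm \<Rightarrow>
    ('w word, 'k, 'v word, 'l) mfun \<times> ('w word \<Rightarrow> 'm) \<Rightarrow> ('w \<Rightarrow> 'v set) \<times> ('w \<Rightarrow> 'm)" where
  "restrict_to_vars H = (\<lambda>(\<pi>, \<tau>).
     (restrict (\<lambda>x. set_word (fob \<pi> (WVar x))) (V H), restrict (\<lambda>x. \<tau> (WVar x)) (V H)))"

end

theory Submission
  imports Defs
begin

text \<open>
  A downward abstraction is determined by its values on variables, because the category of queries is
  free and the query condition fixes the functor on generators up to permuting and rebracketing wires.
  The condition has content only if these permutations are invertible: deterministic morphisms form a
  cartesian category, so a wiring is a tuple of projections, and wirings along a duplicate-free
  relabelling are mutually inverse.  Conjugating generators by them turns naturality of \<open>\<tau>\<close> at a query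
  into the abstraction equation for that query, and naturality at all other morphisms is automatic since
  the components are deterministic.  Two functors that agree on variables are compared by the
  isomorphism built from their structure isomorphisms, which is the identity if both are strict.
\<close>

section \<open>Markov categories\<close>

text \<open>The obstacle is that neither \<open>C\<close> nor \<open>\<pi>\<close> is strict. A
  generator has a flat word of types ending in \<open>WUnit\<close> as its domain, the channel of a
  query has a tensor of blocks, and \<open>\<pi>\<close> sends a word to an object only isomorphic
  to the word of the images. Three isomorphisms mediate: \<open>flat\<close> between blocks and flat
  lists, \<open>regroup\<close> between a listing of \<open>\<pi>(S)\<close> and the listing of its
  blocks \<open>\<pi>(x)\<close>, and \<open>fcoh\<close> for the structure maps of
  \<open>\<pi>\<close>. Only \<open>fcoh\<close> depends on more than \<open>P\<close>, which is why
  two functors with the same \<open>P\<close> can be compared. A downward abstraction asks for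
  deterministic isomorphisms, but the Markov laws assert determinism of no structure map. It is
  derived from projections and pairing, and this needs coherence laws for units that are not among
  the axioms and follow from pentagon, triangle and hexagon. The causal models enter through the
  types of their query channels; acyclicity supplies the order in which every mechanism finds its
  inputs.\<close>

locale markov =
  fixes C :: "('o, 'm) mcat" (structure)
  assumes markov: "markov_category C"

sublocale markov \<subseteq> markov_upto C "(=)"
  using markov by (simp add: markov_category_def)

context markov
begin

section \<open>Typing rules and the normal form of composites\<close>

lemma homI: "f \<in> Arr C \<Longrightarrow> src C f = a \<Longrightarrow> tgt C f = b \<Longrightarrow> f \<in> hom C a b"
  by (simp add: hom_def)

declare src_obj [simp] tgt_obj [simp] unt_obj [simp] ten_obj [simp]

text \<open>Typing is recast here and below as equations for \<open>src\<close> and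
  \<open>tgt\<close>: membership in \<open>hom\<close> leaves intermediate objects to be guessed,
  whereas equations let the simplifier discharge composability conditions.\<close>

lemma idt_arr [simp]:
  "a \<in> Obj C \<Longrightarrow> idt C a \<in> Arr C" "a \<in> Obj C \<Longrightarrow> src C (idt C a) = a" "a \<in> Obj C \<Longrightarrow> tgt C (idt C a) = a"
  using idt_hom[of a] by (auto simp: hom_def)

lemma cmp_arr [simp]:
  assumes "f \<in> Arr C" "g \<in> Arr C" "tgt C f = src C g"
  shows "g \<cdot> f \<in> Arr C" "src C (g \<cdot> f) = src C f" "tgt C (g \<cdot> f) = tgt C g"
  using cmp_hom[of f "src C f" "tgt C f" g "tgt C g"] assms by (auto simp: hom_def)

lemma tenm_arr [simp]:
  assumes "f \<in> Arr C" "g \<in> Arr C"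
  shows "f \<boxtimes> g \<in> Arr C" "src C (f \<boxtimes> g) = src C f \<otimes> src C g" "tgt C (f \<boxtimes> g) = tgt C f \<otimes> tgt C g"
  using tenm_hom[of f "src C f" "tgt C f" g "src C g" "tgt C g"] assms by (auto simp: hom_def)

lemma asc_arr [simp]:
  assumes "a \<in> Obj C" "b \<in> Obj C" "c \<in> Obj C"
  shows "asc C a b c \<in> Arr C" "src C (asc C a b c) = (a \<otimes> b) \<otimes> c" "tgt C (asc C a b c) = a \<otimes> (b \<otimes> c)"
    "asci C a b c \<in> Arr C" "src C (asci C a b c) = a \<otimes> (b \<otimes> c)" "tgt C (asci C a b c) = (a \<otimes> b) \<otimes> c"
  using asc_hom[OF assms] asci_hom[OF assms] by (auto simp: hom_def)

lemma unitor_arr [simp]: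
  assumes "a \<in> Obj C"
  shows "lun C a \<in> Arr C" "src C (lun C a) = unt C \<otimes> a" "tgt C (lun C a) = a"
    "luni C a \<in> Arr C" "src C (luni C a) = a" "tgt C (luni C a) = unt C \<otimes> a"
    "run C a \<in> Arr C" "src C (run C a) = a \<otimes> unt C" "tgt C (run C a) = a"
    "runi C a \<in> Arr C" "src C (runi C a) = a" "tgt C (runi C a) = a \<otimes> unt C"
  using lun_hom[OF assms] luni_hom[OF assms] run_hom[OF assms] runi_hom[OF assms]
  by (auto simp: hom_def)

lemma swp_arr [simp]:
  assumes "a \<in> Obj C" "b \<in> Obj C"
  shows "swp C a b \<in> Arr C" "src C (swp C a b) = a \<otimes> b" "tgt C (swp C a b) = b \<otimes> a"
  using swp_hom[OF assms] by (auto simp: hom_def)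

lemma cpy_dsc_arr [simp]:
  assumes "a \<in> Obj C"
  shows "cpy C a \<in> Arr C" "src C (cpy C a) = a" "tgt C (cpy C a) = a \<otimes> a"
    "dsc C a \<in> Arr C" "src C (dsc C a) = a" "tgt C (dsc C a) = unt C"
  using cpy_hom[OF assms] dsc_hom[OF assms] by (auto simp: hom_def)

lemma assoc [simp]:
  assumes "f \<in> Arr C" "g \<in> Arr C" "h \<in> Arr C" "tgt C f = src C g" "tgt C g = src C h"
  shows "(h \<cdot> g) \<cdot> f = h \<cdot> g \<cdot> f"
  using cmp_assoc[of f "src C f" "src C g" g "src C h" h "tgt C h"] assms by (auto simp: hom_def)

lemma idt_cmp [simp]:
  "f \<in> Arr C \<Longrightarrow> tgt C f = b \<Longrightarrow> idt C b \<cdot> f = f"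
  "f \<in> Arr C \<Longrightarrow> src C f = a \<Longrightarrow> f \<cdot> idt C a = f"
  using idt_left idt_right by (auto simp: hom_def)

declare tenm_idt [simp]

text \<open>Composites are normalized to the right, so an equation for \<open>g \<cdot> f\<close>
  does not match inside a longer chain. This rule makes it usable at the head of one; instances
  \<open>pull[OF law]\<close> recur throughout.\<close>

lemma pull:
  assumes "g \<cdot> f = h" "f \<in> Arr C" "g \<in> Arr C" "k \<in> Arr C" "tgt C k = src C f" "tgt C f = src C g"
  shows "g \<cdot> f \<cdot> k = h \<cdot> k"
  using assms assoc[of k f g] by simp

text \<open>The interchange law is oriented so that neighbouring tensors fuse into one. Steps that
  need the layers kept apart delete \<open>merge\<close> and \<open>merge_left\<close>
  again.\<close>

lemma merge [simp]:
  assumes "f \<in> Arr C" "g \<in> Arr C" "f' \<in> Arr C" "g' \<in> Arr C" "tgt C f = src C g" "tgt C f' = src C g'"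
  shows "(g \<boxtimes> g') \<cdot> (f \<boxtimes> f') = (g \<cdot> f) \<boxtimes> (g' \<cdot> f')"
  using tenm_cmp[of f "src C f" "src C g" g "tgt C g" f' "src C f'" "src C g'" g' "tgt C g'"] assms
  by (simp add: hom_def)

lemma merge_left [simp]:
  assumes "f \<in> Arr C" "g \<in> Arr C" "f' \<in> Arr C" "g' \<in> Arr C" "tgt C f = src C g" "tgt C f' = src C g'"
    "k \<in> Arr C" "tgt C k = src C f \<otimes> src C f'"
  shows "(g \<boxtimes> g') \<cdot> (f \<boxtimes> f') \<cdot> k = ((g \<cdot> f) \<boxtimes> (g' \<cdot> f')) \<cdot> k"
  by (rule pull) (use assms in simp_all)

declare asc_asci [simp] asci_asc [simp] lun_luni [simp] luni_lun [simp] run_runi [simp] runi_run [simp]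
  swp_swp [simp]

lemma asc_inverse_left [simp]:
  assumes "a \<in> Obj C" "b \<in> Obj C" "c \<in> Obj C" "k \<in> Arr C"
  shows "tgt C k = a \<otimes> (b \<otimes> c) \<Longrightarrow> asc C a b c \<cdot> asci C a b c \<cdot> k = k"
    "tgt C k = (a \<otimes> b) \<otimes> c \<Longrightarrow> asci C a b c \<cdot> asc C a b c \<cdot> k = k"
  using pull[OF asc_asci, of a b c k] pull[OF asci_asc, of a b c k] assms by simp_all

lemma unitor_inverse_left [simp]:
  assumes "a \<in> Obj C" "k \<in> Arr C"
  shows "tgt C k = a \<Longrightarrow> lun C a \<cdot> luni C a \<cdot> k = k"
    "tgt C k = unt C \<otimes> a \<Longrightarrow> luni C a \<cdot> lun C a \<cdot> k = k"
    "tgt C k = a \<Longrightarrow> run C a \<cdot> runi C a \<cdot> k = k"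
    "tgt C k = a \<otimes> unt C \<Longrightarrow> runi C a \<cdot> run C a \<cdot> k = k"
  using pull[OF lun_luni, of a k] pull[OF luni_lun, of a k] pull[OF run_runi, of a k]
    pull[OF runi_run, of a k] assms by simp_all

lemma swp_swp_left [simp]:
  assumes "a \<in> Obj C" "b \<in> Obj C" "k \<in> Arr C"
  shows "tgt C k = a \<otimes> b \<Longrightarrow> swp C b a \<cdot> swp C a b \<cdot> k = k"
  using pull[OF swp_swp, of a b k] assms by simp

lemma asc_nat:
  assumes "f \<in> Arr C" "g \<in> Arr C" "h \<in> Arr C" "a' = tgt C f" "b' = tgt C g" "c' = tgt C h"
  shows "asc C a' b' c' \<cdot> ((f \<boxtimes> g) \<boxtimes> h) =
    (f \<boxtimes> (g \<boxtimes> h)) \<cdot> asc C (src C f) (src C g) (src C h)"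
  using asc_natural[of f "src C f" "tgt C f" g "src C g" "tgt C g" h "src C h" "tgt C h"] assms
  by (simp add: hom_def)

lemma lun_nat:
  assumes "f \<in> Arr C" "b = tgt C f"
  shows "lun C b \<cdot> (idt C (unt C) \<boxtimes> f) = f \<cdot> lun C (src C f)"
  using lun_natural[of f "src C f" "tgt C f"] assms by (simp add: hom_def)

lemma run_nat:
  assumes "f \<in> Arr C" "b = tgt C f"
  shows "run C b \<cdot> (f \<boxtimes> idt C (unt C)) = f \<cdot> run C (src C f)"
  using run_natural[of f "src C f" "tgt C f"] assms by (simp add: hom_def)

lemma swp_nat:
  assumes "f \<in> Arr C" "g \<in> Arr C" "a = tgt C f" "b = tgt C g"
  shows "swp C a b \<cdot> (f \<boxtimes> g) = (g \<boxtimes> f) \<cdot> swp C (src C f) (src C g)"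
  using swp_natural[of f "src C f" "tgt C f" g "src C g" "tgt C g"] assms by (simp add: hom_def)

lemma cancel_epi:
  assumes "g \<cdot> i = h \<cdot> i" "i \<cdot> j = idt C (tgt C i)" "i \<in> Arr C" "j \<in> Arr C" "g \<in> Arr C" "h \<in> Arr C"
    "src C g = tgt C i" "src C h = tgt C i" "tgt C j = src C i" 
  shows "g = h"
proof -
  have "(g \<cdot> i) \<cdot> j = (h \<cdot> i) \<cdot> j" using assms by simp
  then show ?thesis using assms(2-) by simp
qed

lemma cancel_mono:
  assumes "i \<cdot> g = i \<cdot> h" "j \<cdot> i = idt C (src C i)" "i \<in> Arr C" "j \<in> Arr C" "g \<in> Arr C" "h \<in> Arr C"
    "tgt C g = src C i" "tgt C h = src C i" "tgt C i = src C j"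
  shows "g = h"
proof -
  have "j \<cdot> i \<cdot> g = j \<cdot> i \<cdot> h" using assms by simp
  then show ?thesis using assms(2-) by (simp add: pull[OF assms(2)])
qed

section \<open>Terminality of the unit and coherence of the unit constraints\<close>

lemma to_unt: "f \<in> Arr C \<Longrightarrow> tgt C f = unt C \<Longrightarrow> f = dsc C (src C f)"
  using terminal[of f "src C f"] by (simp add: hom_def)

lemma to_unt_eq:
  "f \<in> Arr C \<Longrightarrow> g \<in> Arr C \<Longrightarrow> tgt C f = unt C \<Longrightarrow> tgt C g = unt C \<Longrightarrow> src C f = src C g \<Longrightarrow> f = g"
  using to_unt by metis

lemma dsc_cmp [simp]: "f \<in> Arr C \<Longrightarrow> tgt C f = a \<Longrightarrow> dsc C a \<cdot> f = dsc C (src C f)"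
  by (rule to_unt_eq) auto

lemma dsc_unt [simp]: "dsc C (unt C) = idt C (unt C)"
  by (rule to_unt_eq) auto

text \<open>Naturality of the unitors turns tensoring with the unit into conjugation by
  isomorphisms. The next three laws can thus be proved after tensoring with the unit, where
  pentagon, triangle and hexagon apply.\<close>

lemma tenm_unt_faithful:
  assumes "f \<in> Arr C" "g \<in> Arr C" "src C f = src C g" "tgt C f = tgt C g"
  shows "idt C (unt C) \<boxtimes> f = idt C (unt C) \<boxtimes> g \<Longrightarrow> f = g" "f \<boxtimes> idt C (unt C) = g \<boxtimes> idt C (unt C) \<Longrightarrow> f = g"
proof -
  assume "idt C (unt C) \<boxtimes> f = idt C (unt C) \<boxtimes> g"
  then have "f \<cdot> lun C (src C f) = g \<cdot> lun C (src C f)"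
    using lun_nat[of f] lun_nat[of g] assms by simp
  then show "f = g"
    by (rule cancel_epi[where j = "luni C (src C f)"]) (use assms in simp_all)
next
  assume "f \<boxtimes> idt C (unt C) = g \<boxtimes> idt C (unt C)"
  then have "f \<cdot> run C (src C f) = g \<cdot> run C (src C f)"
    using run_nat[of f] run_nat[of g] assms by simp
  then show "f = g"
    by (rule cancel_epi[where j = "runi C (src C f)"]) (use assms in simp_all)
qed

text \<open>Kelly's argument: the pentagon whose first two objects are units, combined with the
  triangle, gives this law tensored with the unit on the left.\<close>

lemma lun_asc:
  assumes [simp]: "a \<in> Obj C" "b \<in> Obj C"
  shows "lun C (a \<otimes> b) \<cdot> asc C (unt C) a b = lun C a \<boxtimes> idt C b"
proof -
  let ?I = "unt C"
  \<comment> \<open>\<open>?X\<close> is the part of the pentagon that is cancelled at the end;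
    \<open>?Y\<close> is its inverse.\<close>
  let ?X = "asc C ?I (?I \<otimes> a) b \<cdot> (asc C ?I ?I a \<boxtimes> idt C b)"
  let ?Y = "(asci C ?I ?I a \<boxtimes> idt C b) \<cdot> asci C ?I (?I \<otimes> a) b"
  have "(idt C ?I \<boxtimes> (lun C (a \<otimes> b) \<cdot> asc C ?I a b)) \<cdot> ?X =
      (idt C ?I \<boxtimes> lun C (a \<otimes> b)) \<cdot> asc C ?I ?I (a \<otimes> b) \<cdot> asc C (?I \<otimes> ?I) a b"
    by (simp add: pentagon)
  also have "\<dots> = (run C ?I \<boxtimes> (idt C a \<boxtimes> idt C b)) \<cdot> asc C (?I \<otimes> ?I) a b"
    by (subst pull[OF triangle]) auto
  also have "\<dots> = asc C ?I a b \<cdot> ((run C ?I \<boxtimes> idt C a) \<boxtimes> idt C b)"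
    by (subst asc_nat) auto
  also have "\<dots> = asc C ?I a b \<cdot> ((idt C ?I \<boxtimes> lun C a) \<boxtimes> idt C b) \<cdot> (asc C ?I ?I a \<boxtimes> idt C b)"
    by (simp add: triangle)
  also have "\<dots> = (idt C ?I \<boxtimes> (lun C a \<boxtimes> idt C b)) \<cdot> ?X"
    by (subst pull[OF asc_nat]) auto
  finally have "idt C ?I \<boxtimes> (lun C (a \<otimes> b) \<cdot> asc C ?I a b) = idt C ?I \<boxtimes> (lun C a \<boxtimes> idt C b)"
    by (rule cancel_epi[where j = ?Y]) auto
  then show ?thesis by (rule tenm_unt_faithful(1)[rotated 4]) auto
qed

text \<open>Mirror image of \<open>lun_asc\<close>, from the pentagon whose last two objects are
  units.\<close>

lemma run_asc:
  assumes [simp]: "a \<in> Obj C" "b \<in> Obj C"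
  shows "(idt C a \<boxtimes> run C b) \<cdot> asc C a b (unt C) = run C (a \<otimes> b)"
proof -
  let ?I = "unt C"
  have "asc C a b ?I \<cdot> (((idt C a \<boxtimes> run C b) \<cdot> asc C a b ?I) \<boxtimes> idt C ?I) =
      asc C a b ?I \<cdot> ((idt C a \<boxtimes> run C b) \<boxtimes> idt C ?I) \<cdot> (asc C a b ?I \<boxtimes> idt C ?I)"
    by simp
  also have "\<dots> = (idt C a \<boxtimes> (run C b \<boxtimes> idt C ?I)) \<cdot> asc C a (b \<otimes> ?I) ?I \<cdot> (asc C a b ?I \<boxtimes> idt C ?I)"
    by (subst pull[OF asc_nat]) auto
  also have "\<dots> = (idt C a \<boxtimes> (idt C b \<boxtimes> lun C ?I)) \<cdot> (idt C a \<boxtimes> asc C b ?I ?I) \<cdot>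
      asc C a (b \<otimes> ?I) ?I \<cdot> (asc C a b ?I \<boxtimes> idt C ?I)"
    by (simp add: triangle)
  also have "\<dots> = (idt C a \<boxtimes> (idt C b \<boxtimes> lun C ?I)) \<cdot> asc C a b (?I \<otimes> ?I) \<cdot> asc C (a \<otimes> b) ?I ?I"
    by (subst pentagon) auto
  also have "\<dots> = asc C a b ?I \<cdot> ((idt C a \<boxtimes> idt C b) \<boxtimes> lun C ?I) \<cdot> asc C (a \<otimes> b) ?I ?I"
    by (subst pull[OF asc_nat]) auto
  also have "\<dots> = asc C a b ?I \<cdot> (run C (a \<otimes> b) \<boxtimes> idt C ?I)"
    by (simp add: triangle)
  finally have "((idt C a \<boxtimes> run C b) \<cdot> asc C a b ?I) \<boxtimes> idt C ?I = run C (a \<otimes> b) \<boxtimes> idt C ?I"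
    by (rule cancel_mono[where j = "asci C a b ?I"]) auto
  then show ?thesis by (rule tenm_unt_faithful(2)[rotated 4]) auto
qed

text \<open>The hexagon at \<open>a\<close> and two units reduces, by \<open>lun_asc\<close> and the
  triangle, to this law tensored with the unit; the leading \<open>swp\<close> then cancels.\<close>

lemma lun_swp:
  assumes [simp]: "a \<in> Obj C"
  shows "lun C a \<cdot> swp C a (unt C) = run C a"
proof -
  let ?I = "unt C"
  have "swp C a ?I \<cdot> ((lun C a \<cdot> swp C a ?I) \<boxtimes> idt C ?I) =
      swp C a ?I \<cdot> (lun C a \<boxtimes> idt C ?I) \<cdot> (swp C a ?I \<boxtimes> idt C ?I)"
    by simp
  also have "\<dots> = swp C a ?I \<cdot> lun C (a \<otimes> ?I) \<cdot> asc C ?I a ?I \<cdot> (swp C a ?I \<boxtimes> idt C ?I)"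
    by (simp add: lun_asc[symmetric])
  also have "\<dots> = lun C (?I \<otimes> a) \<cdot> (idt C ?I \<boxtimes> swp C a ?I) \<cdot> asc C ?I a ?I \<cdot> (swp C a ?I \<boxtimes> idt C ?I)"
    by (subst pull[OF lun_nat]) auto
  also have "\<dots> = lun C (?I \<otimes> a) \<cdot> asc C ?I ?I a \<cdot> swp C a (?I \<otimes> ?I) \<cdot> asc C a ?I ?I"
    by (subst hexagon) auto
  also have "\<dots> = (lun C ?I \<boxtimes> idt C a) \<cdot> swp C a (?I \<otimes> ?I) \<cdot> asc C a ?I ?I"
    by (subst pull[OF lun_asc]) auto
  also have "\<dots> = swp C a ?I \<cdot> (idt C a \<boxtimes> lun C ?I) \<cdot> asc C a ?I ?I"
    by (subst pull[OF swp_nat]) auto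
  also have "\<dots> = swp C a ?I \<cdot> (run C a \<boxtimes> idt C ?I)"
    by (simp add: triangle)
  finally have "(lun C a \<cdot> swp C a ?I) \<boxtimes> idt C ?I = run C a \<boxtimes> idt C ?I"
    by (rule cancel_mono[where j = "swp C ?I a"]) auto
  then show ?thesis by (rule tenm_unt_faithful(2)[rotated 4]) auto
qed

lemma run_swp:
  assumes [simp]: "a \<in> Obj C"
  shows "run C a \<cdot> swp C (unt C) a = lun C a"
  by (simp add: lun_swp[symmetric])

text \<open>Followed by \<open>lun\<close>, both sides end in the terminal unit, and
  \<open>lun\<close> is invertible.\<close>

lemma swp_unt: "swp C (unt C) (unt C) = idt C (unt C \<otimes> unt C)"
  by (rule cancel_mono[where i = "lun C (unt C)" and j = "luni C (unt C)"]) (simp_all add: to_unt_eq)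

text \<open>Since \<open>lun\<close> at the unit is invertible, the tensor of two units is terminal
  as well.\<close>

lemma to_unt_unt_eq:
  assumes "f \<in> Arr C" "g \<in> Arr C" "tgt C f = unt C \<otimes> unt C" "tgt C g = unt C \<otimes> unt C" "src C f = src C g"
  shows "f = g"
proof -
  have "lun C (unt C) \<cdot> f = lun C (unt C) \<cdot> g"
    by (rule to_unt_eq) (use assms in simp_all)
  then show ?thesis
    by (rule cancel_mono[where j = "luni C (unt C)"]) (use assms in simp_all)
qed


lemma asci_nat:
  assumes "f \<in> Arr C" "g \<in> Arr C" "h \<in> Arr C" "a' = tgt C f" "b' = tgt C g" "c' = tgt C h"
  shows "asci C a' b' c' \<cdot> (f \<boxtimes> (g \<boxtimes> h)) =
    ((f \<boxtimes> g) \<boxtimes> h) \<cdot> asci C (src C f) (src C g) (src C h)"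
proof (rule cancel_mono[where i = "asc C a' b' c'" and j = "asci C a' b' c'"])
  show "asc C a' b' c' \<cdot> asci C a' b' c' \<cdot> (f \<boxtimes> g \<boxtimes> h) =
      asc C a' b' c' \<cdot> ((f \<boxtimes> g) \<boxtimes> h) \<cdot> asci C (src C f) (src C g) (src C h)"
    using assms by (subst pull[OF asc_nat]) auto
qed (use assms in auto)

lemma mid_arr [simp]:
  assumes "a \<in> Obj C" "b \<in> Obj C" "c \<in> Obj C" "d \<in> Obj C"
  shows "mid C a b c d \<in> Arr C" "src C (mid C a b c d) = (a \<otimes> b) \<otimes> (c \<otimes> d)"
    "tgt C (mid C a b c d) = (a \<otimes> c) \<otimes> (b \<otimes> d)"
  using assms by (simp_all add: mid_def)

lemma mid_nat:
  assumes [simp]: "f \<in> Arr C" "g \<in> Arr C" "h \<in> Arr C" "k \<in> Arr C"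
    and "a = tgt C f" "b = tgt C g" "c = tgt C h" "d = tgt C k"
  shows "mid C a b c d \<cdot> ((f \<boxtimes> g) \<boxtimes> (h \<boxtimes> k)) =
    ((f \<boxtimes> h) \<boxtimes> (g \<boxtimes> k)) \<cdot> mid C (src C f) (src C g) (src C h) (src C k)"
proof -
  \<comment> \<open>\<open>mid\<close> is \<open>X\<close> conjugated by associators, and
    \<open>X\<close> is itself a swap conjugated by associators, so naturality is proved in two
    layers.\<close>
  define X where "X b c d = asc C c b d \<cdot> (swp C b c \<boxtimes> idt C d) \<cdot> asci C b c d" for b c d
  have X_arr [simp]: "X b c d \<in> Arr C" "src C (X b c d) = b \<otimes> (c \<otimes> d)" "tgt C (X b c d) = c \<otimes> (b \<otimes> d)"
    if "b \<in> Obj C" "c \<in> Obj C" "d \<in> Obj C" for b c d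
    using that by (simp_all add: X_def)
  have X_nat: "X b c d \<cdot> (g \<boxtimes> (h \<boxtimes> k)) = (h \<boxtimes> (g \<boxtimes> k)) \<cdot> X (src C g) (src C h) (src C k)"
  proof -
    have "X b c d \<cdot> (g \<boxtimes> (h \<boxtimes> k)) =
        asc C c b d \<cdot> (swp C b c \<boxtimes> idt C d) \<cdot> ((g \<boxtimes> h) \<boxtimes> k) \<cdot> asci C (src C g) (src C h) (src C k)"
      using assms(5-) by (simp add: X_def asci_nat del: merge merge_left)
    also have "\<dots> = asc C c b d \<cdot> ((h \<boxtimes> g) \<boxtimes> k) \<cdot>
        (swp C (src C g) (src C h) \<boxtimes> idt C (src C k)) \<cdot> asci C (src C g) (src C h) (src C k)"
      using assms(5-) by (simp add: swp_nat)
    also have "\<dots> = (h \<boxtimes> (g \<boxtimes> k)) \<cdot> X (src C g) (src C h) (src C k)"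
      unfolding X_def using assms(5-) by (subst pull[OF asc_nat]) auto
    finally show ?thesis .
  qed
  have "mid C a b c d \<cdot> ((f \<boxtimes> g) \<boxtimes> (h \<boxtimes> k)) =
      asci C a c (b \<otimes> d) \<cdot> (idt C a \<boxtimes> X b c d) \<cdot> asc C a b (c \<otimes> d) \<cdot> ((f \<boxtimes> g) \<boxtimes> (h \<boxtimes> k))"
    using assms(5-) by (simp add: mid_def X_def[symmetric])
  also have "\<dots> = asci C a c (b \<otimes> d) \<cdot> (idt C a \<boxtimes> X b c d) \<cdot> (f \<boxtimes> (g \<boxtimes> (h \<boxtimes> k))) \<cdot>
      asc C (src C f) (src C g) (src C h \<otimes> src C k)"
    using assms(5-) by (subst asc_nat) auto
  also have "\<dots> = asci C a c (b \<otimes> d) \<cdot> (f \<boxtimes> (h \<boxtimes> (g \<boxtimes> k))) \<cdot>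
      (idt C (src C f) \<boxtimes> X (src C g) (src C h) (src C k)) \<cdot> asc C (src C f) (src C g) (src C h \<otimes> src C k)"
    using assms(5-) by (simp add: X_nat[unfolded assms(5-)])
  also have "\<dots> = ((f \<boxtimes> h) \<boxtimes> (g \<boxtimes> k)) \<cdot> mid C (src C f) (src C g) (src C h) (src C k)"
    unfolding mid_def X_def[symmetric] using assms(5-) by (subst pull[OF asci_nat]) auto
  finally show ?thesis .
qed

lemma mid_unt:
  assumes [simp]: "a \<in> Obj C" "b \<in> Obj C"
  shows "mid C a (unt C) (unt C) b = idt C ((a \<otimes> unt C) \<otimes> (unt C \<otimes> b))"
  by (simp add: mid_def swp_unt)

section \<open>Deterministic morphisms\<close>

definition det where
  "det f \<longleftrightarrow> f \<in> Arr C \<and> deterministic C f"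

lemma detI: "f \<in> Arr C \<Longrightarrow> cpy C (tgt C f) \<cdot> f = (f \<boxtimes> f) \<cdot> cpy C (src C f) \<Longrightarrow> det f"
  by (simp add: det_def deterministic_def)

lemma det_arr [simp]: "det f \<Longrightarrow> f \<in> Arr C"
  by (simp add: det_def)

lemma det_cpy_cmp: "det f \<Longrightarrow> tgt C f = b \<Longrightarrow> cpy C b \<cdot> f = (f \<boxtimes> f) \<cdot> cpy C (src C f)"
  by (auto simp: det_def deterministic_def)

lemma det_idt [simp]: "a \<in> Obj C \<Longrightarrow> det (idt C a)"
  by (rule detI) auto

lemma det_cmp [simp]:
  assumes [simp]: "det f" "det g" "tgt C f = src C g"
  shows "det (g \<cdot> f)"
proof (rule detI)
  have "cpy C (tgt C g) \<cdot> g \<cdot> f = (g \<boxtimes> g) \<cdot> cpy C (src C g) \<cdot> f"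
    by (subst pull[OF det_cpy_cmp]) auto
  also have "\<dots> = (g \<boxtimes> g) \<cdot> (f \<boxtimes> f) \<cdot> cpy C (src C f)"
    by (subst det_cpy_cmp) auto
  finally show "cpy C (tgt C (g \<cdot> f)) \<cdot> g \<cdot> f = ((g \<cdot> f) \<boxtimes> (g \<cdot> f)) \<cdot> cpy C (src C (g \<cdot> f))"
    by simp
qed simp

text \<open>The copy of a tensor is the tensor of the copies followed by \<open>mid\<close>, so the
  claim is \<open>mid_nat\<close> with repeated arguments.\<close>

lemma det_tenm [simp]:
  assumes [simp]: "det f" "det g"
  shows "det (f \<boxtimes> g)"
proof (rule detI)
  have "cpy C (tgt C (f \<boxtimes> g)) \<cdot> (f \<boxtimes> g) =
      mid C (tgt C f) (tgt C f) (tgt C g) (tgt C g) \<cdot> ((f \<boxtimes> f) \<boxtimes> (g \<boxtimes> g)) \<cdot>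
        (cpy C (src C f) \<boxtimes> cpy C (src C g))"
    by (simp add: cpy_ten det_cpy_cmp)
  also have "\<dots> = ((f \<boxtimes> g) \<boxtimes> (f \<boxtimes> g)) \<cdot> mid C (src C f) (src C f) (src C g) (src C g) \<cdot>
        (cpy C (src C f) \<boxtimes> cpy C (src C g))"
    by (subst pull[OF mid_nat]) auto
  finally show "cpy C (tgt C (f \<boxtimes> g)) \<cdot> (f \<boxtimes> g) =
      ((f \<boxtimes> g) \<boxtimes> (f \<boxtimes> g)) \<cdot> cpy C (src C (f \<boxtimes> g))"
    by (simp add: cpy_ten)
qed simp

text \<open>Inserting \<open>g \<cdot> f\<close> on both copies lets determinism of \<open>f\<close>
  move its two occurrences back before the copy, where the resulting single \<open>f\<close> cancels
  with \<open>g\<close>.\<close>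

lemma det_inverse:
  assumes [simp]: "det f" "g \<in> Arr C" "src C g = tgt C f" "tgt C g = src C f"
    and gf: "g \<cdot> f = idt C (src C f)" and fg: "f \<cdot> g = idt C (tgt C f)"
  shows "det g"
proof (rule detI)
  have "cpy C (tgt C g) \<cdot> g = (g \<boxtimes> g) \<cdot> (f \<boxtimes> f) \<cdot> cpy C (src C f) \<cdot> g"
    by (simp add: gf)
  also have "\<dots> = (g \<boxtimes> g) \<cdot> cpy C (tgt C f) \<cdot> f \<cdot> g"
    using pull[OF det_cpy_cmp[OF assms(1) refl], of g] by (simp del: merge_left)
  also have "\<dots> = (g \<boxtimes> g) \<cdot> cpy C (src C g)"
    by (simp add: fg)
  finally show "cpy C (tgt C g) \<cdot> g = (g \<boxtimes> g) \<cdot> cpy C (src C g)" .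
qed simp

lemma det_dsc [simp]: "a \<in> Obj C \<Longrightarrow> det (dsc C a)"
  by (rule detI, simp, rule to_unt_unt_eq) simp_all

section \<open>Projections, pairing and the determinism of the structure maps\<close>

definition fst_arr where "fst_arr a b = run C a \<cdot> (idt C a \<boxtimes> dsc C b)"
definition snd_arr where "snd_arr a b = lun C b \<cdot> (dsc C a \<boxtimes> idt C b)"

lemma fst_snd_arr [simp]:
  assumes "a \<in> Obj C" "b \<in> Obj C"
  shows "fst_arr a b \<in> Arr C" "src C (fst_arr a b) = a \<otimes> b" "tgt C (fst_arr a b) = a"
    "snd_arr a b \<in> Arr C" "src C (snd_arr a b) = a \<otimes> b" "tgt C (snd_arr a b) = b"
  using assms by (simp_all add: fst_arr_def snd_arr_def)

lemma counit:
  assumes [simp]: "a \<in> Obj C"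
  shows "(dsc C a \<boxtimes> idt C a) \<cdot> cpy C a = luni C a" "(idt C a \<boxtimes> dsc C a) \<cdot> cpy C a = runi C a"
proof -
  show "(dsc C a \<boxtimes> idt C a) \<cdot> cpy C a = luni C a"
    by (rule cancel_mono[where i = "lun C a" and j = "luni C a"]) (simp_all add: cpy_counit_left)
  show "(idt C a \<boxtimes> dsc C a) \<cdot> cpy C a = runi C a"
    by (rule cancel_mono[where i = "run C a" and j = "runi C a"]) (simp_all add: cpy_counit_right)
qed

text \<open>Sliding the two discards through the \<open>mid\<close> of \<open>cpy_ten\<close> leaves
  \<open>mid\<close> with two units in the middle, which is an identity by \<open>swp_unt\<close>;
  the counit laws do the rest.\<close>

lemma pair_eta:
  assumes [simp]: "a \<in> Obj C" "b \<in> Obj C"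
  shows "(fst_arr a b \<boxtimes> snd_arr a b) \<cdot> cpy C (a \<otimes> b) = idt C (a \<otimes> b)"
proof -
  have m: "((idt C a \<boxtimes> dsc C b) \<boxtimes> (dsc C a \<boxtimes> idt C b)) \<cdot> mid C a a b b =
      mid C a (unt C) (unt C) b \<cdot> ((idt C a \<boxtimes> dsc C a) \<boxtimes> (dsc C b \<boxtimes> idt C b))"
    using mid_nat[of "idt C a" "dsc C a" "dsc C b" "idt C b"] by (simp del: merge tenm_idt)
  have "(fst_arr a b \<boxtimes> snd_arr a b) \<cdot> cpy C (a \<otimes> b) =
      (run C a \<boxtimes> lun C b) \<cdot> ((idt C a \<boxtimes> dsc C b) \<boxtimes> (dsc C a \<boxtimes> idt C b)) \<cdot>
        mid C a a b b \<cdot> (cpy C a \<boxtimes> cpy C b)"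
    by (simp add: fst_arr_def snd_arr_def cpy_ten)
  also have "\<dots> = (run C a \<boxtimes> lun C b) \<cdot> mid C a (unt C) (unt C) b \<cdot>
      ((idt C a \<boxtimes> dsc C a) \<boxtimes> (dsc C b \<boxtimes> idt C b)) \<cdot> (cpy C a \<boxtimes> cpy C b)"
    by (subst pull[OF m]) (simp_all del: merge merge_left)
  also have "\<dots> = idt C (a \<otimes> b)"
    by (simp add: mid_unt counit)
  finally show ?thesis .
qed

text \<open>The unitor inside \<open>fst_arr\<close> is not yet known to be deterministic, its
  determinism being deduced from this lemma. So copying is computed directly: both discards are
  moved through \<open>mid\<close>, and a pure coherence identity remains.\<close>

lemma det_fst [simp]:
  assumes [simp]: "a \<in> Obj C" "b \<in> Obj C"
  shows "det (fst_arr a b)"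
proof (rule detI)
  let ?I = "unt C"
  \<comment> \<open>Splitting the trailing unit in two and removing the halves after
    \<open>mid\<close> amounts to removing it directly; this follows from the triangle,
    \<open>lun_asc\<close>, \<open>lun_swp\<close> and \<open>run_asc\<close>.\<close>
  have K: "(run C a \<boxtimes> run C a) \<cdot> mid C a a ?I ?I \<cdot> (idt C (a \<otimes> a) \<boxtimes> luni C ?I) = run C (a \<otimes> a)"
  proof -
    have 1: "(run C a \<boxtimes> run C a) \<cdot> asci C a ?I (a \<otimes> ?I) = idt C a \<boxtimes> (run C a \<cdot> lun C (a \<otimes> ?I))"
    proof -
      have "(run C a \<boxtimes> run C a) \<cdot> asci C a ?I (a \<otimes> ?I) =
          (idt C a \<boxtimes> run C a) \<cdot> (run C a \<boxtimes> idt C (a \<otimes> ?I)) \<cdot> asci C a ?I (a \<otimes> ?I)"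
        by simp
      also have "\<dots> = idt C a \<boxtimes> (run C a \<cdot> lun C (a \<otimes> ?I))"
        by (simp add: triangle[symmetric])
      finally show ?thesis .
    qed
    have 2: "run C a \<cdot> lun C (a \<otimes> ?I) \<cdot> asc C ?I a ?I \<cdot> (swp C a ?I \<boxtimes> idt C ?I) \<cdot> asci C a ?I ?I =
        run C a \<cdot> (idt C a \<boxtimes> lun C ?I)"
    proof -
      have "run C a \<cdot> lun C (a \<otimes> ?I) \<cdot> asc C ?I a ?I \<cdot> (swp C a ?I \<boxtimes> idt C ?I) \<cdot> asci C a ?I ?I =
          run C a \<cdot> (run C a \<boxtimes> idt C ?I) \<cdot> asci C a ?I ?I"
        by (subst pull[OF lun_asc]) (auto simp: lun_swp)
      also have "\<dots> = run C a \<cdot> (idt C a \<boxtimes> lun C ?I)"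
        by (simp add: triangle[symmetric])
      finally show ?thesis .
    qed
    have "(run C a \<boxtimes> run C a) \<cdot> mid C a a ?I ?I =
        ((run C a \<boxtimes> run C a) \<cdot> asci C a ?I (a \<otimes> ?I)) \<cdot>
          (idt C a \<boxtimes> (asc C ?I a ?I \<cdot> (swp C a ?I \<boxtimes> idt C ?I) \<cdot> asci C a ?I ?I)) \<cdot> asc C a a (?I \<otimes> ?I)"
      unfolding mid_def by simp
    also have "\<dots> = (idt C a \<boxtimes> (run C a \<cdot> (idt C a \<boxtimes> lun C ?I))) \<cdot> asc C a a (?I \<otimes> ?I)"
      unfolding 1 by (simp add: 2)
    also have "\<dots> = (idt C a \<boxtimes> run C a) \<cdot> (idt C a \<boxtimes> (idt C a \<boxtimes> lun C ?I)) \<cdot> asc C a a (?I \<otimes> ?I)"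
      by simp
    also have "\<dots> = (idt C a \<boxtimes> run C a) \<cdot> asc C a a ?I \<cdot> ((idt C a \<boxtimes> idt C a) \<boxtimes> lun C ?I)"
      by (subst asc_nat) (auto simp del: merge_left)
    also have "\<dots> = run C (a \<otimes> a) \<cdot> (idt C (a \<otimes> a) \<boxtimes> lun C ?I)"
      by (subst pull[OF run_asc]) auto
    finally have *: "(run C a \<boxtimes> run C a) \<cdot> mid C a a ?I ?I = run C (a \<otimes> a) \<cdot> (idt C (a \<otimes> a) \<boxtimes> lun C ?I)" .
    show ?thesis
      by (subst pull[OF *]) auto
  qed
  have dd: "(dsc C b \<boxtimes> dsc C b) \<cdot> cpy C b = luni C ?I \<cdot> dsc C b"
    by (rule to_unt_unt_eq) auto
  have m: "((idt C a \<boxtimes> dsc C b) \<boxtimes> (idt C a \<boxtimes> dsc C b)) \<cdot> mid C a a b b =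
      mid C a a ?I ?I \<cdot> ((idt C a \<boxtimes> idt C a) \<boxtimes> (dsc C b \<boxtimes> dsc C b))"
    using mid_nat[of "idt C a" "idt C a" "dsc C b" "dsc C b"] by (simp del: merge tenm_idt)
  have "(fst_arr a b \<boxtimes> fst_arr a b) \<cdot> cpy C (a \<otimes> b) =
      (run C a \<boxtimes> run C a) \<cdot> ((idt C a \<boxtimes> dsc C b) \<boxtimes> (idt C a \<boxtimes> dsc C b)) \<cdot>
        mid C a a b b \<cdot> (cpy C a \<boxtimes> cpy C b)"
    by (simp add: fst_arr_def cpy_ten)
  also have "\<dots> = (run C a \<boxtimes> run C a) \<cdot> mid C a a ?I ?I \<cdot>
      ((idt C a \<boxtimes> idt C a) \<boxtimes> (dsc C b \<boxtimes> dsc C b)) \<cdot> (cpy C a \<boxtimes> cpy C b)"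
    by (subst pull[OF m]) (simp_all del: merge merge_left tenm_idt)
  also have "\<dots> = (run C a \<boxtimes> run C a) \<cdot> mid C a a ?I ?I \<cdot> (idt C (a \<otimes> a) \<boxtimes> luni C ?I) \<cdot>
      (cpy C a \<boxtimes> dsc C b)"
    by (simp add: dd)
  also have "\<dots> = ((run C a \<boxtimes> run C a) \<cdot> mid C a a ?I ?I \<cdot> (idt C (a \<otimes> a) \<boxtimes> luni C ?I)) \<cdot>
      (cpy C a \<boxtimes> dsc C b)"
    by (simp del: merge merge_left)
  also have "\<dots> = run C (a \<otimes> a) \<cdot> (cpy C a \<boxtimes> idt C ?I) \<cdot> (idt C a \<boxtimes> dsc C b)"
    unfolding K by simp
  also have "\<dots> = cpy C a \<cdot> fst_arr a b"
    unfolding fst_arr_def by (subst pull[OF run_nat]) auto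
  finally show "cpy C (tgt C (fst_arr a b)) \<cdot> fst_arr a b =
      (fst_arr a b \<boxtimes> fst_arr a b) \<cdot> cpy C (src C (fst_arr a b))"
    by simp
qed simp

lemma det_snd [simp]:
  assumes [simp]: "a \<in> Obj C" "b \<in> Obj C"
  shows "det (snd_arr a b)"
proof (rule detI)
  let ?I = "unt C"
  have K: "(lun C b \<boxtimes> lun C b) \<cdot> mid C ?I ?I b b \<cdot> (luni C ?I \<boxtimes> idt C (b \<otimes> b)) = lun C (b \<otimes> b)"
  proof -
    have 1: "(lun C b \<boxtimes> lun C b) \<cdot> asci C ?I b (?I \<otimes> b) = (idt C b \<boxtimes> lun C b) \<cdot> lun C (b \<otimes> (?I \<otimes> b))"
    proof -
      have "(lun C b \<boxtimes> lun C b) \<cdot> asci C ?I b (?I \<otimes> b) =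
          (idt C b \<boxtimes> lun C b) \<cdot> (lun C b \<boxtimes> idt C (?I \<otimes> b)) \<cdot> asci C ?I b (?I \<otimes> b)"
        by simp
      also have "\<dots> = (idt C b \<boxtimes> lun C b) \<cdot> lun C (b \<otimes> (?I \<otimes> b))"
        by (simp add: lun_asc[symmetric] del: merge merge_left)
      finally show ?thesis .
    qed
    have 2: "(idt C b \<boxtimes> lun C b) \<cdot> asc C b ?I b \<cdot> (swp C ?I b \<boxtimes> idt C b) \<cdot> asci C ?I b b = lun C (b \<otimes> b)"
    proof -
      have "(idt C b \<boxtimes> lun C b) \<cdot> asc C b ?I b \<cdot> (swp C ?I b \<boxtimes> idt C b) \<cdot> asci C ?I b b =
          (lun C b \<boxtimes> idt C b) \<cdot> asci C ?I b b"
        by (subst pull[OF triangle]) (auto simp: run_swp)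
      then show ?thesis by (simp add: lun_asc[symmetric])
    qed
    have "(lun C b \<boxtimes> lun C b) \<cdot> mid C ?I ?I b b =
        ((lun C b \<boxtimes> lun C b) \<cdot> asci C ?I b (?I \<otimes> b)) \<cdot>
          (idt C ?I \<boxtimes> (asc C b ?I b \<cdot> (swp C ?I b \<boxtimes> idt C b) \<cdot> asci C ?I b b)) \<cdot> asc C ?I ?I (b \<otimes> b)"
      unfolding mid_def by simp
    also have "\<dots> = (idt C b \<boxtimes> lun C b) \<cdot> lun C (b \<otimes> (?I \<otimes> b)) \<cdot>
          (idt C ?I \<boxtimes> (asc C b ?I b \<cdot> (swp C ?I b \<boxtimes> idt C b) \<cdot> asci C ?I b b)) \<cdot> asc C ?I ?I (b \<otimes> b)"
      unfolding 1 by simp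
    also have "\<dots> = (idt C b \<boxtimes> lun C b) \<cdot> (asc C b ?I b \<cdot> (swp C ?I b \<boxtimes> idt C b) \<cdot> asci C ?I b b) \<cdot>
        lun C (?I \<otimes> (b \<otimes> b)) \<cdot> asc C ?I ?I (b \<otimes> b)"
      by (subst pull[OF lun_nat]) auto
    also have "\<dots> = ((idt C b \<boxtimes> lun C b) \<cdot> asc C b ?I b \<cdot> (swp C ?I b \<boxtimes> idt C b) \<cdot> asci C ?I b b) \<cdot>
        lun C (?I \<otimes> (b \<otimes> b)) \<cdot> asc C ?I ?I (b \<otimes> b)"
      by simp
    also have "\<dots> = lun C (b \<otimes> b) \<cdot> (lun C ?I \<boxtimes> idt C (b \<otimes> b))"
      unfolding 2 by (simp add: lun_asc)
    finally have *: "(lun C b \<boxtimes> lun C b) \<cdot> mid C ?I ?I b b = lun C (b \<otimes> b) \<cdot> (lun C ?I \<boxtimes> idt C (b \<otimes> b))" .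
    show ?thesis
      by (subst pull[OF *]) auto
  qed
  have dd: "(dsc C a \<boxtimes> dsc C a) \<cdot> cpy C a = luni C ?I \<cdot> dsc C a"
    by (rule to_unt_unt_eq) auto
  have m: "((dsc C a \<boxtimes> idt C b) \<boxtimes> (dsc C a \<boxtimes> idt C b)) \<cdot> mid C a a b b =
      mid C ?I ?I b b \<cdot> ((dsc C a \<boxtimes> dsc C a) \<boxtimes> (idt C b \<boxtimes> idt C b))"
    using mid_nat[of "dsc C a" "dsc C a" "idt C b" "idt C b"] by (simp del: merge tenm_idt)
  have "(snd_arr a b \<boxtimes> snd_arr a b) \<cdot> cpy C (a \<otimes> b) =
      (lun C b \<boxtimes> lun C b) \<cdot> ((dsc C a \<boxtimes> idt C b) \<boxtimes> (dsc C a \<boxtimes> idt C b)) \<cdot>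
        mid C a a b b \<cdot> (cpy C a \<boxtimes> cpy C b)"
    by (simp add: snd_arr_def cpy_ten)
  also have "\<dots> = (lun C b \<boxtimes> lun C b) \<cdot> mid C ?I ?I b b \<cdot>
      ((dsc C a \<boxtimes> dsc C a) \<boxtimes> (idt C b \<boxtimes> idt C b)) \<cdot> (cpy C a \<boxtimes> cpy C b)"
    by (subst pull[OF m]) (simp_all del: merge merge_left tenm_idt)
  also have "\<dots> = (lun C b \<boxtimes> lun C b) \<cdot> mid C ?I ?I b b \<cdot> (luni C ?I \<boxtimes> idt C (b \<otimes> b)) \<cdot>
      (dsc C a \<boxtimes> cpy C b)"
    by (simp add: dd)
  also have "\<dots> = ((lun C b \<boxtimes> lun C b) \<cdot> mid C ?I ?I b b \<cdot> (luni C ?I \<boxtimes> idt C (b \<otimes> b))) \<cdot>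
      (dsc C a \<boxtimes> cpy C b)"
    by (simp del: merge merge_left)
  also have "\<dots> = lun C (b \<otimes> b) \<cdot> (idt C ?I \<boxtimes> cpy C b) \<cdot> (dsc C a \<boxtimes> idt C b)"
    unfolding K by simp
  also have "\<dots> = cpy C b \<cdot> snd_arr a b"
    unfolding snd_arr_def by (subst pull[OF lun_nat]) auto
  finally show "cpy C (tgt C (snd_arr a b)) \<cdot> snd_arr a b =
      (snd_arr a b \<boxtimes> snd_arr a b) \<cdot> cpy C (src C (snd_arr a b))"
    by simp
qed simp

text \<open>A unitor is the projection away from a unit factor, because discarding the unit is the
  identity.\<close>

lemma det_unitors [simp]:
  assumes [simp]: "a \<in> Obj C"
  shows "det (lun C a)" "det (luni C a)" "det (run C a)" "det (runi C a)"
proof -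
  show l: "det (lun C a)" using det_snd[of "unt C" a] by (simp add: snd_arr_def)
  show r: "det (run C a)" using det_fst[of a "unt C"] by (simp add: fst_arr_def)
  show "det (luni C a)" by (rule det_inverse[OF l]) auto
  show "det (runi C a)" by (rule det_inverse[OF r]) auto
qed

text \<open>Cocommutativity lets the two inner copies be exchanged.\<close>

lemma det_cpy [simp]:
  assumes [simp]: "a \<in> Obj C"
  shows "det (cpy C a)"
proof (rule detI)
  define c3 where "c3 = (idt C a \<boxtimes> cpy C a) \<cdot> cpy C a"
  have c3 [simp]: "c3 \<in> Arr C" "src C c3 = a" "tgt C c3 = a \<otimes> (a \<otimes> a)"
    by (simp_all add: c3_def)
  have c3': "c3 = asc C a a a \<cdot> (cpy C a \<boxtimes> idt C a) \<cdot> cpy C a"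
    by (simp add: c3_def cpy_coassoc)
  have X: "asc C a a a \<cdot> (swp C a a \<boxtimes> idt C a) \<cdot> asci C a a a \<cdot> c3 = c3"
    by (simp add: c3' cpy_cocomm)
  have main: "asc C a a (a \<otimes> a) \<cdot> (cpy C a \<boxtimes> cpy C a) \<cdot> cpy C a = (idt C a \<boxtimes> c3) \<cdot> cpy C a"
  proof -
    have "asc C a a (a \<otimes> a) \<cdot> (cpy C a \<boxtimes> cpy C a) \<cdot> cpy C a =
        asc C a a (a \<otimes> a) \<cdot> ((idt C a \<boxtimes> idt C a) \<boxtimes> cpy C a) \<cdot> (cpy C a \<boxtimes> idt C a) \<cdot> cpy C a"
      by simp
    also have "\<dots> = (idt C a \<boxtimes> (idt C a \<boxtimes> cpy C a)) \<cdot> asc C a a a \<cdot> (cpy C a \<boxtimes> idt C a) \<cdot> cpy C a"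
      by (subst pull[OF asc_nat]) auto
    also have "\<dots> = (idt C a \<boxtimes> c3) \<cdot> cpy C a"
      by (simp add: cpy_coassoc c3_def)
    finally show ?thesis .
  qed
  have "cpy C (a \<otimes> a) \<cdot> cpy C a =
      asci C a a (a \<otimes> a) \<cdot> (idt C a \<boxtimes> (asc C a a a \<cdot> (swp C a a \<boxtimes> idt C a) \<cdot> asci C a a a)) \<cdot>
        asc C a a (a \<otimes> a) \<cdot> (cpy C a \<boxtimes> cpy C a) \<cdot> cpy C a"
    by (simp add: cpy_ten mid_def)
  also have "\<dots> = asci C a a (a \<otimes> a) \<cdot> (idt C a \<boxtimes> c3) \<cdot> cpy C a"
    by (simp add: main X)
  also have "\<dots> = (cpy C a \<boxtimes> cpy C a) \<cdot> cpy C a"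
    by (simp add: main[symmetric])
  finally show "cpy C (tgt C (cpy C a)) \<cdot> cpy C a = (cpy C a \<boxtimes> cpy C a) \<cdot> cpy C (src C (cpy C a))"
    by simp
qed simp

text \<open>The associator is the pairing of its deterministic components, hence deterministic itself.\<close>

lemma det_asc [simp]:
  assumes [simp]: "a \<in> Obj C" "b \<in> Obj C" "c \<in> Obj C"
  shows "det (asc C a b c)" "det (asci C a b c)"
proof -
  let ?p = "fst_arr (a \<otimes> b) c" and ?q = "snd_arr (a \<otimes> b) c"
    and ?r = "fst_arr a b" and ?s = "snd_arr a b" and ?o = "(a \<otimes> b) \<otimes> c"
  have "((?r \<cdot> ?p) \<boxtimes> (((?s \<cdot> ?p) \<boxtimes> ?q) \<cdot> cpy C ?o)) \<cdot> cpy C ?o =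
      ((?r \<cdot> ?p) \<boxtimes> ((?s \<cdot> ?p) \<boxtimes> ?q)) \<cdot> (idt C ?o \<boxtimes> cpy C ?o) \<cdot> cpy C ?o"
    by simp
  also have "\<dots> = ((?r \<cdot> ?p) \<boxtimes> ((?s \<cdot> ?p) \<boxtimes> ?q)) \<cdot> asc C ?o ?o ?o \<cdot> (cpy C ?o \<boxtimes> idt C ?o) \<cdot> cpy C ?o"
    by (simp add: cpy_coassoc[symmetric])
  also have "\<dots> = asc C a b c \<cdot> (((?r \<cdot> ?p) \<boxtimes> (?s \<cdot> ?p)) \<boxtimes> ?q) \<cdot> (cpy C ?o \<boxtimes> idt C ?o) \<cdot> cpy C ?o"
    using pull[OF asc_nat[of "?r \<cdot> ?p" "?s \<cdot> ?p" ?q a b c], of "(cpy C ?o \<boxtimes> idt C ?o) \<cdot> cpy C ?o"]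
    by (simp del: merge_left merge)
  also have "\<dots> = asc C a b c \<cdot> (((?r \<boxtimes> ?s) \<cdot> (?p \<boxtimes> ?p) \<cdot> cpy C ?o) \<boxtimes> ?q) \<cdot> cpy C ?o"
    by simp
  also have "\<dots> = asc C a b c \<cdot> (((?r \<boxtimes> ?s) \<cdot> cpy C (a \<otimes> b) \<cdot> ?p) \<boxtimes> ?q) \<cdot> cpy C ?o"
    by (simp add: det_cpy_cmp del: merge_left)
  also have "\<dots> = asc C a b c"
    by (simp add: pull[OF pair_eta] pair_eta)
  finally have "asc C a b c = ((?r \<cdot> ?p) \<boxtimes> (((?s \<cdot> ?p) \<boxtimes> ?q) \<cdot> cpy C ?o)) \<cdot> cpy C ?o" ..
  then show d: "det (asc C a b c)" by simp
  show "det (asci C a b c)" by (rule det_inverse[OF d]) auto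
qed

end

lemma tens_simps [simp]: "tens C [] = unt C" "tens C (a # as) = a \<otimes>\<^bsub>C\<^esub> tens C as"
  by (simp_all add: tens_def)

lemma tensm_simps [simp]: "tensm C [] = idt C (unt C)" "tensm C (f # fs) = f \<boxtimes>\<^bsub>C\<^esub> tensm C fs"
  by (simp_all add: tensm_def)

text \<open>Needed because strict functors change the labelling:
  \<open>\<lambda>x. fob F (WVar x)\<close> agrees with \<open>vob\<close> only on the variables of
  the model.\<close>

lemma wire_cong:
  assumes "\<forall>x \<in> set xs. ob x = ob' x" "set ys \<subseteq> set xs"
  shows "wire C ob xs ys = wire C ob' xs ys"
proof -
  have m: "map ob xs = map ob' xs" using assms by simp
  have p: "y \<in> set xs \<Longrightarrow> proj C ob xs y = proj C ob' xs y" for y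
    using assms(1)
  proof (induction xs)
    case (Cons x xs)
    then have m: "map ob xs = map ob' xs" by simp
    show ?case unfolding proj.simps m using Cons by auto
  qed simp
  show ?thesis using assms(2) by (induction ys) (simp_all add: m p)
qed

lemma regroup_cong:
  assumes "\<forall>x \<in> set xs. ob x = ob' x" "\<forall>ys \<in> set yss. set ys \<subseteq> set xs"
  shows "regroup C ob xs yss = regroup C ob' xs yss"
proof -
  have m: "map ob xs = map ob' xs" using assms by simp
  show ?thesis
    using assms(2) by (induction yss) (simp_all add: m wire_cong[OF assms(1)])
qed

context markov
begin

subsection \<open>Isomorphisms\<close>

definition inv_arr where
  "inv_arr f = (SOME g. g \<in> hom C (tgt C f) (src C f) \<and> g \<cdot> f = idt C (src C f) \<and> f \<cdot> g = idt C (tgt C f))"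

text \<open>Like \<open>det\<close>, bundled with membership in \<open>Arr C\<close>, so that one
  premise yields both the typing and the property.\<close>

definition iso where "iso f \<longleftrightarrow> f \<in> Arr C \<and> iso_arr C f"

lemma isoI:
  assumes "f \<in> Arr C" "g \<in> Arr C" "src C g = tgt C f" "tgt C g = src C f"
    "g \<cdot> f = idt C (src C f)" "f \<cdot> g = idt C (tgt C f)"
  shows "iso f"
  using assms by (auto simp: iso_def iso_arr_def hom_def)

lemma iso_arrow [simp]: "iso f \<Longrightarrow> f \<in> Arr C"
  by (simp add: iso_def)

lemma inv_arr [simp]:
  assumes "iso f"
  shows "inv_arr f \<in> Arr C" "src C (inv_arr f) = tgt C f" "tgt C (inv_arr f) = src C f"
    "inv_arr f \<cdot> f = idt C (src C f)" "f \<cdot> inv_arr f = idt C (tgt C f)"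
proof -
  have "\<exists>g. g \<in> hom C (tgt C f) (src C f) \<and> g \<cdot> f = idt C (src C f) \<and> f \<cdot> g = idt C (tgt C f)"
    using assms by (auto simp: iso_def iso_arr_def)
  from someI_ex[OF this, folded inv_arr_def]
  show "inv_arr f \<in> Arr C" "src C (inv_arr f) = tgt C f" "tgt C (inv_arr f) = src C f"
    "inv_arr f \<cdot> f = idt C (src C f)" "f \<cdot> inv_arr f = idt C (tgt C f)"
    by (auto simp: hom_def)
qed

lemma inv_arr_left [simp]:
  assumes "iso f" "k \<in> Arr C"
  shows "tgt C k = src C f \<Longrightarrow> inv_arr f \<cdot> f \<cdot> k = k" "tgt C k = tgt C f \<Longrightarrow> f \<cdot> inv_arr f \<cdot> k = k"
proof -
  show "inv_arr f \<cdot> f \<cdot> k = k" if "tgt C k = src C f"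
    by (subst pull[OF inv_arr(4)]) (simp_all add: assms that)
  show "f \<cdot> inv_arr f \<cdot> k = k" if "tgt C k = tgt C f"
    by (subst pull[OF inv_arr(5)]) (simp_all add: assms that)
qed

lemma iso_epi:
  assumes "g \<cdot> i = h \<cdot> i" "iso i" "g \<in> Arr C" "h \<in> Arr C" "src C g = tgt C i" "src C h = tgt C i"
  shows "g = h"
  by (rule cancel_epi[OF assms(1), of "inv_arr i"]) (use assms(2-) in simp_all)

lemma iso_mono:
  assumes "i \<cdot> g = i \<cdot> h" "iso i" "g \<in> Arr C" "h \<in> Arr C" "tgt C g = src C i" "tgt C h = src C i"
  shows "g = h"
  by (rule cancel_mono[OF assms(1), of "inv_arr i"]) (use assms(2-) in simp_all)

lemma iso_idt [simp]: "a \<in> Obj C \<Longrightarrow> iso (idt C a)"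
  by (rule isoI[where g = "idt C a"]) auto

lemma iso_cmp [simp]:
  assumes "iso f" "iso g" "tgt C f = src C g"
  shows "iso (g \<cdot> f)"
  by (rule isoI[where g = "inv_arr f \<cdot> inv_arr g"]) (use assms in simp_all)

lemma iso_tenm [simp]:
  assumes "iso f" "iso g"
  shows "iso (f \<boxtimes> g)"
  by (rule isoI[where g = "inv_arr f \<boxtimes> inv_arr g"]) (use assms in simp_all)

lemma iso_inv_arr [simp]: "iso f \<Longrightarrow> iso (inv_arr f)"
  by (rule isoI[where g = f]) auto

lemma det_inv_arr [simp]: "iso f \<Longrightarrow> det f \<Longrightarrow> det (inv_arr f)"
  by (rule det_inverse[where f = f]) auto

lemma iso_structural [simp]:
  assumes "a \<in> Obj C"
  shows "iso (lun C a)" "iso (luni C a)" "iso (run C a)" "iso (runi C a)"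
  using assms
  by (auto intro: isoI[where g = "luni C a"] isoI[where g = "lun C a"]
      isoI[where g = "runi C a"] isoI[where g = "run C a"])

lemma iso_asc [simp]:
  assumes "a \<in> Obj C" "b \<in> Obj C" "c \<in> Obj C"
  shows "iso (asc C a b c)" "iso (asci C a b c)"
  using assms by (auto intro: isoI[where g = "asci C a b c"] isoI[where g = "asc C a b c"])

lemma epic_cmp_iso:
  assumes "epic C f" "iso i" "f \<in> Arr C" "tgt C i = src C f"
  shows "epic C (f \<cdot> i)"
  unfolding epic_def
proof (intro allI ballI impI)
  fix c g h
  assume g: "g \<in> hom C (tgt C (f \<cdot> i)) c" and h: "h \<in> hom C (tgt C (f \<cdot> i)) c"
    and eq: "g \<cdot> f \<cdot> i = h \<cdot> f \<cdot> i"
  have "g \<cdot> f = h \<cdot> f"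
    by (rule iso_epi[of _ i]) (use g h eq assms in \<open>simp_all add: hom_def\<close>)
  then show "g = h" using assms g h by (auto simp: epic_def)
qed

subsection \<open>Lists of wires\<close>

lemma tens_obj [simp]: "set as \<subseteq> Obj C \<Longrightarrow> tens C as \<in> Obj C"
  by (induction as) auto

lemma tens_map_tens_obj [simp]: "\<forall>as \<in> set ass. set as \<subseteq> Obj C \<Longrightarrow> tens C (map (tens C) ass) \<in> Obj C"
  by (rule tens_obj) auto

lemma tensm_arr [simp]:
  assumes "set fs \<subseteq> Arr C"
  shows "tensm C fs \<in> Arr C" "src C (tensm C fs) = tens C (map (src C) fs)"
    "tgt C (tensm C fs) = tens C (map (tgt C) fs)"
  using assms by (induction fs) auto

lemma det_tensm [simp]: "\<forall>f \<in> set fs. det f \<Longrightarrow> det (tensm C fs)"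
  by (induction fs) auto

lemma iso_tensm [simp]: "\<forall>f \<in> set fs. iso f \<Longrightarrow> iso (tensm C fs)"
  by (induction fs) auto

lemma tensm_map_cmp:
  assumes "\<forall>x \<in> set xs. f x \<in> Arr C \<and> g x \<in> Arr C \<and> tgt C (f x) = src C (g x)"
  shows "tensm C (map g xs) \<cdot> tensm C (map f xs) = tensm C (map (\<lambda>x. g x \<cdot> f x) xs)"
  using assms
proof (induction xs)
  case (Cons x xs)
  then have "f ` set xs \<subseteq> Arr C" "g ` set xs \<subseteq> Arr C" by auto
  moreover have "map (\<lambda>x. tgt C (f x)) xs = map (\<lambda>x. src C (g x)) xs"
    using Cons.prems by simp
  then have "tens C (map (tgt C) (map f xs)) = tens C (map (src C) (map g xs))"
    by (simp only: map_map comp_def)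
  ultimately show ?case using Cons by (simp del: map_map)
qed simp

lemma join_arr [simp]:
  assumes "set as \<subseteq> Obj C" "set bs \<subseteq> Obj C"
  shows "join C as bs \<in> Arr C" "src C (join C as bs) = tens C as \<otimes> tens C bs"
    "tgt C (join C as bs) = tens C (as @ bs)"
  using assms by (induction as) simp_all

lemma unjoin_arr [simp]:
  assumes "set as \<subseteq> Obj C" "set bs \<subseteq> Obj C"
  shows "unjoin C as bs \<in> Arr C" "src C (unjoin C as bs) = tens C (as @ bs)"
    "tgt C (unjoin C as bs) = tens C as \<otimes> tens C bs"
  using assms by (induction as) simp_all

lemma join_inverse [simp]:
  assumes "set as \<subseteq> Obj C" "set bs \<subseteq> Obj C"
  shows "join C as bs \<cdot> unjoin C as bs = idt C (tens C (as @ bs))"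
    "unjoin C as bs \<cdot> join C as bs = idt C (tens C as \<otimes> tens C bs)"
  using assms by (induction as) simp_all

lemma det_join [simp]:
  assumes "set as \<subseteq> Obj C" "set bs \<subseteq> Obj C"
  shows "det (join C as bs)" "det (unjoin C as bs)"
  using assms by (induction as) simp_all

lemma flat_arr [simp]:
  assumes "\<forall>as \<in> set ass. set as \<subseteq> Obj C"
  shows "flat C ass \<in> Arr C" "src C (flat C ass) = tens C (map (tens C) ass)"
    "tgt C (flat C ass) = tens C (concat ass)"
    "unflat C ass \<in> Arr C" "src C (unflat C ass) = tens C (concat ass)"
    "tgt C (unflat C ass) = tens C (map (tens C) ass)"
  using assms
proof (induction ass)
  case (Cons as ass)
  { case 1 with Cons show ?case by (simp add: UN_subset_iff) next
    case 2 with Cons show ?case by (simp add: UN_subset_iff) next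
    case 3 with Cons show ?case by (simp add: UN_subset_iff) next
    case 4 with Cons show ?case by (simp add: UN_subset_iff) next
    case 5 with Cons show ?case by (simp add: UN_subset_iff) next
    case 6 with Cons show ?case by (simp add: UN_subset_iff) }
qed simp_all

lemma flat_inverse [simp]:
  assumes "\<forall>as \<in> set ass. set as \<subseteq> Obj C"
  shows "flat C ass \<cdot> unflat C ass = idt C (tens C (concat ass))"
    "unflat C ass \<cdot> flat C ass = idt C (tens C (map (tens C) ass))"
proof -
  have "flat C ass \<cdot> unflat C ass = idt C (tens C (concat ass)) \<and>
      unflat C ass \<cdot> flat C ass = idt C (tens C (map (tens C) ass))"
    using assms
  proof (induction ass)
    case (Cons as ass)
    then have [simp]: "set as \<subseteq> Obj C" "set (concat ass) \<subseteq> Obj C" "\<forall>as \<in> set ass. set as \<subseteq> Obj C"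
      by auto
    have 1: "(idt C (tens C as) \<boxtimes> flat C ass) \<cdot> (idt C (tens C as) \<boxtimes> unflat C ass) \<cdot> unjoin C as (concat ass) =
        unjoin C as (concat ass)"
      using Cons by (simp del: set_concat)
    have 2: "unjoin C as (concat ass) \<cdot> join C as (concat ass) \<cdot> (idt C (tens C as) \<boxtimes> flat C ass) =
        idt C (tens C as) \<boxtimes> flat C ass"
      by (subst pull[OF join_inverse(2)]) (simp_all del: set_concat)
    show ?case using Cons by (simp add: 1 2 del: set_concat merge_left)
  qed simp
  then show "flat C ass \<cdot> unflat C ass = idt C (tens C (concat ass))"
    "unflat C ass \<cdot> flat C ass = idt C (tens C (map (tens C) ass))" by auto
qed

lemma iso_flat [simp]:
  assumes "\<forall>as \<in> set ass. set as \<subseteq> Obj C"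
  shows "iso (flat C ass)" "iso (unflat C ass)"
  using assms by (auto intro: isoI[where g = "unflat C ass"] isoI[where g = "flat C ass"])

lemma det_flat [simp]:
  assumes "\<forall>as \<in> set ass. set as \<subseteq> Obj C"
  shows "det (flat C ass)" "det (unflat C ass)"
proof -
  have "det (flat C ass) \<and> det (unflat C ass)"
    using assms
  proof (induction ass)
    case (Cons as ass)
    then have "set as \<subseteq> Obj C" "set (concat ass) \<subseteq> Obj C" by auto
    with Cons show ?case by (simp del: set_concat)
  qed simp
  then show "det (flat C ass)" "det (unflat C ass)" by auto
qed

lemma join_nat:
  assumes "set fs \<subseteq> Arr C" "set gs \<subseteq> Arr C"
  shows "join C (map (tgt C) fs) (map (tgt C) gs) \<cdot> (tensm C fs \<boxtimes> tensm C gs) =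
    tensm C (fs @ gs) \<cdot> join C (map (src C) fs) (map (src C) gs)"
  using assms(1)
proof (induction fs)
  case Nil
  then show ?case using assms(2) by (simp add: lun_nat)
next
  case (Cons f fs)
  have o: "tgt C ` set l \<subseteq> Obj C" "src C ` set l \<subseteq> Obj C" if "set l \<subseteq> Arr C" for l
    using that by auto
  note [simp] = o[OF assms(2)] o[of fs]
  have "join C (map (tgt C) (f # fs)) (map (tgt C) gs) \<cdot> (tensm C (f # fs) \<boxtimes> tensm C gs) =
     (idt C (tgt C f) \<boxtimes> join C (map (tgt C) fs) (map (tgt C) gs)) \<cdot>
       asc C (tgt C f) (tens C (map (tgt C) fs)) (tens C (map (tgt C) gs)) \<cdot>
       ((f \<boxtimes> tensm C fs) \<boxtimes> tensm C gs)"
    using Cons.prems assms(2) by simp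
  also have "\<dots> = (f \<boxtimes> (join C (map (tgt C) fs) (map (tgt C) gs) \<cdot> (tensm C fs \<boxtimes> tensm C gs))) \<cdot>
      asc C (src C f) (tens C (map (src C) fs)) (tens C (map (src C) gs))"
    using Cons.prems assms(2) by (simp add: asc_nat)
  also have "\<dots> = tensm C ((f # fs) @ gs) \<cdot> join C (map (src C) (f # fs)) (map (src C) gs)"
    using Cons assms(2) by simp
  finally show ?case .
qed

text \<open>Induction on the blocks with \<open>join_nat\<close>, which rests on naturality of the
  associator. It later exchanges block tensors and flat tensors of the components of an
  abstraction.\<close>

lemma flat_nat:
  assumes "\<forall>fs \<in> set fss. set fs \<subseteq> Arr C"
  shows "flat C (map (map (tgt C)) fss) \<cdot> tensm C (map (tensm C) fss) =
    tensm C (concat fss) \<cdot> flat C (map (map (src C)) fss)"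
  using assms
proof (induction fss)
  case (Cons fs fss)
  have o: "tgt C ` set l \<subseteq> Obj C" "src C ` set l \<subseteq> Obj C" if "set l \<subseteq> Arr C" for l
    using that by auto
  have t: "tensm C ` set fss \<subseteq> Arr C"
    using Cons.prems by auto
  have c: "set (concat fss) \<subseteq> Arr C"
    using Cons.prems by auto
  note [simp] = o[OF c, simplified] o[of fs] t c[simplified]
  have mm: "map (\<lambda>x. tgt C (tensm C x)) fss = map (\<lambda>x. tens C (map (tgt C) x)) fss"
    "map (\<lambda>x. src C (tensm C x)) fss = map (\<lambda>x. tens C (map (src C) x)) fss"
    using Cons.prems by auto
  have q: "\<forall>x\<in>set fss. tgt C ` set x \<subseteq> Obj C" "\<forall>x\<in>set fss. src C ` set x \<subseteq> Obj C"
    using Cons.prems o by simp_all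
  have "flat C (map (map (tgt C)) (fs # fss)) \<cdot> tensm C (map (tensm C) (fs # fss)) =
      join C (map (tgt C) fs) (map (tgt C) (concat fss)) \<cdot>
        (tensm C fs \<boxtimes> (flat C (map (map (tgt C)) fss) \<cdot> tensm C (map (tensm C) fss)))"
    using Cons.prems q by (simp add: map_concat[symmetric] comp_def mm)
  also have "\<dots> = join C (map (tgt C) fs) (map (tgt C) (concat fss)) \<cdot> (tensm C fs \<boxtimes> tensm C (concat fss)) \<cdot>
      (idt C (tens C (map (src C) fs)) \<boxtimes> flat C (map (map (src C)) fss))"
    using Cons q by (simp add: map_concat[symmetric] comp_def)
  also have "\<dots> = (tensm C (fs @ concat fss) \<cdot> join C (map (src C) fs) (map (src C) (concat fss))) \<cdot>
      (idt C (tens C (map (src C) fs)) \<boxtimes> flat C (map (map (src C)) fss))"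
    by (subst pull[OF join_nat]) (use Cons.prems q in \<open>simp_all add: map_concat[symmetric] comp_def\<close>)
  also have "\<dots> = tensm C (concat (fs # fss)) \<cdot> flat C (map (map (src C)) (fs # fss))"
    using Cons.prems q by (simp add: map_concat[symmetric] comp_def)
  finally show ?case .
qed simp

subsection \<open>Wirings\<close>

text \<open>The other copy is discarded untouched, so the counit law and naturality of the unitor
  apply to an arbitrary \<open>f\<close>.\<close>

lemma counit_cmp:
  assumes "f \<in> Arr C" "a = src C f" "b = tgt C f"
  shows "lun C b \<cdot> (dsc C a \<boxtimes> f) \<cdot> cpy C a = f" "run C b \<cdot> (f \<boxtimes> dsc C a) \<cdot> cpy C a = f"
proof -
  have "lun C b \<cdot> (dsc C a \<boxtimes> f) \<cdot> cpy C a = lun C b \<cdot> (idt C (unt C) \<boxtimes> f) \<cdot> (dsc C a \<boxtimes> idt C a) \<cdot> cpy C a"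
    using assms by simp
  also have "\<dots> = f"
    using assms(1) unfolding assms(2,3) by (subst pull[OF lun_nat]) (auto simp: counit)
  finally show "lun C b \<cdot> (dsc C a \<boxtimes> f) \<cdot> cpy C a = f" .
  have "run C b \<cdot> (f \<boxtimes> dsc C a) \<cdot> cpy C a = run C b \<cdot> (f \<boxtimes> idt C (unt C)) \<cdot> (idt C a \<boxtimes> dsc C a) \<cdot> cpy C a"
    using assms by simp
  also have "\<dots> = f"
    using assms(1) unfolding assms(2,3) by (subst pull[OF run_nat]) (auto simp: counit)
  finally show "run C b \<cdot> (f \<boxtimes> dsc C a) \<cdot> cpy C a = f" .
qed

lemma label_obj [simp]: "y \<in> set xs \<Longrightarrow> ob ` set xs \<subseteq> Obj C \<Longrightarrow> ob y \<in> Obj C"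
  by auto

lemma proj_arr [simp]:
  assumes "y \<in> set xs" "ob ` set xs \<subseteq> Obj C"
  shows "proj C ob xs y \<in> Arr C" "src C (proj C ob xs y) = tens C (map ob xs)" "tgt C (proj C ob xs y) = ob y"
  using assms by (induction xs) auto

lemma det_proj [simp]:
  assumes "y \<in> set xs" "ob ` set xs \<subseteq> Obj C"
  shows "det (proj C ob xs y)"
  using assms by (induction xs) auto

lemma wire_arr [simp]:
  assumes "set ys \<subseteq> set xs" "ob ` set xs \<subseteq> Obj C"
  shows "wire C ob xs ys \<in> Arr C" "src C (wire C ob xs ys) = tens C (map ob xs)"
    "tgt C (wire C ob xs ys) = tens C (map ob ys)"
  using assms by (induction ys) auto

lemma det_wire [simp]:
  assumes "set ys \<subseteq> set xs" "ob ` set xs \<subseteq> Obj C"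
  shows "det (wire C ob xs ys)"
  using assms by (induction ys) auto

lemma regroup_arr [simp]:
  assumes "\<forall>ys \<in> set yss. set ys \<subseteq> set xs" "ob ` set xs \<subseteq> Obj C"
  shows "regroup C ob xs yss \<in> Arr C" "src C (regroup C ob xs yss) = tens C (map ob xs)"
    "tgt C (regroup C ob xs yss) = tens C (map (\<lambda>ys. tens C (map ob ys)) yss)"
  using assms by (induction yss) auto

lemma det_regroup [simp]:
  assumes "\<forall>ys \<in> set yss. set ys \<subseteq> set xs" "ob ` set xs \<subseteq> Obj C"
  shows "det (regroup C ob xs yss)"
  using assms by (induction yss) auto

text \<open>Both sides copy the input once per output wire; they differ in the bracketing of the
  copies, which \<open>asc_nat\<close> and \<open>cpy_coassoc\<close> reconcile.\<close>

lemma wire_append: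
  assumes "set ys \<subseteq> set xs" "set zs \<subseteq> set xs" "ob ` set xs \<subseteq> Obj C"
  shows "join C (map ob ys) (map ob zs) \<cdot> (wire C ob xs ys \<boxtimes> wire C ob xs zs) \<cdot> cpy C (tens C (map ob xs)) =
    wire C ob xs (ys @ zs)"
  using assms(1)
proof (induction ys)
  case Nil
  then show ?case using assms(2,3) by (simp add: counit_cmp)
next
  case (Cons y ys)
  let ?a = "tens C (map ob xs)" and ?p = "proj C ob xs y" and ?w = "wire C ob xs"
  have [simp]: "?a \<in> Obj C" "ob y \<in> Obj C" "y \<in> set xs" "ob ` set ys \<subseteq> Obj C" "ob ` set zs \<subseteq> Obj C"
    "set ys \<subseteq> set xs"
    using Cons.prems assms subset_trans[OF image_mono assms(3)]
    by (simp_all add: label_obj[OF _ assms(3)])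
  note [simp] = assms(2,3)
  have "join C (map ob (y # ys)) (map ob zs) \<cdot> (?w (y # ys) \<boxtimes> ?w zs) \<cdot> cpy C ?a =
      (idt C (ob y) \<boxtimes> join C (map ob ys) (map ob zs)) \<cdot> asc C (ob y) (tens C (map ob ys)) (tens C (map ob zs)) \<cdot>
        ((?p \<boxtimes> ?w ys) \<boxtimes> ?w zs) \<cdot> (cpy C ?a \<boxtimes> idt C ?a) \<cdot> cpy C ?a"
    by simp
  also have "\<dots> = (?p \<boxtimes> (join C (map ob ys) (map ob zs) \<cdot> (?w ys \<boxtimes> ?w zs))) \<cdot>
        asc C ?a ?a ?a \<cdot> (cpy C ?a \<boxtimes> idt C ?a) \<cdot> cpy C ?a"
    by (subst pull[OF asc_nat]) auto
  also have "\<dots> = (?p \<boxtimes> (join C (map ob ys) (map ob zs) \<cdot> (?w ys \<boxtimes> ?w zs) \<cdot> cpy C ?a)) \<cdot> cpy C ?a"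
    by (simp add: cpy_coassoc)
  finally show ?case using Cons by simp
qed

text \<open>Selecting one component discards the others, so nothing has to pass through a copy:
  \<open>counit_cmp\<close> and terminality suffice.\<close>

lemma proj_wire:
  assumes "set ys \<subseteq> set xs" "z \<in> set ys" "ob ` set xs \<subseteq> Obj C"
  shows "proj C ob ys z \<cdot> wire C ob xs ys = proj C ob xs z"
  using assms(1,2)
proof (induction ys)
  case (Cons y ys)
  then have [simp]: "ob y \<in> Obj C" "y \<in> set xs" "ob ` set ys \<subseteq> Obj C" "set ys \<subseteq> set xs"
    using assms(3) by auto
  show ?case
  proof (cases "y = z")
    case True
    then have "ob z \<in> Obj C" using assms(3) Cons.prems by auto
    with True show ?thesis using assms(3) Cons.prems by (auto simp: counit_cmp)
  next
    case False
    then have [simp]: "z \<in> set ys" "y \<noteq> z" using Cons.prems by auto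
    have z [simp]: "z \<in> set xs" by (rule subsetD[of "set ys"]) simp_all
    have [simp]: "ob z \<in> Obj C" using z assms(3) by (rule label_obj)
    show ?thesis using assms(3) Cons.IH by (simp add: counit_cmp)
  qed
qed simp

text \<open>Here the inner wiring feeds several outputs and must pass through the copy, which is
  allowed because wirings are deterministic.\<close>

lemma wire_wire:
  assumes "set ys \<subseteq> set xs" "set zs \<subseteq> set ys" "ob ` set xs \<subseteq> Obj C"
  shows "wire C ob ys zs \<cdot> wire C ob xs ys = wire C ob xs zs"
  using assms(2)
proof (induction zs)
  case Nil
  have "ob ` set ys \<subseteq> Obj C" using assms by auto
  then show ?case using assms by simp
next
  case (Cons z zs)
  then have [simp]: "z \<in> set ys" "set zs \<subseteq> set ys" "ob ` set ys \<subseteq> Obj C" "ob z \<in> Obj C" "z \<in> set xs" "set zs \<subseteq> set xs"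
    using assms by auto
  show ?case using Cons assms by (simp add: det_cpy_cmp proj_wire)
qed

text \<open>The wire \<open>x\<close> is not among the outputs and hence is discarded in every
  projection; determinism of \<open>snd_arr\<close> pulls this common discard in front of the
  copies.\<close>

lemma wire_Cons:
  assumes "x \<notin> set ys" "set ys \<subseteq> set xs" "ob x \<in> Obj C" "ob ` set xs \<subseteq> Obj C"
  shows "wire C ob (x # xs) ys = wire C ob xs ys \<cdot> snd_arr (ob x) (tens C (map ob xs))"
  using assms(1,2)
proof (induction ys)
  case Nil
  then show ?case using assms by simp
next
  case (Cons y ys)
  then have [simp]: "y \<in> set xs" "x \<noteq> y" "ob y \<in> Obj C" "set ys \<subseteq> set xs" using assms by auto
  note [simp] = assms(3,4)
  have p: "proj C ob (x # xs) y = proj C ob xs y \<cdot> snd_arr (ob x) (tens C (map ob xs))"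
  proof -
    have "proj C ob (x # xs) y = lun C (ob y) \<cdot> (idt C (unt C) \<boxtimes> proj C ob xs y) \<cdot>
        (dsc C (ob x) \<boxtimes> idt C (tens C (map ob xs)))"
      by simp
    then show ?thesis by (simp add: snd_arr_def pull[OF lun_nat] del: merge)
  qed
  have q: "wire C ob (x # xs) ys = wire C ob xs ys \<cdot> snd_arr (ob x) (tens C (map ob xs))"
    using Cons by simp
  show ?case by (simp add: p q det_cpy_cmp del: proj.simps)
qed

text \<open>In the induction the head of the tuple is \<open>fst_arr\<close> and the tail is
  \<open>snd_arr\<close> by \<open>wire_Cons\<close>, where distinctness keeps \<open>x\<close> out
  of the tail; \<open>pair_eta\<close> glues them.\<close>

lemma wire_id:
  assumes "distinct xs" "ob ` set xs \<subseteq> Obj C"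
  shows "wire C ob xs xs = idt C (tens C (map ob xs))"
  using assms
proof (induction xs)
  case (Cons x xs)
  then have "wire C ob (x # xs) xs = snd_arr (ob x) (tens C (map ob xs))"
    by (simp add: wire_Cons)
  moreover have "proj C ob (x # xs) x = fst_arr (ob x) (tens C (map ob xs))"
    by (simp add: fst_arr_def)
  ultimately show ?case using Cons.prems pair_eta[of "ob x" "tens C (map ob xs)"] by simp
qed simp

text \<open>Reduces the bracketed wiring to an unbracketed one, for which the composition law
  \<open>wire_wire\<close> is available.\<close>

lemma regroup_eq_wire:
  assumes "\<forall>ys \<in> set yss. set ys \<subseteq> set xs" "ob ` set xs \<subseteq> Obj C"
  shows "flat C (map (map ob) yss) \<cdot> regroup C ob xs yss = wire C ob xs (concat yss)"
  using assms(1)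
proof (induction yss)
  case Nil
  then show ?case using assms(2) by simp
next
  case (Cons ys yss)
  have o: "\<forall>zs\<in>set yss. ob ` set zs \<subseteq> Obj C" "ob ` set ys \<subseteq> Obj C" "ob ` set (concat yss) \<subseteq> Obj C"
    "set (concat yss) \<subseteq> set xs" "set ys \<subseteq> set xs"
    using Cons.prems assms(2) by fastforce+
  note [simp] = o assms(2)
  have "flat C (map (map ob) (ys # yss)) \<cdot> regroup C ob xs (ys # yss) =
     join C (map ob ys) (map ob (concat yss)) \<cdot>
      (wire C ob xs ys \<boxtimes> (flat C (map (map ob) yss) \<cdot> regroup C ob xs yss)) \<cdot> cpy C (tens C (map ob xs))"
    using Cons.prems o by (simp add: map_concat[symmetric] comp_def)
  also have "\<dots> = wire C ob xs (concat (ys # yss))"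
    using Cons wire_append[of ys xs "concat yss" ob] by (simp del: set_concat)
  finally show ?case .
qed

text \<open>Up to the invertible \<open>flat\<close>, this is a wiring between two duplicate-free
  listings of the same labels, and the wiring in the other direction is its inverse.\<close>

lemma iso_regroup [simp]:
  assumes "distinct xs" "distinct (concat yss)" "set xs = set (concat yss)" "ob ` set xs \<subseteq> Obj C"
  shows "iso (regroup C ob xs yss)"
proof -
  let ?ys = "concat yss"
  have o: "\<forall>ys\<in>set yss. ob ` set ys \<subseteq> Obj C" "\<forall>ys\<in>set yss. set ys \<subseteq> set xs" "ob ` set ?ys \<subseteq> Obj C"
    using assms by auto
  have i: "iso (wire C ob xs ?ys)"
    by (rule isoI[where g = "wire C ob ?ys xs"])
      (use assms o in \<open>simp_all add: wire_wire wire_id del: set_concat\<close>)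
  have "regroup C ob xs yss = unflat C (map (map ob) yss) \<cdot> flat C (map (map ob) yss) \<cdot> regroup C ob xs yss"
    using assms o by (subst pull[OF flat_inverse(2)]) (simp_all add: comp_def)
  also have "\<dots> = unflat C (map (map ob) yss) \<cdot> wire C ob xs ?ys"
    using assms o by (simp add: regroup_eq_wire)
  finally show ?thesis
    using i o assms by (simp add: map_concat del: set_concat)
qed

section \<open>Typing of states, iterated copies and \<open>zipten\<close>\<close>

lemma states_arr [simp]:
  assumes "\<forall>s \<in> set ss. s \<in> Arr C \<and> src C s = unt C"
  shows "states C ss \<in> Arr C" "src C (states C ss) = unt C" "tgt C (states C ss) = tens C (map (tgt C) ss)"
  using assms by (induction ss) auto

lemma ncopy_arr [simp]:
  assumes "a \<in> Obj C"
  shows "ncopy C m a \<in> Arr C" "src C (ncopy C m a) = a" "tgt C (ncopy C m a) = tens C (replicate m a)"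
  using assms by (induction m) auto

lemma zipten_arr [simp]:
  assumes "length as = length bs" "set as \<subseteq> Obj C" "set bs \<subseteq> Obj C"
  shows "zipten C as bs \<in> Arr C" "src C (zipten C as bs) = tens C as \<otimes> tens C bs"
    "tgt C (zipten C as bs) = tens C (map2 (\<lambda>a b. a \<otimes> b) as bs)"
proof -
  have z: "set (map2 (\<lambda>a b. a \<otimes> b) as bs) \<subseteq> Obj C" if "set as \<subseteq> Obj C" "set bs \<subseteq> Obj C" for as bs
    using that by (auto simp: subset_iff intro!: ten_obj intro: set_zip_leftD set_zip_rightD)
  have "zipten C as bs \<in> Arr C \<and> src C (zipten C as bs) = tens C as \<otimes> tens C bs \<and>
    tgt C (zipten C as bs) = tens C (map2 (\<lambda>a b. a \<otimes> b) as bs)"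
    using assms
  proof (induction as bs rule: list_induct2)
    case (Cons a as b bs)
    then show ?case using z[of as bs] by simp
  qed simp
  then show "zipten C as bs \<in> Arr C" "src C (zipten C as bs) = tens C as \<otimes> tens C bs"
    "tgt C (zipten C as bs) = tens C (map2 (\<lambda>a b. a \<otimes> b) as bs)" by auto
qed

end

section \<open>Functors\<close>

locale markov_functor_between = src: markov C + tgt: markov D + markov_functor C D F
  for C :: "('o, 'm) mcat" and D :: "('p, 'n) mcat" (structure) and F :: "('o, 'm, 'p, 'n) mfun"
begin

declare fob_obj [simp]

lemma fob_image_obj [simp]: "A \<subseteq> Obj C \<Longrightarrow> fob F ` A \<subseteq> Obj D"
  by auto

lemma far_arr [simp]:
  assumes "f \<in> Arr C"
  shows "far F f \<in> Arr D" "src D (far F f) = fob F (src C f)" "tgt D (far F f) = fob F (tgt C f)"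
  using far_hom[of f "src C f" "tgt C f"] assms by (auto simp: hom_def)

lemma fmu_arr [simp]:
  assumes "a \<in> Obj C" "b \<in> Obj C"
  shows "fmu F a b \<in> Arr D" "src D (fmu F a b) = fob F a \<otimes> fob F b" "tgt D (fmu F a b) = fob F (a \<otimes>\<^bsub>C\<^esub> b)"
    "tgt.iso (fmu F a b)" "tgt.det (fmu F a b)"
  using fmu_hom[OF assms] fmu_iso[OF assms] fmu_det[OF assms]
  unfolding hom_def tgt.iso_def tgt.det_def by blast+

lemma fnu_arr [simp]:
  "fnu F \<in> Arr D" "src D (fnu F) = unt D" "tgt D (fnu F) = fob F (unt C)"
  "tgt.iso (fnu F)" "tgt.det (fnu F)"
  using fnu_hom fnu_iso fnu_det unfolding hom_def tgt.iso_def tgt.det_def by blast+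

declare far_idt [simp]

lemma far_compose [simp]:
  assumes "f \<in> Arr C" "g \<in> Arr C" "tgt C f = src C g"
  shows "far F (g \<cdot>\<^bsub>C\<^esub> f) = far F g \<cdot> far F f"
  using far_cmp[of f "src C f" "tgt C f" g "tgt C g"] assms by (simp add: hom_def)

lemma fmu_nat:
  assumes "f \<in> Arr C" "g \<in> Arr C" "a = tgt C f" "b = tgt C g"
  shows "fmu F a b \<cdot> (far F f \<boxtimes> far F g) = far F (f \<boxtimes>\<^bsub>C\<^esub> g) \<cdot> fmu F (src C f) (src C g)"
  using fmu_natural[of f "src C f" "tgt C f" g "src C g" "tgt C g"] assms by (simp add: hom_def)

lemma iso_far [simp]:
  assumes "src.iso f"
  shows "tgt.iso (far F f)"
proof (rule tgt.isoI)
  show "far F (src.inv_arr f) \<cdot> far F f = idt D (src D (far F f))"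
    using assms by (subst far_compose[symmetric]) auto
  show "far F f \<cdot> far F (src.inv_arr f) = idt D (tgt D (far F f))"
    using assms by (subst far_compose[symmetric]) auto
qed (use assms in simp_all)

lemma fcoh_arr [simp]:
  assumes "set as \<subseteq> Obj C"
  shows "fcoh C D F as \<in> Arr D" "src D (fcoh C D F as) = tens D (map (fob F) as)"
    "tgt D (fcoh C D F as) = fob F (tens C as)"
  using assms by (induction as) auto

lemma iso_det_fcoh [simp]:
  assumes "set as \<subseteq> Obj C"
  shows "tgt.iso (fcoh C D F as)" "tgt.det (fcoh C D F as)"
  using assms by (induction as) auto

end

locale strict_markov_functor = markov_functor_between +
  assumes strict: "strict_functor C D F"
begin

lemma strict_simps [simp]:
  "a \<in> Obj C \<Longrightarrow> b \<in> Obj C \<Longrightarrow> fob F (a \<otimes>\<^bsub>C\<^esub> b) = fob F a \<otimes> fob F b"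
  "a \<in> Obj C \<Longrightarrow> b \<in> Obj C \<Longrightarrow> fmu F a b = idt D (fob F a \<otimes> fob F b)"
  "fob F (unt C) = unt D" "fnu F = idt D (unt D)"
  using strict by (auto simp: strict_functor_def)

lemma far_tenm [simp]:
  "f \<in> Arr C \<Longrightarrow> g \<in> Arr C \<Longrightarrow> far F (f \<boxtimes>\<^bsub>C\<^esub> g) = far F f \<boxtimes> far F g"
  using fmu_nat[of f g] by simp

text \<open>With identities as structure maps, \<open>fmu_asc\<close> reads off the image of
  \<open>asc\<close>. The functor laws speak of \<open>asc\<close> alone, so the image of its
  inverse is obtained by cancellation.\<close>

lemma far_asc [simp]:
  assumes "a \<in> Obj C" "b \<in> Obj C" "c \<in> Obj C"
  shows "far F (asc C a b c) = asc D (fob F a) (fob F b) (fob F c)"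
    "far F (asci C a b c) = asci D (fob F a) (fob F b) (fob F c)"
proof -
  have a: "src D (far F (asc C a b c)) = (fob F a \<otimes> fob F b) \<otimes> fob F c"
    using assms by simp
  show *: "far F (asc C a b c) = asc D (fob F a) (fob F b) (fob F c)"
    using fmu_asc[OF assms] assms a by simp
  have "far F (asc C a b c) \<cdot> far F (asci C a b c) = idt D (fob F a \<otimes> (fob F b \<otimes> fob F c))"
    using assms by (subst far_compose[symmetric]) auto
  then have "asc D (fob F a) (fob F b) (fob F c) \<cdot> far F (asci C a b c) =
      asc D (fob F a) (fob F b) (fob F c) \<cdot> asci D (fob F a) (fob F b) (fob F c)"
    using assms by (simp add: *)
  then show "far F (asci C a b c) = asci D (fob F a) (fob F b) (fob F c)"
    by (rule tgt.iso_mono) (use assms in simp_all)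
qed

lemma far_lun [simp]:
  assumes "a \<in> Obj C"
  shows "far F (lun C a) = lun D (fob F a)" "far F (luni C a) = luni D (fob F a)"
proof -
  show *: "far F (lun C a) = lun D (fob F a)"
    using fmu_lun[OF assms] assms by simp
  have "far F (lun C a) \<cdot> far F (luni C a) = idt D (fob F a)"
    using assms by (subst far_compose[symmetric]) auto
  then have "lun D (fob F a) \<cdot> far F (luni C a) = lun D (fob F a) \<cdot> luni D (fob F a)"
    using assms by (simp add: *)
  then show "far F (luni C a) = luni D (fob F a)"
    by (rule tgt.iso_mono) (use assms in simp_all)
qed

lemma far_run [simp]:
  assumes "a \<in> Obj C"
  shows "far F (run C a) = run D (fob F a)"
  using fmu_run[OF assms] assms by simp

lemma far_swp [simp]:
  assumes "a \<in> Obj C" "b \<in> Obj C"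
  shows "far F (swp C a b) = swp D (fob F a) (fob F b)"
  using fmu_swp[OF assms] assms by simp

lemma far_cpy_strict [simp]: "a \<in> Obj C \<Longrightarrow> far F (cpy C a) = cpy D (fob F a)"
  by (simp add: far_cpy)

lemma far_dsc [simp]: "a \<in> Obj C \<Longrightarrow> far F (dsc C a) = dsc D (fob F a)"
  by (rule tgt.to_unt_eq) simp_all

lemma fob_tens [simp]: "set as \<subseteq> Obj C \<Longrightarrow> fob F (tens C as) = tens D (map (fob F) as)"
  by (induction as) auto

lemma far_tensm: "set fs \<subseteq> Arr C \<Longrightarrow> far F (tensm C fs) = tensm D (map (far F) fs)"
  by (induction fs) auto

lemma far_join [simp]:
  assumes "set as \<subseteq> Obj C" "set bs \<subseteq> Obj C"
  shows "far F (join C as bs) = join D (map (fob F) as) (map (fob F) bs)"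
    "far F (unjoin C as bs) = unjoin D (map (fob F) as) (map (fob F) bs)"
  using assms by (induction as) simp_all

lemma far_flat [simp]:
  assumes "\<forall>as \<in> set ass. set as \<subseteq> Obj C"
  shows "far F (flat C ass) = flat D (map (map (fob F)) ass)"
    "far F (unflat C ass) = unflat D (map (map (fob F)) ass)"
proof -
  have "far F (flat C ass) = flat D (map (map (fob F)) ass) \<and>
      far F (unflat C ass) = unflat D (map (map (fob F)) ass)"
    using assms
  proof (induction ass)
    case (Cons as ass)
    then have "set (concat ass) \<subseteq> Obj C" by auto
    with Cons show ?case by (simp add: map_concat[symmetric] del: set_concat)
  qed simp
  then show "far F (flat C ass) = flat D (map (map (fob F)) ass)"
    "far F (unflat C ass) = unflat D (map (map (fob F)) ass)" by auto
qed

lemma far_proj: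
  assumes "y \<in> set xs" "ob ` set xs \<subseteq> Obj C"
  shows "far F (proj C ob xs y) = proj D (\<lambda>x. fob F (ob x)) xs y"
  using assms
proof (induction xs)
  case (Cons x xs)
  then have "fob F (tens C (map ob xs)) = tens D (map (\<lambda>x. fob F (ob x)) xs)"
    by (simp add: comp_def)
  with Cons show ?case using src.label_obj[of y xs ob] by auto
qed simp

lemma far_wire:
  assumes "set ys \<subseteq> set xs" "ob ` set xs \<subseteq> Obj C"
  shows "far F (wire C ob xs ys) = wire D (\<lambda>x. fob F (ob x)) xs ys"
  using assms by (induction ys) (simp_all add: far_proj comp_def)

lemma far_regroup:
  assumes "\<forall>ys \<in> set yss. set ys \<subseteq> set xs" "ob ` set xs \<subseteq> Obj C"
  shows "far F (regroup C ob xs yss) = regroup D (\<lambda>x. fob F (ob x)) xs yss"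
  using assms by (induction yss) (simp_all add: far_wire comp_def)

lemma fcoh_strict: "set as \<subseteq> Obj C \<Longrightarrow> fcoh C D F as = idt D (tens D (map (fob F) as))"
  by (induction as) auto

end

text \<open>With identities as structure maps, each coherence condition says that a structure map is
  preserved on the nose. The premises cover exactly the structure maps that occur in the functor
  laws; the values on inverses and discards are consequences.\<close>

lemma strict_functorI:
  fixes C :: "('o, 'm) mcat" and D :: "('p, 'n) mcat" (structure) and F :: "('o, 'm, 'p, 'n) mfun"
  assumes "markov C" "markov D"
    and "fob F \<in> extensional (Obj C)" "far F \<in> extensional (Arr C)"
    and "fmu F = (\<lambda>a b. if a \<in> Obj C \<and> b \<in> Obj C then idt D (fob F a \<otimes> fob F b) else undefined)"
    and "fnu F = idt D (unt D)"
    and "\<And>a. a \<in> Obj C \<Longrightarrow> fob F a \<in> Obj D"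
    and "\<And>a b. a \<in> Obj C \<Longrightarrow> b \<in> Obj C \<Longrightarrow> fob F (a \<otimes>\<^bsub>C\<^esub> b) = fob F a \<otimes> fob F b"
    and "fob F (unt C) = unt D"
    and "\<And>f. f \<in> Arr C \<Longrightarrow> far F f \<in> hom D (fob F (src C f)) (fob F (tgt C f))"
    and "\<And>a. a \<in> Obj C \<Longrightarrow> far F (idt C a) = idt D (fob F a)"
    and "\<And>f g. f \<in> Arr C \<Longrightarrow> g \<in> Arr C \<Longrightarrow> tgt C f = src C g \<Longrightarrow> far F (g \<cdot>\<^bsub>C\<^esub> f) = far F g \<cdot> far F f"
    and "\<And>f g. f \<in> Arr C \<Longrightarrow> g \<in> Arr C \<Longrightarrow> far F (f \<boxtimes>\<^bsub>C\<^esub> g) = far F f \<boxtimes> far F g"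
    and "\<And>a b c. a \<in> Obj C \<Longrightarrow> b \<in> Obj C \<Longrightarrow> c \<in> Obj C \<Longrightarrow>
      far F (asc C a b c) = asc D (fob F a) (fob F b) (fob F c)"
    and "\<And>a. a \<in> Obj C \<Longrightarrow> far F (lun C a) = lun D (fob F a)"
    and "\<And>a. a \<in> Obj C \<Longrightarrow> far F (run C a) = run D (fob F a)"
    and "\<And>a b. a \<in> Obj C \<Longrightarrow> b \<in> Obj C \<Longrightarrow> far F (swp C a b) = swp D (fob F a) (fob F b)"
    and "\<And>a. a \<in> Obj C \<Longrightarrow> far F (cpy C a) = cpy D (fob F a)"
  shows "strict_markov_functor C D F"
proof -
  interpret src: markov C by fact
  interpret tgt: markov D by fact
  have far_arr [simp]: "far F f \<in> Arr D" "src D (far F f) = fob F (src C f)" "tgt D (far F f) = fob F (tgt C f)"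
    if "f \<in> Arr C" for f
    using assms(10)[OF that] by (auto simp: hom_def)
  have iso: "iso_arr D (idt D a)" if "a \<in> Obj D" for a
    using tgt.iso_idt[OF that] unfolding tgt.iso_def by blast
  have det: "deterministic D (idt D a)" if "a \<in> Obj D" for a
    using tgt.det_idt[OF that] unfolding tgt.det_def by blast
  note [simp] = assms(5-9) assms(11-)
  show ?thesis
  proof unfold_locales
    show "strict_functor C D F"
      by (simp add: strict_functor_def)
  qed (use assms(3,4) in \<open>auto simp: hom_def iso det\<close>)
qed

lemma strict_fcomp:
  assumes "strict_markov_functor C D F" "strict_markov_functor D B G"
  shows "strict_markov_functor C B (fcomp C B G F)"
proof -
  interpret F: strict_markov_functor C D F by fact
  interpret G: strict_markov_functor D B G by fact
  show ?thesis
    by (rule strict_functorI)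
      (auto simp: fcomp_def hom_def fun_eq_iff F.src.markov_axioms G.tgt.markov_axioms)
qed

section \<open>The free Markov category\<close>

lemma term_cat_simps [simp]:
  "Obj (term_cat S) = words S" "Arr (term_cat S) = {t. wf_term S t}"
  "src (term_cat S) = tsrc S" "tgt (term_cat S) = ttgt S" "idt (term_cat S) = TIdt"
  "cmp (term_cat S) = TCmp" "ten (term_cat S) = WTen" "tenm (term_cat S) = TTen"
  "unt (term_cat S) = WUnit" "asc (term_cat S) = TAsc" "asci (term_cat S) = TAsci"
  "lun (term_cat S) = TLun" "luni (term_cat S) = TLuni" "run (term_cat S) = TRun"
  "runi (term_cat S) = TRuni" "swp (term_cat S) = TSwp" "cpy (term_cat S) = TCpy"
  "dsc (term_cat S) = TDsc"
  by (simp_all add: term_cat_def)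

lemma words_simps [simp]:
  "WUnit \<in> words S" "WVar x \<in> words S \<longleftrightarrow> x \<in> types S"
  "WTen a b \<in> words S \<longleftrightarrow> a \<in> words S \<and> b \<in> words S"
  by (auto simp: words_def)

lemma wlist_simps [simp]: "wlist [] = WUnit" "wlist (x # xs) = WTen (WVar x) (wlist xs)"
  by (simp_all add: wlist_def)

lemma wlist_words [simp]: "wlist xs \<in> words S \<longleftrightarrow> set xs \<subseteq> types S"
  by (induction xs) auto

lemma set_wlist [simp]: "set_word (wlist xs) = set xs"
  by (induction xs) auto

lemma weval_wlist: "weval C ob (wlist xs) = tens C (map ob xs)"
  by (induction xs) auto

lemma wf_term_words:
  assumes "wf_term S t"
  shows "tsrc S t \<in> words S" "ttgt S t \<in> words S"
  using assms by (induction t) auto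

lemma hom_term_cat [simp]: "t \<in> hom (term_cat S) a b \<longleftrightarrow> wf_term S t \<and> tsrc S t = a \<and> ttgt S t = b"
  by (auto simp: hom_def)

text \<open>It witnesses that the congruences intersected in \<open>free_eq\<close> include one that
  respects types, so that equivalent terms are well-formed and parallel.\<close>

definition parallel_terms :: "('t, 'g) qsig \<Rightarrow> ('t, 'g) mterm \<Rightarrow> ('t, 'g) mterm \<Rightarrow> bool" where
  "parallel_terms S t u \<longleftrightarrow> wf_term S t \<and> wf_term S u \<and> tsrc S t = tsrc S u \<and> ttgt S t = ttgt S u"

lemma parallel_congruence: "markov_upto (term_cat S) (parallel_terms S)"
  by unfold_locales (simp_all add: parallel_terms_def mid_def, (intro conjI wf_term_words; simp)+)

lemma free_eq_parallel: "free_eq S t u \<Longrightarrow> parallel_terms S t u"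
  using parallel_congruence by (auto simp: free_eq_def)

text \<open>The laws are Horn clauses in the relation and so survive intersection.
  \<open>E_parallel\<close> concludes something about types instead, and needs an actual congruence,
  namely \<open>parallel_terms\<close>.\<close>

lemma free_congruence: "markov_upto (term_cat S) (free_eq S)"
proof
  fix f f' g g' h a b c
  show "free_eq S g f" if "free_eq S f g"
    using that unfolding free_eq_def by (metis markov_upto.E_sym)
  show "free_eq S f h" if "free_eq S f g" "free_eq S g h"
    using that unfolding free_eq_def by (metis markov_upto.E_trans)
  show "g \<in> hom (term_cat S) a b" if "free_eq S f g" "f \<in> hom (term_cat S) a b"
    using that free_eq_parallel[of S f g] by (simp add: parallel_terms_def)
  show "free_eq S (cmp (term_cat S) g f) (cmp (term_cat S) g' f')"
    if "free_eq S f f'" "free_eq S g g'" "f \<in> hom (term_cat S) a b" "g \<in> hom (term_cat S) b c"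
    unfolding free_eq_def
  proof (intro allI impI)
    fix E assume E: "markov_upto (term_cat S) E"
    show "E (cmp (term_cat S) g f) (cmp (term_cat S) g' f')"
      by (rule markov_upto.E_cmp[OF E _ _ that(3,4)]) (use that(1,2) E in \<open>unfold free_eq_def, blast+\<close>)
  qed
  show "free_eq S (tenm (term_cat S) f g) (tenm (term_cat S) f' g')"
    if "free_eq S f f'" "free_eq S g g'" "f \<in> Arr (term_cat S)" "g \<in> Arr (term_cat S)"
    unfolding free_eq_def
  proof (intro allI impI)
    fix E assume E: "markov_upto (term_cat S) E"
    show "E (tenm (term_cat S) f g) (tenm (term_cat S) f' g')"
      by (rule markov_upto.E_tenm[OF E _ _ that(3,4)]) (use that(1,2) E in \<open>unfold free_eq_def, blast+\<close>)
  qed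
  (* The relation is instantiated by hand: as a head variable it would match every goal. *)
qed (unfold free_eq_def, ((simp; fail)[1] | (simp, intro conjI wf_term_words; simp; fail)[1] | (intro allI impI,
      (rule_tac E = E in markov_upto.E_refl; assumption
      | rule_tac E = E in markov_upto.idt_left; assumption
      | rule_tac E = E in markov_upto.idt_right; assumption
      | rule_tac E = E in markov_upto.cmp_assoc; assumption
      | rule_tac E = E in markov_upto.tenm_idt; assumption
      | rule_tac E = E in markov_upto.tenm_cmp; assumption
      | rule_tac E = E in markov_upto.asc_asci; assumption
      | rule_tac E = E in markov_upto.asci_asc; assumption
      | rule_tac E = E in markov_upto.lun_luni; assumption
      | rule_tac E = E in markov_upto.luni_lun; assumption
      | rule_tac E = E in markov_upto.run_runi; assumption
      | rule_tac E = E in markov_upto.runi_run; assumption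
      | rule_tac E = E in markov_upto.asc_natural; assumption
      | rule_tac E = E in markov_upto.lun_natural; assumption
      | rule_tac E = E in markov_upto.run_natural; assumption
      | rule_tac E = E in markov_upto.pentagon; assumption
      | rule_tac E = E in markov_upto.triangle; assumption
      | rule_tac E = E in markov_upto.swp_natural; assumption
      | rule_tac E = E in markov_upto.swp_swp; assumption
      | rule_tac E = E in markov_upto.hexagon; assumption
      | rule_tac E = E in markov_upto.cpy_coassoc; assumption
      | rule_tac E = E in markov_upto.cpy_counit_left; assumption
      | rule_tac E = E in markov_upto.cpy_counit_right; assumption
      | rule_tac E = E in markov_upto.cpy_cocomm; assumption
      | rule_tac E = E in markov_upto.cpy_unt; assumption
      | rule_tac E = E in markov_upto.cpy_ten; assumption
      | rule_tac E = E in markov_upto.terminal; assumption))[1])+)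

section \<open>Classes of terms and the quotient category\<close>

lemma tcls_refl: "wf_term S t \<Longrightarrow> t \<in> tcls S t"
  using markov_upto.E_refl[OF free_congruence, of t S] by (simp add: tcls_def)

lemma tcls_eqI:
  assumes "free_eq S t u"
  shows "tcls S t = tcls S u"
  using assms markov_upto.E_sym[OF free_congruence] markov_upto.E_trans[OF free_congruence]
  unfolding tcls_def by blast

text \<open>The operations of \<open>free_markov\<close> act on chosen representatives; these facts
  make the choice invisible.\<close>

lemma trep_tcls:
  assumes "wf_term S t"
  shows "free_eq S t (trep (tcls S t))" "wf_term S (trep (tcls S t))"
    "tcls S (trep (tcls S t)) = tcls S t" "tsrc S (trep (tcls S t)) = tsrc S t"
    "ttgt S (trep (tcls S t)) = ttgt S t"
proof -
  have "trep (tcls S t) \<in> tcls S t"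
    unfolding trep_def using tcls_refl[OF assms] by (rule someI)
  then show 1: "free_eq S t (trep (tcls S t))" "wf_term S (trep (tcls S t))"
    by (auto simp: tcls_def)
  show "tcls S (trep (tcls S t)) = tcls S t"
    using tcls_eqI[OF 1(1)] ..
  show "tsrc S (trep (tcls S t)) = tsrc S t" "ttgt S (trep (tcls S t)) = ttgt S t"
    using free_eq_parallel[OF 1(1)] by (simp_all add: parallel_terms_def)
qed

lemma free_markov_simps [simp]:
  "Obj (free_markov S) = words S" "Arr (free_markov S) = tcls S ` {t. wf_term S t}"
  "ten (free_markov S) = WTen" "unt (free_markov S) = WUnit"
  "idt (free_markov S) a = tcls S (TIdt a)"
  "asc (free_markov S) a b c = tcls S (TAsc a b c)" "asci (free_markov S) a b c = tcls S (TAsci a b c)"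
  "lun (free_markov S) a = tcls S (TLun a)" "luni (free_markov S) a = tcls S (TLuni a)"
  "run (free_markov S) a = tcls S (TRun a)" "runi (free_markov S) a = tcls S (TRuni a)"
  "swp (free_markov S) a b = tcls S (TSwp a b)"
  "cpy (free_markov S) a = tcls S (TCpy a)" "dsc (free_markov S) a = tcls S (TDsc a)"
  by (simp_all add: free_markov_def)

lemma free_markov_src_tgt [simp]:
  assumes "wf_term S t"
  shows "src (free_markov S) (tcls S t) = tsrc S t" "tgt (free_markov S) (tcls S t) = ttgt S t"
  using trep_tcls[OF assms] by (simp_all add: free_markov_def)

lemma free_markov_cmp [simp]:
  assumes "wf_term S f" "wf_term S g" "ttgt S f = tsrc S g"
  shows "tcls S g \<cdot>\<^bsub>free_markov S\<^esub> tcls S f = tcls S (TCmp g f)"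
proof -
  have "free_eq S (TCmp g f) (TCmp (trep (tcls S g)) (trep (tcls S f)))"
    using markov_upto.E_cmp[OF free_congruence trep_tcls(1) trep_tcls(1), of S f g] assms by simp
  then show ?thesis
    using tcls_eqI by (fastforce simp: free_markov_def)
qed

lemma free_markov_tenm [simp]:
  assumes "wf_term S f" "wf_term S g"
  shows "tcls S f \<boxtimes>\<^bsub>free_markov S\<^esub> tcls S g = tcls S (TTen f g)"
proof -
  have "free_eq S (TTen f g) (TTen (trep (tcls S f)) (trep (tcls S g)))"
    using markov_upto.E_tenm[OF free_congruence trep_tcls(1) trep_tcls(1), of S f g] assms by simp
  then show ?thesis
    using tcls_eqI by (fastforce simp: free_markov_def)
qed

lemma tcls_hom [simp]: "wf_term S t \<Longrightarrow> tsrc S t = a \<Longrightarrow> ttgt S t = b \<Longrightarrow> tcls S t \<in> hom (free_markov S) a b"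
  by (auto simp: hom_def)

lemma hom_free_markovE:
  assumes "K \<in> hom (free_markov S) a b"
  obtains t where "wf_term S t" "tsrc S t = a" "ttgt S t = b" "K = tcls S t"
  using assms by (auto simp: hom_def)

lemma markov_category_free: "markov_category (free_markov S)"
proof -
  interpret T: markov_upto "term_cat S" "free_eq S"
    by (rule free_congruence)
  note laws = T.idt_left T.idt_right T.cmp_assoc T.tenm_idt T.tenm_cmp T.asc_asci T.asci_asc
    T.lun_luni T.luni_lun T.run_runi T.runi_run T.asc_natural T.lun_natural T.run_natural
    T.pentagon T.triangle T.swp_natural T.swp_swp T.hexagon T.cpy_coassoc T.cpy_counit_left
    T.cpy_counit_right T.cpy_cocomm T.cpy_unt T.cpy_ten T.terminal
  \<comment> \<open>The laws are unfolded to statements about terms, so that, after representatives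
    are chosen, each equation between classes is an instance of a law under
    \<open>tcls_eqI\<close>.\<close>
  note laws' = laws[unfolded mid_def term_cat_simps hom_term_cat]
  show ?thesis
    unfolding markov_category_def
    by unfold_locales
      ((clarsimp simp: wf_term_words mid_def; fail)
        | (elim hom_free_markovE; clarsimp simp: wf_term_words mid_def; fail)
        | ((elim hom_free_markovE)?; clarsimp simp: wf_term_words mid_def; rule tcls_eqI; (rule laws'; simp)))+
qed

lemma markov_free: "markov (free_markov S)"
  by unfold_locales (rule markov_category_free)

lemma tens_WVar: "tens (free_markov S) (map WVar xs) = wlist xs"
  by (induction xs) auto

lemma gen_arr_hom:
  assumes "q \<in> gens S" "set (ins S q) \<subseteq> types S" "set (outs S q) \<subseteq> types S"
  shows "gen_arr S q \<in> hom (free_markov S) (wlist (ins S q)) (wlist (outs S q))"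
  using assms by (simp add: gen_arr_def)

section \<open>Universal property: evaluation of terms in a Markov category\<close>

locale free_model = markov D for D :: "('o, 'm) mcat" (structure) +
  fixes S :: "('t, 'g) qsig" and ob :: "'t \<Rightarrow> 'o" and ch :: "'g \<Rightarrow> 'm"
  assumes ob_obj: "ob ` types S \<subseteq> Obj D"
    and ch_hom: "q \<in> gens S \<Longrightarrow> set (ins S q) \<subseteq> types S \<Longrightarrow> set (outs S q) \<subseteq> types S \<Longrightarrow>
      ch q \<in> hom D (tens D (map ob (ins S q))) (tens D (map ob (outs S q)))"
begin

lemma weval_obj [simp]: "w \<in> words S \<Longrightarrow> weval D ob w \<in> Obj D"
  using ob_obj by (induction w) auto

lemma teval_arr [simp]:
  assumes "wf_term S t"
  shows "teval D ob ch t \<in> Arr D" "src D (teval D ob ch t) = weval D ob (tsrc S t)"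
    "tgt D (teval D ob ch t) = weval D ob (ttgt S t)"
proof -
  have "teval D ob ch t \<in> Arr D \<and> src D (teval D ob ch t) = weval D ob (tsrc S t) \<and>
    tgt D (teval D ob ch t) = weval D ob (ttgt S t)"
    using assms
  proof (induction t)
    case (TGen q)
    then show ?case using ch_hom[of q] by (simp add: hom_def weval_wlist)
  qed (simp_all add: wf_term_words)
  then show "teval D ob ch t \<in> Arr D" "src D (teval D ob ch t) = weval D ob (tsrc S t)"
    "tgt D (teval D ob ch t) = weval D ob (ttgt S t)" by auto
qed

text \<open>The heart of freeness: since \<open>D\<close> satisfies the Markov laws, having equal
  values is one of the congruences intersected in \<open>free_eq\<close>, so evaluation is constant
  on classes. Parallelism is added because a congruence must respect types.\<close>

lemma teval_congruence:
  "markov_upto (term_cat S) (\<lambda>t u. parallel_terms S t u \<and> teval D ob ch t = teval D ob ch u)"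
proof -
  interpret P: markov_upto "term_cat S" "parallel_terms S"
    by (rule parallel_congruence)
  have "teval D ob ch f = dsc D (weval D ob (tsrc S f))" if "wf_term S f \<and> ttgt S f = WUnit" for f
    using to_unt[of "teval D ob ch f"] that by simp
  then show ?thesis
    by unfold_locales
      (simp_all add: parallel_terms_def mid_def wf_term_words asc_nat lun_nat run_nat swp_nat
        pentagon triangle hexagon cpy_coassoc counit cpy_cocomm cpy_unt cpy_ten
        del: merge_left)
qed

lemma teval_free_eq: "free_eq S t u \<Longrightarrow> teval D ob ch t = teval D ob ch u"
  using teval_congruence by (auto simp: free_eq_def)

lemma model_of_tcls:
  assumes "wf_term S t"
  shows "far (model_of S D ob ch) (tcls S t) = teval D ob ch t"
  using teval_free_eq[OF trep_tcls(1)[OF assms]] assms by (simp add: model_of_def)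

lemma model_of_gen_arr:
  assumes "q \<in> gens S" "set (ins S q) \<subseteq> types S" "set (outs S q) \<subseteq> types S"
  shows "far (model_of S D ob ch) (gen_arr S q) = ch q"
  using assms model_of_tcls[of "TGen q"] by (simp add: gen_arr_def)

lemma strict_model_of: "strict_markov_functor (free_markov S) D (model_of S D ob ch)"
proof (rule strict_functorI)
  show "fmu (model_of S D ob ch) = (\<lambda>a b. if a \<in> Obj (free_markov S) \<and> b \<in> Obj (free_markov S)
      then idt D (fob (model_of S D ob ch) a \<otimes> fob (model_of S D ob ch) b) else undefined)"
    by (auto simp: model_of_def fun_eq_iff)
  show "fob (model_of S D ob ch) \<in> extensional (Obj (free_markov S))"
    "far (model_of S D ob ch) \<in> extensional (Arr (free_markov S))"
    by (simp_all add: model_of_def)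
qed (auto simp: markov_free markov_axioms model_of_tcls wf_term_words hom_def, simp_all add: model_of_def wf_term_words)

end

text \<open>The morphisms at which \<open>\<tau>\<close> is natural are closed under composition,
  tensor and inversion, and they contain the structure maps: \<open>asc\<close>, \<open>lun\<close>,
  \<open>run\<close>, \<open>swp\<close> by monoidality of \<open>\<tau>\<close>, \<open>cpy\<close>
  because the components are deterministic, \<open>dsc\<close> by terminality. Hence only generators
  have to be checked. \<open>F\<close> and \<open>G\<close> are not assumed strict, since the
  \<open>\<pi>\<close> of a downward abstraction is merely strong.\<close>

lemma markov_nat_freeI:
  fixes S :: "('t, 'g) qsig" and D :: "('o, 'm) mcat" (structure)
  assumes "markov_functor (free_markov S) D F" "markov_functor (free_markov S) D G" "markov D"
    and ext: "\<tau> \<in> extensional (words S)"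
    and hom: "\<And>w. w \<in> words S \<Longrightarrow> \<tau> w \<in> hom D (fob F w) (fob G w)"
    and det: "\<And>w. w \<in> words S \<Longrightarrow> deterministic D (\<tau> w)"
    and mu: "\<And>v w. v \<in> words S \<Longrightarrow> w \<in> words S \<Longrightarrow>
      \<tau> (WTen v w) \<cdot> fmu F v w = fmu G v w \<cdot> (\<tau> v \<boxtimes> \<tau> w)"
    and nu: "\<tau> WUnit \<cdot> fnu F = fnu G"
    and gen: "\<And>q. q \<in> gens S \<Longrightarrow> set (ins S q) \<subseteq> types S \<Longrightarrow> set (outs S q) \<subseteq> types S \<Longrightarrow>
      \<tau> (wlist (outs S q)) \<cdot> far F (gen_arr S q) = far G (gen_arr S q) \<cdot> \<tau> (wlist (ins S q))"
  shows "markov_nat (free_markov S) D F G \<tau>"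
proof -
  \<comment> \<open>The free category is hidden behind \<open>Q\<close>, so that the simplifier
    applies the abstract laws instead of unfolding operations into classes of terms.\<close>
  define Q where "Q = free_markov S"
  interpret Q: markov Q unfolding Q_def by (rule markov_free)
  interpret D: markov D by fact
  interpret F: markov_functor_between Q D F
    by (intro markov_functor_between.intro Q.markov_axioms D.markov_axioms) (simp add: Q_def assms)
  interpret G: markov_functor_between Q D G
    by (intro markov_functor_between.intro Q.markov_axioms D.markov_axioms) (simp add: Q_def assms)
  have Q_simps: "Obj Q = words S" "a \<otimes>\<^bsub>Q\<^esub> b = WTen a b" "unt Q = WUnit" for a b
    by (simp_all add: Q_def)
  have tau [simp]: "\<tau> w \<in> Arr D" "src D (\<tau> w) = fob F w" "tgt D (\<tau> w) = fob G w" "D.det (\<tau> w)"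
    if "w \<in> Obj Q" for w
    using hom[of w] det[of w] that by (auto simp: hom_def D.det_def Q_simps)
  have mu': "\<tau> (v \<otimes>\<^bsub>Q\<^esub> w) \<cdot> fmu F v w = fmu G v w \<cdot> (\<tau> v \<boxtimes> \<tau> w)"
    if "v \<in> Obj Q" "w \<in> Obj Q" for v w
    using mu[of v w] that by (simp add: Q_simps)
  define nat where "nat f \<longleftrightarrow> f \<in> Arr Q \<and> \<tau> (tgt Q f) \<cdot> far F f = far G f \<cdot> \<tau> (src Q f)" for f
  have nat_idt: "nat (idt Q a)" if "a \<in> Obj Q" for a
    using that by (simp add: nat_def)
  have nat_cmp: "nat (g \<cdot>\<^bsub>Q\<^esub> f)" if "nat f" "nat g" "tgt Q f = src Q g" for f g
  proof -
    have [simp]: "f \<in> Arr Q" "g \<in> Arr Q" using that by (auto simp: nat_def)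
    have "\<tau> (tgt Q g) \<cdot> far F g \<cdot> far F f = far G g \<cdot> \<tau> (src Q g) \<cdot> far F f"
      using that D.pull[of "\<tau> (tgt Q g)" "far F g" _ "far F f"] by (simp add: nat_def)
    then show ?thesis using that by (simp add: nat_def)
  qed
  have nat_tenm: "nat (f \<boxtimes>\<^bsub>Q\<^esub> g)" if "nat f" "nat g" for f g
  proof -
    have [simp]: "f \<in> Arr Q" "g \<in> Arr Q" using that by (auto simp: nat_def)
    have "(\<tau> (tgt Q f \<otimes>\<^bsub>Q\<^esub> tgt Q g) \<cdot> far F (f \<boxtimes>\<^bsub>Q\<^esub> g)) \<cdot> fmu F (src Q f) (src Q g) =
        \<tau> (tgt Q f \<otimes>\<^bsub>Q\<^esub> tgt Q g) \<cdot> fmu F (tgt Q f) (tgt Q g) \<cdot> (far F f \<boxtimes> far F g)"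
      by (simp add: F.fmu_nat)
    also have "\<dots> = fmu G (tgt Q f) (tgt Q g) \<cdot> ((far G f \<cdot> \<tau> (src Q f)) \<boxtimes> (far G g \<cdot> \<tau> (src Q g)))"
      using that by (subst D.pull[OF mu']) (auto simp: nat_def)
    also have "\<dots> = fmu G (tgt Q f) (tgt Q g) \<cdot> (far G f \<boxtimes> far G g) \<cdot> (\<tau> (src Q f) \<boxtimes> \<tau> (src Q g))"
      by simp
    also have "\<dots> = (far G (f \<boxtimes>\<^bsub>Q\<^esub> g) \<cdot> \<tau> (src Q f \<otimes>\<^bsub>Q\<^esub> src Q g)) \<cdot> fmu F (src Q f) (src Q g)"
      by (subst D.pull[OF G.fmu_nat]) (auto simp: mu')
    finally have "\<tau> (tgt Q f \<otimes>\<^bsub>Q\<^esub> tgt Q g) \<cdot> far F (f \<boxtimes>\<^bsub>Q\<^esub> g) =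
        far G (f \<boxtimes>\<^bsub>Q\<^esub> g) \<cdot> \<tau> (src Q f \<otimes>\<^bsub>Q\<^esub> src Q g)"
      by (rule D.iso_epi) auto
    then show ?thesis by (simp add: nat_def)
  qed
  \<comment> \<open>The functor laws do not mention \<open>asci\<close>, \<open>luni\<close> and
    \<open>runi\<close>; naturality there is transferred from their inverses.\<close>
  have nat_inverse: "nat g"
    if "nat f" and [simp]: "g \<in> Arr Q" "src Q g = tgt Q f" "tgt Q g = src Q f"
      and i: "g \<cdot>\<^bsub>Q\<^esub> f = idt Q (src Q f)" "f \<cdot>\<^bsub>Q\<^esub> g = idt Q (tgt Q f)" for f g
  proof -
    have [simp]: "f \<in> Arr Q" and f: "\<tau> (tgt Q f) \<cdot> far F f = far G f \<cdot> \<tau> (src Q f)"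
      using that(1) by (auto simp: nat_def)
    have 1: "far F f \<cdot> far F g = idt D (fob F (tgt Q f))"
      "far G g \<cdot> far G f = idt D (fob G (src Q f))"
      using i by (simp_all add: F.far_compose[symmetric] G.far_compose[symmetric] del: F.far_compose G.far_compose)
    have "far G g \<cdot> \<tau> (tgt Q f) = far G g \<cdot> (\<tau> (tgt Q f) \<cdot> far F f) \<cdot> far F g"
      by (simp add: 1)
    also have "\<dots> = \<tau> (src Q f) \<cdot> far F g"
      unfolding f by (simp add: D.pull[OF 1(2)])
    finally show ?thesis by (simp add: nat_def)
  qed
  have nat_asc: "nat (asc Q a b c)" if [simp]: "a \<in> Obj Q" "b \<in> Obj Q" "c \<in> Obj Q" for a b c
  proof -
    \<comment> \<open>Both sides are compared after precomposition with this isomorphism, where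
      \<open>fmu_asc\<close> rewrites the image of \<open>asc\<close>. The unitors and the swap
      follow the same pattern.\<close>
    let ?iso = "fmu F (a \<otimes>\<^bsub>Q\<^esub> b) c \<cdot> (fmu F a b \<boxtimes> idt D (fob F c))"
    have "(\<tau> (a \<otimes>\<^bsub>Q\<^esub> (b \<otimes>\<^bsub>Q\<^esub> c)) \<cdot> far F (asc Q a b c)) \<cdot> ?iso =
        \<tau> (a \<otimes>\<^bsub>Q\<^esub> (b \<otimes>\<^bsub>Q\<^esub> c)) \<cdot> fmu F a (b \<otimes>\<^bsub>Q\<^esub> c) \<cdot> (idt D (fob F a) \<boxtimes> fmu F b c) \<cdot>
          asc D (fob F a) (fob F b) (fob F c)"
      by (simp add: F.fmu_asc)
    also have "\<dots> = fmu G a (b \<otimes>\<^bsub>Q\<^esub> c) \<cdot> (\<tau> a \<boxtimes> (\<tau> (b \<otimes>\<^bsub>Q\<^esub> c) \<cdot> fmu F b c)) \<cdot>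
          asc D (fob F a) (fob F b) (fob F c)"
      by (subst D.pull[OF mu']) auto
    also have "\<dots> = fmu G a (b \<otimes>\<^bsub>Q\<^esub> c) \<cdot> (idt D (fob G a) \<boxtimes> fmu G b c) \<cdot>
          (\<tau> a \<boxtimes> (\<tau> b \<boxtimes> \<tau> c)) \<cdot> asc D (fob F a) (fob F b) (fob F c)"
      by (simp add: mu')
    also have "\<dots> = fmu G a (b \<otimes>\<^bsub>Q\<^esub> c) \<cdot> (idt D (fob G a) \<boxtimes> fmu G b c) \<cdot>
          asc D (fob G a) (fob G b) (fob G c) \<cdot> ((\<tau> a \<boxtimes> \<tau> b) \<boxtimes> \<tau> c)"
      by (subst D.asc_nat) (auto simp del: D.merge_left)
    also have "\<dots> = (fmu G a (b \<otimes>\<^bsub>Q\<^esub> c) \<cdot> (idt D (fob G a) \<boxtimes> fmu G b c) \<cdot>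
          asc D (fob G a) (fob G b) (fob G c)) \<cdot> ((\<tau> a \<boxtimes> \<tau> b) \<boxtimes> \<tau> c)"
      by (simp del: D.merge_left)
    also have "\<dots> = far G (asc Q a b c) \<cdot> fmu G (a \<otimes>\<^bsub>Q\<^esub> b) c \<cdot>
          ((fmu G a b \<cdot> (\<tau> a \<boxtimes> \<tau> b)) \<boxtimes> \<tau> c)"
      by (subst G.fmu_asc[symmetric]) auto
    also have "\<dots> = far G (asc Q a b c) \<cdot> fmu G (a \<otimes>\<^bsub>Q\<^esub> b) c \<cdot>
          (\<tau> (a \<otimes>\<^bsub>Q\<^esub> b) \<boxtimes> \<tau> c) \<cdot> (fmu F a b \<boxtimes> idt D (fob F c))"
      by (simp add: mu')
    also have "\<dots> = (far G (asc Q a b c) \<cdot> \<tau> ((a \<otimes>\<^bsub>Q\<^esub> b) \<otimes>\<^bsub>Q\<^esub> c)) \<cdot> ?iso"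
      by (subst D.pull[OF mu'[symmetric]]) auto
    finally have "\<tau> (a \<otimes>\<^bsub>Q\<^esub> (b \<otimes>\<^bsub>Q\<^esub> c)) \<cdot> far F (asc Q a b c) =
        far G (asc Q a b c) \<cdot> \<tau> ((a \<otimes>\<^bsub>Q\<^esub> b) \<otimes>\<^bsub>Q\<^esub> c)"
      by (rule D.iso_epi) auto
    then show ?thesis by (simp add: nat_def)
  qed
  have nu': "\<tau> (unt Q) \<cdot> fnu F = fnu G" using nu by (simp add: Q_simps)
  have nat_lun: "nat (lun Q a)" if [simp]: "a \<in> Obj Q" for a
  proof -
    let ?iso = "fmu F (unt Q) a \<cdot> (fnu F \<boxtimes> idt D (fob F a))"
    have "(\<tau> a \<cdot> far F (lun Q a)) \<cdot> ?iso = \<tau> a \<cdot> lun D (fob F a)"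
      by (simp add: F.fmu_lun)
    also have "\<dots> = lun D (fob G a) \<cdot> (idt D (unt D) \<boxtimes> \<tau> a)"
      by (simp add: D.lun_nat)
    also have "\<dots> = (far G (lun Q a) \<cdot> fmu G (unt Q) a \<cdot> (fnu G \<boxtimes> idt D (fob G a))) \<cdot> (idt D (unt D) \<boxtimes> \<tau> a)"
      by (simp only: G.fmu_lun that)
    also have "\<dots> = far G (lun Q a) \<cdot> fmu G (unt Q) a \<cdot> (\<tau> (unt Q) \<boxtimes> \<tau> a) \<cdot> (fnu F \<boxtimes> idt D (fob F a))"
      by (simp add: nu')
    also have "\<dots> = (far G (lun Q a) \<cdot> \<tau> (unt Q \<otimes>\<^bsub>Q\<^esub> a)) \<cdot> ?iso"
      by (subst D.pull[OF mu'[symmetric]]) auto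
    finally have "\<tau> a \<cdot> far F (lun Q a) = far G (lun Q a) \<cdot> \<tau> (unt Q \<otimes>\<^bsub>Q\<^esub> a)"
      by (rule D.iso_epi) auto
    then show ?thesis by (simp add: nat_def)
  qed
  have nat_run: "nat (run Q a)" if [simp]: "a \<in> Obj Q" for a
  proof -
    let ?iso = "fmu F a (unt Q) \<cdot> (idt D (fob F a) \<boxtimes> fnu F)"
    have "(\<tau> a \<cdot> far F (run Q a)) \<cdot> ?iso = \<tau> a \<cdot> run D (fob F a)"
      by (simp add: F.fmu_run)
    also have "\<dots> = run D (fob G a) \<cdot> (\<tau> a \<boxtimes> idt D (unt D))"
      by (simp add: D.run_nat)
    also have "\<dots> = (far G (run Q a) \<cdot> fmu G a (unt Q) \<cdot> (idt D (fob G a) \<boxtimes> fnu G)) \<cdot> (\<tau> a \<boxtimes> idt D (unt D))"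
      by (simp only: G.fmu_run that)
    also have "\<dots> = far G (run Q a) \<cdot> fmu G a (unt Q) \<cdot> (\<tau> a \<boxtimes> \<tau> (unt Q)) \<cdot> (idt D (fob F a) \<boxtimes> fnu F)"
      by (simp add: nu')
    also have "\<dots> = (far G (run Q a) \<cdot> \<tau> (a \<otimes>\<^bsub>Q\<^esub> unt Q)) \<cdot> ?iso"
      by (subst D.pull[OF mu'[symmetric]]) auto
    finally have "\<tau> a \<cdot> far F (run Q a) = far G (run Q a) \<cdot> \<tau> (a \<otimes>\<^bsub>Q\<^esub> unt Q)"
      by (rule D.iso_epi) auto
    then show ?thesis by (simp add: nat_def)
  qed
  have nat_swp: "nat (swp Q a b)" if [simp]: "a \<in> Obj Q" "b \<in> Obj Q" for a b
  proof -
    have "(\<tau> (b \<otimes>\<^bsub>Q\<^esub> a) \<cdot> far F (swp Q a b)) \<cdot> fmu F a b =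
        \<tau> (b \<otimes>\<^bsub>Q\<^esub> a) \<cdot> fmu F b a \<cdot> swp D (fob F a) (fob F b)"
      by (simp add: F.fmu_swp)
    also have "\<dots> = fmu G b a \<cdot> swp D (fob G a) (fob G b) \<cdot> (\<tau> a \<boxtimes> \<tau> b)"
      by (subst D.pull[OF mu']) (auto simp: D.swp_nat)
    also have "\<dots> = far G (swp Q a b) \<cdot> fmu G a b \<cdot> (\<tau> a \<boxtimes> \<tau> b)"
      by (subst D.pull[OF G.fmu_swp[symmetric]]) auto
    also have "\<dots> = (far G (swp Q a b) \<cdot> \<tau> (a \<otimes>\<^bsub>Q\<^esub> b)) \<cdot> fmu F a b"
      by (simp add: mu')
    finally have "\<tau> (b \<otimes>\<^bsub>Q\<^esub> a) \<cdot> far F (swp Q a b) = far G (swp Q a b) \<cdot> \<tau> (a \<otimes>\<^bsub>Q\<^esub> b)"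
      by (rule D.iso_epi) auto
    then show ?thesis by (simp add: nat_def)
  qed
  have nat_cpy: "nat (cpy Q a)" if [simp]: "a \<in> Obj Q" for a
    by (simp add: nat_def F.far_cpy G.far_cpy D.pull[OF mu'] D.det_cpy_cmp)
  have nat_dsc: "nat (dsc Q a)" if [simp]: "a \<in> Obj Q" for a
  proof -
    \<comment> \<open>\<open>fob G (unt Q)\<close> is isomorphic to the unit through
      \<open>fnu G\<close>, hence terminal.\<close>
    have u: "f = g" if [simp]: "f \<in> Arr D" "g \<in> Arr D" "src D f = src D g" "tgt D f = fob G (unt Q)"
      "tgt D g = fob G (unt Q)" for f g
    proof (rule D.iso_mono)
      show "D.inv_arr (fnu G) \<cdot> f = D.inv_arr (fnu G) \<cdot> g"
        by (rule D.to_unt_eq) auto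
    qed auto
    have "\<tau> (unt Q) \<cdot> far F (dsc Q a) = far G (dsc Q a) \<cdot> \<tau> a"
      by (rule u) auto
    then show ?thesis by (simp add: nat_def)
  qed
  have "nat (tcls S t)" if "wf_term S t" for t
    using that
  proof (induction t)
    case (TGen q)
    then show ?case using gen[of q] by (simp add: nat_def Q_def gen_arr_def)
  next
    case (TIdt a)
    then show ?case using nat_idt[of a] by (simp add: Q_def)
  next
    case (TCmp g f)
    then show ?case using nat_cmp[of "tcls S f" "tcls S g"] by (simp add: Q_def)
  next
    case (TTen f g)
    then show ?case using nat_tenm[of "tcls S f" "tcls S g"] by (simp add: Q_def)
  next
    case (TAsc a b c)
    then show ?case using nat_asc[of a b c] by (simp add: Q_def)
  next
    case (TAsci a b c)
    then have "nat (asci Q a b c)"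
      by (intro nat_inverse[OF nat_asc[of a b c]]) (simp_all add: Q_simps del: free_markov_simps)
    then show ?case by (simp add: Q_def)
  next
    case (TLun a)
    then show ?case using nat_lun[of a] by (simp add: Q_def)
  next
    case (TLuni a)
    then have "nat (luni Q a)"
      by (intro nat_inverse[OF nat_lun[of a]]) (simp_all add: Q_simps del: free_markov_simps)
    then show ?case by (simp add: Q_def)
  next
    case (TRun a)
    then show ?case using nat_run[of a] by (simp add: Q_def)
  next
    case (TRuni a)
    then have "nat (runi Q a)"
      by (intro nat_inverse[OF nat_run[of a]]) (simp_all add: Q_simps del: free_markov_simps)
    then show ?case by (simp add: Q_def)
  next
    case (TSwp a b)
    then show ?case using nat_swp[of a b] by (simp add: Q_def)
  next
    case (TCpy a)
    then show ?case using nat_cpy[of a] by (simp add: Q_def)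
  next
    case (TDsc a)
    then show ?case using nat_dsc[of a] by (simp add: Q_def)
  qed
  then have nat: "nat f" if "f \<in> Arr Q" for f
    using that by (auto simp: Q_def)
  show ?thesis
    unfolding Q_def[symmetric]
  proof unfold_locales
    show "\<tau> \<in> extensional (Obj Q)" using ext by (simp add: Q_simps)
    show "\<tau> b \<cdot> far F f = far G f \<cdot> \<tau> a" if "f \<in> hom Q a b" for f a b
      using nat[of f] that by (auto simp: nat_def hom_def)
    show "\<tau> (unt Q) \<cdot> fnu F = fnu G" by (rule nu')
  qed (auto simp: hom_def mu mu' intro: det simp: Q_simps)
qed

text \<open>From here on free categories are treated as abstract Markov categories; unfolding their
  operations would keep the rules of the locale \<open>markov\<close> from matching.\<close>

declare free_markov_simps [simp del] free_markov_src_tgt [simp del] tcls_hom [simp del]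

section \<open>Functional causal models\<close>

lemma set_lst [simp]: "set (lst M X) = X \<inter> V M"
  by (auto simp: lst_def)

lemma CF_simps [simp]:
  "types (CF M) = V M" "ins (CF M) q = concat (blocks_in M q)" "outs (CF M) q = concat (blocks_out M q)"
  "q \<in> gens (CF M) \<longleftrightarrow> (\<forall>(Y, X) \<in> set q. Y \<subseteq> V M \<and> X \<subseteq> V M)"
  by (simp_all add: CF_def)

lemma set_blocks:
  "set (concat (blocks_in M q)) \<subseteq> V M" "set (concat (blocks_out M q)) \<subseteq> V M"
  by (auto simp: blocks_in_def blocks_out_def)

lemma in_blocks:
  "S \<in> set (blocks_in M q) \<Longrightarrow> \<exists>X. S = lst M X" "S \<in> set (blocks_out M q) \<Longrightarrow> \<exists>X. S = lst M X"
  by (auto simp: blocks_in_def blocks_out_def)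

text \<open>The condition in \<open>topo_order\<close> as a recursion, with the set of available
  variables as accumulator. It matches the recursion of \<open>run_mechs\<close>, whose context
  grows in the same way.\<close>

primrec pa_closed :: "('v, 'o, 'm) fcm \<Rightarrow> 'v set \<Rightarrow> 'v list \<Rightarrow> bool" where
  "pa_closed M A [] \<longleftrightarrow> True"
| "pa_closed M A (x # xs) \<longleftrightarrow> pa M x \<subseteq> A \<and> pa_closed M (insert x A) xs"

text \<open>Under an intervention the variables in \<open>X\<close> lose their mechanisms but become
  inputs, so they are available from the start.\<close>

lemma pa_closed_filter: "pa_closed M A xs \<Longrightarrow> pa_closed M (A \<union> X) (filter (\<lambda>x. x \<notin> X) xs)"
proof (induction xs arbitrary: A)
  case (Cons x xs)
  then have "pa_closed M (insert x A \<union> X) (filter (\<lambda>x. x \<notin> X) xs)" "pa M x \<subseteq> A"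
    using Cons.IH[of "insert x A"] by simp_all
  then show ?case by (auto simp: insert_absorb)
qed simp

lemma pa_closedI:
  assumes "\<forall>i < length xs. pa M (xs ! i) \<subseteq> A \<union> set (take i xs)"
  shows "pa_closed M A xs"
  using assms
proof (induction xs arbitrary: A)
  case (Cons x xs)
  have "pa M (xs ! i) \<subseteq> insert x A \<union> set (take i xs)" if "i < length xs" for i
    using Cons.prems[rule_format, of "Suc i"] that by simp
  then show ?case using Cons.IH Cons.prems[rule_format, of 0] by simp
qed simp

text \<open>Only parents inside \<open>A\<close> are counted, so that the induction can remove a
  variable from \<open>A\<close>. The removed variable has no children in \<open>A\<close>, hence
  may come last.\<close>

lemma topo_order_exists:
  assumes "finite A" "acyclic {(y, x). x \<in> W \<and> y \<in> p x}" "finite W" "\<forall>x \<in> W. finite (p x)" "A \<subseteq> W"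
  shows "\<exists>xs. distinct xs \<and> set xs = A \<and> (\<forall>i < length xs. p (xs ! i) \<inter> A \<subseteq> set (take i xs))"
  using assms(1,5)
proof (induction "card A" arbitrary: A)
  case 0
  then show ?case by simp
next
  case (Suc n)
  let ?r = "{(y, x). x \<in> W \<and> y \<in> p x}"
  have "finite ?r"
    by (rule finite_subset[of _ "(\<Union>x \<in> W. p x) \<times> W"]) (use assms(3,4) in auto)
  then have wf: "wf (?r\<inverse>)"
    using assms(2) by (rule finite_acyclic_wf_converse)
  obtain a where "a \<in> A" using Suc.hyps(2) by fastforce
  \<comment> \<open>Minimality for the converse relation means that no child of \<open>x\<close>
    lies in \<open>A\<close>.\<close>
  with wf obtain x where x: "x \<in> A" "\<And>y. (y, x) \<in> ?r\<inverse> \<Longrightarrow> y \<notin> A"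
    by (rule wfE_min) (rule that, assumption, blast)
  have "n = card (A - {x})" using Suc.hyps(2) card_Diff_singleton[OF x(1)] by linarith
  then obtain xs where xs: "distinct xs" "set xs = A - {x}"
    "\<forall>i < length xs. p (xs ! i) \<inter> (A - {x}) \<subseteq> set (take i xs)"
    using Suc.hyps(1)[of "A - {x}"] Suc.prems by auto
  have "p ((xs @ [x]) ! i) \<inter> A \<subseteq> set (take i (xs @ [x]))" if "i < Suc (length xs)" for i
  proof (cases "i < length xs")
    case True
    then have "xs ! i \<in> A" using xs(2) nth_mem by blast
    then have "x \<notin> p (xs ! i)" using x(2)[of "xs ! i"] Suc.prems(2) by auto
    then show ?thesis using xs(3) True by (auto simp: nth_append)
  next
    case False
    then have "i = length xs" using that by simp
    moreover have "x \<notin> p x" using x(2)[of x] x(1) Suc.prems(2) by auto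
    ultimately show ?thesis using xs(2) by auto
  qed
  then show ?case
    using xs x(1) by (intro exI[of _ "xs @ [x]"]) auto
qed

locale fcm = markov C for C :: "('o, 'm) mcat" (structure) +
  fixes M :: "('v, 'o, 'm) fcm"
  assumes fcm: "functional_causal_model C M"
begin

lemma distinct_vars [simp]: "distinct (vars M)"
  using fcm by (simp add: functional_causal_model_def)

lemma distinct_lst [simp]: "distinct (lst M X)"
  by (simp add: lst_def)

lemma variable_simps [simp]:
  assumes "x \<in> V M"
  shows "pa M x \<subseteq> V M" "vob M x \<in> Obj C" "uob M x \<in> Obj C"
    "lam M x \<in> Arr C" "src C (lam M x) = unt C" "tgt C (lam M x) = uob M x"
    "mech M x \<in> Arr C" "src C (mech M x) = vtens C M (pa M x) \<otimes> uob M x"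
    "tgt C (mech M x) = vob M x"
  using fcm assms by (auto simp: functional_causal_model_def hom_def)

lemma vob_image [simp]: "A \<subseteq> V M \<Longrightarrow> vob M ` A \<subseteq> Obj C"
  by auto

lemma vtens_obj [simp]: "vtens C M X \<in> Obj C"
  unfolding vtens_def by (rule tens_obj) auto

lemma utens_obj [simp]: "utens C M \<in> Obj C"
  unfolding utens_def by (rule tens_obj) auto

text \<open>Parents lie in \<open>V M\<close>, so for \<open>A = V M\<close> intersecting with
  \<open>A\<close> in \<open>topo_order_exists\<close> changes nothing, and the choice in the
  definition is justified.\<close>

lemma topo_order:
  "set (topo_order M) = V M" "pa_closed M {} (topo_order M)"
proof -
  let ?P = "\<lambda>xs. distinct xs \<and> set xs = V M \<and> (\<forall>i < length xs. pa M (xs ! i) \<subseteq> set (take i xs))"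
  have pa: "pa M x \<subseteq> V M" if "x \<in> V M" for x using that by simp
  have "\<exists>xs. distinct xs \<and> set xs = V M \<and> (\<forall>i < length xs. pa M (xs ! i) \<inter> V M \<subseteq> set (take i xs))"
    by (rule topo_order_exists[where W = "V M"])
      (use fcm finite_subset[OF pa] in \<open>auto simp: functional_causal_model_def\<close>)
  then obtain xs where xs: "distinct xs" "set xs = V M"
    "\<forall>i < length xs. pa M (xs ! i) \<inter> V M \<subseteq> set (take i xs)" by blast
  have "pa M (xs ! i) \<subseteq> set (take i xs)" if "i < length xs" for i
    using xs(2,3) pa[of "xs ! i"] that nth_mem[OF that] by blast
  with xs have "\<exists>xs. ?P xs" by blast
  then have "?P (topo_order M)"
    unfolding topo_order_def by (rule someI_ex)
  then show "set (topo_order M) = V M" "pa_closed M {} (topo_order M)"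
    by (auto intro: pa_closedI)
qed

lemma nob_obj:
  assumes "ns \<subseteq> Endo ` V M \<union> Exo ` V M"
  shows "nob M ` ns \<subseteq> Obj C"
  using assms by auto

text \<open>Acyclicity enters through \<open>pa_closed\<close>: whenever a mechanism is reached, all
  its parents are already wires of the context.\<close>

lemma run_mechs_arr:
  assumes "set ctx \<subseteq> Endo ` V M \<union> Exo ` V M" "Exo ` V M \<subseteq> set ctx" "set xs \<subseteq> V M"
    "Endo ` A \<subseteq> set ctx" "pa_closed M A xs"
  shows "run_mechs C M ctx xs \<in> hom C (tens C (map (nob M) ctx)) (tens C (map (nob M) (rev (map Endo xs) @ ctx)))"
  using assms
proof (induction xs arbitrary: ctx A)
  case Nil
  then have "nob M ` set ctx \<subseteq> Obj C" by (intro nob_obj)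
  then show ?case by (simp add: hom_def)
next
  case (Cons x xs)
  have [simp]: "nob M ` set ctx \<subseteq> Obj C" using Cons.prems by (intro nob_obj)
  have [simp]: "x \<in> V M" "Exo x \<in> set ctx" using Cons.prems by auto
  have "pa M x \<subseteq> A" using Cons.prems(5) by simp
  then have [simp]: "Endo ` (pa M x \<inter> V M) \<subseteq> set ctx" using Cons.prems(4) by blast
  have IH: "run_mechs C M (Endo x # ctx) xs \<in> hom C (tens C (map (nob M) (Endo x # ctx)))
      (tens C (map (nob M) (rev (map Endo xs) @ Endo x # ctx)))"
    by (rule Cons.IH[of _ "insert x A"]) (use Cons.prems in auto)
  have t: "tens C (map (nob M) (map Endo (lst M (pa M x)))) = vtens C M (pa M x)"
    by (simp add: vtens_def comp_def)
  show ?case using IH t by (simp add: hom_def del: map_map)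
qed

lemma do_channel_arr [simp]:
  assumes "X \<subseteq> V M" "Y \<subseteq> V M"
  shows "do_channel C M X Y \<in> Arr C" "src C (do_channel C M X Y) = utens C M \<otimes> vtens C M X"
    "tgt C (do_channel C M X Y) = vtens C M Y"
proof -
  define ctx where "ctx = map Exo (vars M) @ map Endo (lst M X)"
  define xs where "xs = filter (\<lambda>x. x \<notin> X) (topo_order M)"
  have ctx: "set ctx = Exo ` V M \<union> Endo ` X" using assms by (auto simp: ctx_def)
  have xs: "set xs = V M - X" by (auto simp: xs_def topo_order)
  have "pa_closed M ({} \<union> X) xs"
    unfolding xs_def by (rule pa_closed_filter[OF topo_order(2)])
  then have run: "run_mechs C M ctx xs \<in> hom C (tens C (map (nob M) ctx)) (tens C (map (nob M) (rev (map Endo xs) @ ctx)))"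
    by (intro run_mechs_arr[where A = X]) (use ctx xs assms in auto)
  have ctx_ob: "map (nob M) ctx = map (uob M) (vars M) @ map (vob M) (lst M X)"
    by (simp add: ctx_def comp_def)
  have j: "join C (map (uob M) (vars M)) (map (vob M) (lst M X)) \<in>
      hom C (utens C M \<otimes> vtens C M X) (tens C (map (nob M) ctx))"
    unfolding ctx_ob by (rule homI) (use assms in \<open>auto simp: utens_def vtens_def image_subset_iff\<close>)
  have n: "nob M ` set (rev (map Endo xs) @ ctx) \<subseteq> Obj C"
    by (rule nob_obj) (use ctx xs assms in auto)
  have s: "set (map Endo (lst M Y)) \<subseteq> set (rev (map Endo xs) @ ctx)"
    using ctx xs assms by auto
  have w: "wire C (nob M) (rev (map Endo xs) @ ctx) (map Endo (lst M Y)) \<in>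
      hom C (tens C (map (nob M) (rev (map Endo xs) @ ctx))) (vtens C M Y)"
    using wire_arr[OF s n] by (simp add: hom_def vtens_def comp_def)
  have "do_channel C M X Y = wire C (nob M) (rev (map Endo xs) @ ctx) (map Endo (lst M Y)) \<cdot>
      run_mechs C M ctx xs \<cdot> join C (map (uob M) (vars M)) (map (vob M) (lst M X))"
    by (simp add: do_channel_def Let_def ctx_def xs_def)
  then have "do_channel C M X Y \<in> hom C (utens C M \<otimes> vtens C M X) (vtens C M Y)"
    using cmp_hom[OF cmp_hom[OF j run] w] by simp
  then show "do_channel C M X Y \<in> Arr C" "src C (do_channel C M X Y) = utens C M \<otimes> vtens C M X"
    "tgt C (do_channel C M X Y) = vtens C M Y" by (auto simp: hom_def)
qed

lemma cf_channel_arr [simp]: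
  assumes "\<forall>(Y, X) \<in> set q. Y \<subseteq> V M \<and> X \<subseteq> V M"
  shows "cf_channel C M q \<in> Arr C" "src C (cf_channel C M q) = tens C (map (\<lambda>(Y, X). vtens C M X) q)"
    "tgt C (cf_channel C M q) = tens C (map (\<lambda>(Y, X). vtens C M Y) q)"
proof -
  let ?U = "utens C M" and ?Xs = "map (\<lambda>(Y, X). vtens C M X) q"
  have Xs [simp]: "set ?Xs \<subseteq> Obj C" by auto
  have z: "map2 (\<lambda>a b. a \<otimes> b) (replicate (length q) ?U) ?Xs = map (\<lambda>(Y, X). ?U \<otimes> vtens C M X) q"
    by (induction q) auto
  have zip: "zipten C (replicate (length q) ?U) ?Xs \<in> Arr C"
    "src C (zipten C (replicate (length q) ?U) ?Xs) = tens C (replicate (length q) ?U) \<otimes> tens C ?Xs"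
    "tgt C (zipten C (replicate (length q) ?U) ?Xs) = tens C (map (\<lambda>(Y, X). ?U \<otimes> vtens C M X) q)"
    using zipten_arr[of "replicate (length q) ?U" ?Xs] Xs unfolding z by (auto simp: set_replicate_conv_if)
  have f: "set (map (\<lambda>(Y, X). do_channel C M X Y) q) \<subseteq> Arr C"
    using assms by fastforce
  have st: "map (src C) (map (\<lambda>(Y, X). do_channel C M X Y) q) = map (\<lambda>(Y, X). ?U \<otimes> vtens C M X) q"
    "map (tgt C) (map (\<lambda>(Y, X). do_channel C M X Y) q) = map (\<lambda>(Y, X). vtens C M Y) q"
    using assms by fastforce+
  have l: "map (tgt C) (map (lam M) (vars M)) = map (uob M) (vars M)" by simp
  have s: "states C (map (lam M) (vars M)) \<in> Arr C" "src C (states C (map (lam M) (vars M))) = unt C"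
    "tgt C (states C (map (lam M) (vars M))) = ?U"
    using states_arr[of "map (lam M) (vars M)"] unfolding l by (auto simp: utens_def)
  have x: "tens C ?Xs \<in> Obj C" by (rule tens_obj[OF Xs])
  show "cf_channel C M q \<in> Arr C" "src C (cf_channel C M q) = tens C ?Xs"
    "tgt C (cf_channel C M q) = tens C (map (\<lambda>(Y, X). vtens C M Y) q)"
    unfolding cf_channel_def Let_def using s zip x tensm_arr[OF f] unfolding st by simp_all
qed

text \<open>The value of \<open>fcm_model\<close> on a generator, named so that the locale
  \<open>free_model\<close> can be instantiated.\<close>

definition query_channel where
  "query_channel q = flat C (map (map (vob M)) (blocks_out M q)) \<cdot> cf_channel C M q \<cdot>
     unflat C (map (map (vob M)) (blocks_in M q))"

lemma blocks_obj [simp]: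
  "\<forall>as \<in> set (map (map (vob M)) (blocks_in M q)). set as \<subseteq> Obj C"
  "\<forall>as \<in> set (map (map (vob M)) (blocks_out M q)). set as \<subseteq> Obj C"
  by (auto simp: blocks_in_def blocks_out_def)

lemma tens_blocks:
  "map (tens C) (map (map (vob M)) (blocks_in M q)) = map (\<lambda>(Y, X). vtens C M X) q"
  "map (tens C) (map (map (vob M)) (blocks_out M q)) = map (\<lambda>(Y, X). vtens C M Y) q"
  by (auto simp: blocks_in_def blocks_out_def vtens_def)

sublocale model: free_model C "CF M" "vob M" query_channel
proof
  fix q assume q: "q \<in> gens (CF M)"
  show "query_channel q \<in>
      hom C (tens C (map (vob M) (ins (CF M) q))) (tens C (map (vob M) (outs (CF M) q)))"
    using q flat_arr[OF blocks_obj(1), of q] flat_arr[OF blocks_obj(2), of q]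
    unfolding tens_blocks by (simp add: hom_def query_channel_def map_concat)
qed auto

lemma fcm_model_eq: "fcm_model C M = model_of (CF M) C (vob M) query_channel"
  by (simp add: fcm_model_def query_channel_def[abs_def])

lemma strict_fcm_model: "strict_markov_functor (free_markov (CF M)) C (fcm_model C M)"
  unfolding fcm_model_eq by (rule model.strict_model_of)

lemma fcm_model_gen_arr:
  "q \<in> gens (CF M) \<Longrightarrow> far (fcm_model C M) (gen_arr (CF M) q) = query_channel q"
  unfolding fcm_model_eq using set_blocks[of M q] by (intro model.model_of_gen_arr) simp_all

lemma fob_fcm_model: "w \<in> words (CF M) \<Longrightarrow> fob (fcm_model C M) w = weval C (vob M) w"
  by (simp add: fcm_model_def model_of_def)

lemma gen_arr_CF_hom:
  "q \<in> gens (CF M) \<Longrightarrow> gen_arr (CF M) q \<in>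
    hom (free_markov (CF M)) (wlist (concat (blocks_in M q))) (wlist (concat (blocks_out M q)))"
  using gen_arr_hom[of q "CF M"] set_blocks[of M q] by simp

end

section \<open>Transport between functors on a free category\<close>

lemma free_obj_simps [simp]:
  "WUnit \<in> Obj (free_markov S)" "WVar x \<in> Obj (free_markov S) \<longleftrightarrow> x \<in> types S"
  "WTen a b \<in> Obj (free_markov S) \<longleftrightarrow> a \<in> Obj (free_markov S) \<and> b \<in> Obj (free_markov S)"
  "wlist xs \<in> Obj (free_markov S) \<longleftrightarrow> set xs \<subseteq> types S"
  "tens (free_markov S) (map WVar xs) = wlist xs"
  by (simp_all add: free_markov_simps(1) tens_WVar)

lemma free_ten_unt: "a \<otimes>\<^bsub>free_markov S\<^esub> b = WTen a b" "unt (free_markov S) = WUnit"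
  by (simp_all add: free_markov_simps)

text \<open>Both \<open>F w\<close> and \<open>G w\<close> are canonically isomorphic to the tensor
  of the images of the letters of \<open>w\<close>. Passing through it gives the only candidate for
  a monoidal comparison that is the identity on variables.\<close>

primrec transport :: "('p, 'n) mcat \<Rightarrow> ('t word, 'k, 'p, 'n) mfun \<Rightarrow> ('t word, 'k, 'p, 'n) mfun \<Rightarrow>
    't word \<Rightarrow> 'n" where
  "transport D F G WUnit = fnu G \<cdot>\<^bsub>D\<^esub> markov.inv_arr D (fnu F)"
| "transport D F G (WVar x) = idt D (fob F (WVar x))"
| "transport D F G (WTen v w) =
     fmu G v w \<cdot>\<^bsub>D\<^esub> (transport D F G v \<boxtimes>\<^bsub>D\<^esub> transport D F G w) \<cdot>\<^bsub>D\<^esub> markov.inv_arr D (fmu F v w)"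

locale free_functor_pair =
  F: markov_functor_between "free_markov S" D F + G: markov_functor_between "free_markov S" D G
  for S :: "('t, 'g) qsig" and D :: "('p, 'n) mcat" (structure) and F G +
  assumes agree: "x \<in> types S \<Longrightarrow> fob F (WVar x) = fob G (WVar x)"
begin

lemma structure_arr [simp]:
  assumes "v \<in> Obj (free_markov S)" "w \<in> Obj (free_markov S)"
  shows "src D (fmu F v w) = fob F v \<otimes> fob F w" "tgt D (fmu F v w) = fob F (WTen v w)"
    "src D (fmu G v w) = fob G v \<otimes> fob G w" "tgt D (fmu G v w) = fob G (WTen v w)"
  using F.fmu_arr[OF assms] G.fmu_arr[OF assms] by (simp_all add: free_ten_unt)

lemma structure_unt [simp]: "tgt D (fnu F) = fob F WUnit" "tgt D (fnu G) = fob G WUnit"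
  using F.fnu_arr G.fnu_arr by (simp_all add: free_ten_unt)

lemma transport_arr [simp]:
  assumes "w \<in> Obj (free_markov S)"
  shows "transport D F G w \<in> Arr D" "src D (transport D F G w) = fob F w" "tgt D (transport D F G w) = fob G w"
    "F.tgt.iso (transport D F G w)" "F.tgt.det (transport D F G w)"
proof -
  have "src D (transport D F G w) = fob F w \<and> tgt D (transport D F G w) = fob G w \<and>
    F.tgt.iso (transport D F G w) \<and> F.tgt.det (transport D F G w)"
    using assms by (induction w) (simp_all add: agree free_ten_unt)
  then show "transport D F G w \<in> Arr D" "src D (transport D F G w) = fob F w" "tgt D (transport D F G w) = fob G w"
    "F.tgt.iso (transport D F G w)" "F.tgt.det (transport D F G w)"
    by auto
qed

lemma transport_fmu:
  assumes "v \<in> Obj (free_markov S)" "w \<in> Obj (free_markov S)"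
  shows "transport D F G (WTen v w) \<cdot> fmu F v w =
    fmu G v w \<cdot> (transport D F G v \<boxtimes> transport D F G w)"
  using assms by simp

lemma transport_fnu: "transport D F G WUnit \<cdot> fnu F = fnu G"
  by simp

lemma fcoh_wlist [simp]:
  assumes "set xs \<subseteq> types S"
  shows "fcoh (free_markov S) D F (map WVar xs) \<in> Arr D"
    "src D (fcoh (free_markov S) D F (map WVar xs)) = tens D (map (\<lambda>x. fob F (WVar x)) xs)"
    "tgt D (fcoh (free_markov S) D F (map WVar xs)) = fob F (wlist xs)"
proof -
  have "set (map WVar xs) \<subseteq> Obj (free_markov S)" using assms by auto
  from F.fcoh_arr[OF this] show "fcoh (free_markov S) D F (map WVar xs) \<in> Arr D"
    "src D (fcoh (free_markov S) D F (map WVar xs)) = tens D (map (\<lambda>x. fob F (WVar x)) xs)"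
    "tgt D (fcoh (free_markov S) D F (map WVar xs)) = fob F (wlist xs)"
    by (simp_all add: comp_def)
qed

text \<open>Naturality at a generator is checked after composing with \<open>fcoh\<close>, where the
  query condition is available; this rule exchanges the coherence map of \<open>F\<close> for that
  of \<open>G\<close>.\<close>

lemma transport_fcoh:
  assumes "set xs \<subseteq> types S"
  shows "transport D F G (wlist xs) \<cdot> fcoh (free_markov S) D F (map WVar xs) =
    fcoh (free_markov S) D G (map WVar xs)"
  using assms
proof (induction xs)
  case Nil
  then show ?case using transport_fnu by simp
next
  case (Cons x xs)
  then have [simp]: "x \<in> types S" "set xs \<subseteq> types S" by auto
  show ?case
    using Cons.IH
    by (simp add: F.tgt.pull[OF transport_fmu] agree del: transport.simps(3)) (simp add: agree)
qed

lemma transport_natural: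
  assumes "\<And>q. q \<in> gens S \<Longrightarrow> set (ins S q) \<subseteq> types S \<Longrightarrow> set (outs S q) \<subseteq> types S \<Longrightarrow>
    transport D F G (wlist (outs S q)) \<cdot> far F (gen_arr S q) =
    far G (gen_arr S q) \<cdot> transport D F G (wlist (ins S q))"
  shows "markov_nat (free_markov S) D F G (restrict (transport D F G) (words S))"
proof (rule markov_nat_freeI)
  have obj: "w \<in> words S \<Longrightarrow> w \<in> Obj (free_markov S)" for w by (simp add: free_markov_simps)
  show "restrict (transport D F G) (words S) (WTen v w) \<cdot> fmu F v w =
      fmu G v w \<cdot> (restrict (transport D F G) (words S) v \<boxtimes> restrict (transport D F G) (words S) w)"
    if "v \<in> words S" "w \<in> words S" for v w
    using transport_fmu[OF obj obj, OF that] that by simp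
  show "restrict (transport D F G) (words S) w \<in> hom D (fob F w) (fob G w)" if "w \<in> words S" for w
    using transport_arr[OF obj[OF that]] that by (simp add: hom_def)
  show "deterministic D (restrict (transport D F G) (words S) w)" if "w \<in> words S" for w
    using transport_arr(5)[OF obj[OF that]] that unfolding F.tgt.det_def by simp
qed (use assms transport_fnu F.markov_functor_axioms G.markov_functor_axioms F.tgt.markov_axioms in simp_all)

end

section \<open>Abstractions\<close>

lemma distinct_concat_lst:
  assumes "distinct xs" "distinct (vars L)" "\<forall>x \<in> set xs. \<forall>y \<in> set xs. x \<noteq> y \<longrightarrow> P x \<inter> P y = {}"
  shows "distinct (concat (map (\<lambda>x. lst L (P x)) xs))"
  using assms
proof (induction xs)
  case (Cons x xs)
  have "set (lst L (P x)) \<inter> set (concat (map (\<lambda>x. lst L (P x)) xs)) = {}"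
    using Cons.prems(1,3) by fastforce
  with Cons show ?case by (simp add: lst_def)
qed simp

locale fcm_pair = L: fcm C L + H: fcm C H
  for C :: "('o, 'm) mcat" (structure) and L :: "('v, 'o, 'm) fcm" and H :: "('w, 'o, 'm) fcm"
begin

abbreviation QL where "QL \<equiv> free_markov (CF L)"
abbreviation QH where "QH \<equiv> free_markov (CF H)"

sublocale lm: strict_markov_functor QL C "fcm_model C L"
  by (rule L.strict_fcm_model)

sublocale hm: strict_markov_functor QH C "fcm_model C H"
  by (rule H.strict_fcm_model)

lemma fob_model_wlist [simp]:
  "set xs \<subseteq> V L \<Longrightarrow> fob (fcm_model C L) (wlist xs) = tens C (map (vob L) xs)"
  "set ys \<subseteq> V H \<Longrightarrow> fob (fcm_model C H) (wlist ys) = tens C (map (vob H) ys)"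
  by (simp_all add: L.fob_fcm_model H.fob_fcm_model weval_wlist)

lemma fob_model_WVar [simp]:
  "x \<in> V L \<Longrightarrow> fob (fcm_model C L) (WVar x) = vob L x"
  "y \<in> V H \<Longrightarrow> fob (fcm_model C H) (WVar y) = vob H y"
  by (simp_all add: L.fob_fcm_model H.fob_fcm_model)

section \<open>Isomorphisms regrouping the wires of a query\<close>

definition low where "low P S = lst L (img P (set S))"

definition block_iso where
  "block_iso P S = regroup QL WVar (low P S) (map (\<lambda>x. lst L (P x)) S)"

text \<open>The part of \<open>img_iso\<close> that is determined by \<open>P\<close>: the functor
  is replaced by its values on variables, and \<open>fcoh\<close> is split off.\<close>

definition query_iso where
  "query_iso P Ss = flat QL (map (map (\<lambda>x. wlist (lst L (P x)))) Ss) \<cdot>\<^bsub>QL\<^esub>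
     tensm QL (map (block_iso P) Ss) \<cdot>\<^bsub>QL\<^esub> unflat QL (map (\<lambda>S. map WVar (low P S)) Ss)"

text \<open>Common ground of both notions: demanded in \<open>cf_abstractions\<close>, and for
  subsets of \<open>V L\<close> equivalent to the distinctness of the lists in
  \<open>preserves_cf_queries\<close>.\<close>

definition disjoint_images where
  "disjoint_images P \<longleftrightarrow> (\<forall>x \<in> V H. P x \<subseteq> V L) \<and> (\<forall>x \<in> V H. \<forall>y \<in> V H. x \<noteq> y \<longrightarrow> P x \<inter> P y = {})"

definition var_block where "var_block S \<longleftrightarrow> distinct S \<and> set S \<subseteq> V H"

lemma var_block_lst [simp]: "var_block (lst H X)"
  by (simp add: var_block_def)

lemma var_blocks [simp]: "\<forall>S \<in> set (blocks_in H q). var_block S" "\<forall>S \<in> set (blocks_out H q). var_block S"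
  by (auto dest!: in_blocks)

lemma set_low [simp]: "set (low P S) \<subseteq> V L"
  by (simp add: low_def)

text \<open>Disjointness makes the concatenated blocks duplicate-free, which is what invertibility
  of \<open>regroup\<close> requires.\<close>

lemma block_iso_arr [simp]:
  assumes "disjoint_images P" "var_block S"
  shows "block_iso P S \<in> Arr QL" "src QL (block_iso P S) = wlist (low P S)"
    "tgt QL (block_iso P S) = tens QL (map (\<lambda>x. wlist (lst L (P x))) S)"
    "lm.src.iso (block_iso P S)" "lm.src.det (block_iso P S)"
proof -
  have sub: "\<forall>ys \<in> set (map (\<lambda>x. lst L (P x)) S). set ys \<subseteq> set (low P S)"
    by (auto simp: low_def img_def)
  have obj: "WVar ` set (low P S) \<subseteq> Obj QL" by (auto simp: low_def)
  have d: "distinct (concat (map (\<lambda>x. lst L (P x)) S))"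
  proof (rule distinct_concat_lst)
    show "\<forall>x \<in> set S. \<forall>y \<in> set S. x \<noteq> y \<longrightarrow> P x \<inter> P y = {}"
      using assms unfolding var_block_def disjoint_images_def by (meson subsetD)
  qed (use assms in \<open>simp_all add: var_block_def\<close>)
  have e: "set (low P S) = set (concat (map (\<lambda>x. lst L (P x)) S))"
    by (auto simp: low_def img_def)
  have d': "distinct (low P S)" by (simp add: low_def)
  show "block_iso P S \<in> Arr QL" "src QL (block_iso P S) = wlist (low P S)"
    "tgt QL (block_iso P S) = tens QL (map (\<lambda>x. wlist (lst L (P x))) S)"
    unfolding block_iso_def using lm.src.regroup_arr[OF sub obj] by (simp_all add: comp_def)
  show "lm.src.iso (block_iso P S)" "lm.src.det (block_iso P S)"
    unfolding block_iso_def using lm.src.iso_regroup[OF d' d e obj] lm.src.det_regroup[OF sub obj] by simp_all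
qed

lemma query_iso_arr [simp]:
  assumes "disjoint_images P" "\<forall>S \<in> set Ss. var_block S"
  shows "query_iso P Ss \<in> Arr QL" "src QL (query_iso P Ss) = wlist (concat (map (low P) Ss))"
    "tgt QL (query_iso P Ss) = tens QL (map (\<lambda>x. wlist (lst L (P x))) (concat Ss))"
    "lm.src.iso (query_iso P Ss)" "lm.src.det (query_iso P Ss)"
proof -
  have f: "\<forall>as \<in> set (map (map (\<lambda>x. wlist (lst L (P x)))) Ss). set as \<subseteq> Obj QL" by auto
  have u: "\<forall>as \<in> set (map (\<lambda>S. map WVar (low P S)) Ss). set as \<subseteq> Obj QL"
    by (auto simp: low_def)
  have b: "set (map (block_iso P) Ss) \<subseteq> Arr QL"
    "\<forall>f \<in> set (map (block_iso P) Ss). lm.src.iso f" "\<forall>f \<in> set (map (block_iso P) Ss). lm.src.det f"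
    using assms by auto
  have st: "map (src QL) (map (block_iso P) Ss) = map (tens QL) (map (\<lambda>S. map WVar (low P S)) Ss)"
    "map (tgt QL) (map (block_iso P) Ss) = map (tens QL) (map (map (\<lambda>x. wlist (lst L (P x)))) Ss)"
    using assms by auto
  have c: "concat (map (\<lambda>S. map WVar (low P S)) Ss) = map WVar (concat (map (low P) Ss))"
    "concat (map (map (\<lambda>x. wlist (lst L (P x)))) Ss) = map (\<lambda>x. wlist (lst L (P x))) (concat Ss)"
    by (simp_all add: map_concat comp_def)
  note ts = lm.src.tensm_arr[OF b(1), unfolded st]
  show "query_iso P Ss \<in> Arr QL" "src QL (query_iso P Ss) = wlist (concat (map (low P) Ss))"
    "tgt QL (query_iso P Ss) = tens QL (map (\<lambda>x. wlist (lst L (P x))) (concat Ss))"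
    "lm.src.iso (query_iso P Ss)" "lm.src.det (query_iso P Ss)"
    unfolding query_iso_def
    using ts lm.src.flat_arr[OF f, unfolded c] lm.src.flat_arr[OF u, unfolded c]
      lm.src.iso_tensm[OF b(2)] lm.src.det_tensm[OF b(3)] lm.src.iso_flat(1)[OF f] lm.src.iso_flat(2)[OF u]
      lm.src.det_flat(1)[OF f] lm.src.det_flat(2)[OF u]
    by (simp_all del: map_map)
qed

end

section \<open>The abstraction equation as an equation about generators\<close>

context fcm_pair
begin

text \<open>The model is strict and so carries a wiring of types to the same wiring of
  objects.\<close>

lemma far_query_iso:
  assumes "disjoint_images P" "\<forall>S \<in> set Ss. var_block S"
  shows "far (fcm_model C L) (query_iso P Ss) =
    flat C (map (map (\<lambda>x. vtens C L (P x))) Ss) \<cdot>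
    tensm C (map (\<lambda>S. regroup C (vob L) (low P S) (map (\<lambda>x. lst L (P x)) S)) Ss) \<cdot>
    unflat C (map (\<lambda>S. map (vob L) (low P S)) Ss)"
proof -
  have f: "\<forall>as \<in> set (map (map (\<lambda>x. wlist (lst L (P x)))) Ss). set as \<subseteq> Obj QL" by auto
  have u: "\<forall>as \<in> set (map (\<lambda>S. map WVar (low P S)) Ss). set as \<subseteq> Obj QL"
    by (auto simp: low_def)
  have b: "set (map (block_iso P) Ss) \<subseteq> Arr QL"
    using assms by auto
  have st: "map (src QL) (map (block_iso P) Ss) = map (tens QL) (map (\<lambda>S. map WVar (low P S)) Ss)"
    "map (tgt QL) (map (block_iso P) Ss) = map (tens QL) (map (map (\<lambda>x. wlist (lst L (P x)))) Ss)"
    using assms by auto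
  note ts = lm.src.tensm_arr[OF b, unfolded st]
  have 1: "map (map (fob (fcm_model C L))) (map (map (\<lambda>x. wlist (lst L (P x)))) Ss) =
      map (map (\<lambda>x. vtens C L (P x))) Ss"
    by (simp add: vtens_def)
  have 2: "map (map (fob (fcm_model C L))) (map (\<lambda>S. map WVar (low P S)) Ss) =
      map (\<lambda>S. map (vob L) (low P S)) Ss"
    by (auto simp: low_def)
  have 3: "far (fcm_model C L) (block_iso P S) =
      regroup C (vob L) (low P S) (map (\<lambda>x. lst L (P x)) S)" for S
  proof -
    have "far (fcm_model C L) (block_iso P S) =
        regroup C (\<lambda>x. fob (fcm_model C L) (WVar x)) (low P S) (map (\<lambda>x. lst L (P x)) S)"
      unfolding block_iso_def by (rule lm.far_regroup) (auto simp: low_def img_def)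
    also have "\<dots> = regroup C (vob L) (low P S) (map (\<lambda>x. lst L (P x)) S)"
      by (rule regroup_cong) (auto simp: low_def img_def)
    finally show ?thesis .
  qed
  then have 4: "map (far (fcm_model C L)) (map (block_iso P) Ss) =
      map (\<lambda>S. regroup C (vob L) (low P S) (map (\<lambda>x. lst L (P x)) S)) Ss"
    by simp
  show ?thesis
    unfolding query_iso_def
    using ts lm.src.flat_arr[OF f] lm.src.flat_arr[OF u] lm.far_flat[OF f] lm.far_flat[OF u] lm.far_tensm[OF b]
    unfolding 1 2 4 by (simp del: map_map)
qed

lemma blocks_img_query:
  assumes "q \<in> gens (CF H)"
  shows "blocks_in L (img_query P q) = map (low P) (blocks_in H q)"
    "blocks_out L (img_query P q) = map (low P) (blocks_out H q)"
proof -
  have "lst L (img P X) = low P (lst H X)" if "X \<subseteq> V H" for X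
    using that by (simp add: low_def Int_absorb2)
  then show "blocks_in L (img_query P q) = map (low P) (blocks_in H q)"
    "blocks_out L (img_query P q) = map (low P) (blocks_out H q)"
    using assms by (auto simp: blocks_in_def blocks_out_def img_query_def)
qed

lemma img_query_gens [simp]:
  assumes "disjoint_images P" "q \<in> gens (CF H)"
  shows "img_query P q \<in> gens (CF L)"
  using assms by (fastforce simp: img_query_def img_def disjoint_images_def)

lemma tau_set_lst: "tau_set C L H P t X = tensm C (map t (lst H X)) \<cdot>
    regroup C (vob L) (low P (lst H X)) (map (\<lambda>x. lst L (P x)) (lst H X))" if "X \<subseteq> V H"
proof -
  have "X \<inter> V H = X" using that by auto
  then show ?thesis by (simp add: tau_set_def low_def)
qed

text \<open>
  The queries of the signature carry flat lists of wires, the channels of the models blocks; naturality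
  of \<open>flat\<close> converts one into the other.
\<close>

lemma tensm_query_iso:
  assumes "disjoint_images P" and Ss: "\<forall>S \<in> set Ss. var_block S"
    and t: "\<forall>x \<in> V H. t x \<in> hom C (vtens C L (P x)) (vob H x)"
  shows "tensm C (map t (concat Ss)) \<cdot> far (fcm_model C L) (query_iso P Ss) \<cdot>
      flat C (map (\<lambda>S. map (vob L) (low P S)) Ss) =
    flat C (map (map (vob H)) Ss) \<cdot>
      tensm C (map (\<lambda>S. tensm C (map t S) \<cdot> regroup C (vob L) (low P S) (map (\<lambda>x. lst L (P x)) S)) Ss)"
proof -
  let ?r = "\<lambda>S. regroup C (vob L) (low P S) (map (\<lambda>x. lst L (P x)) S)"
  have r: "?r S \<in> Arr C" "src C (?r S) = tens C (map (vob L) (low P S))"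
    "tgt C (?r S) = tens C (map (\<lambda>x. vtens C L (P x)) S)" for S
  proof -
    have "\<forall>ys \<in> set (map (\<lambda>x. lst L (P x)) S). set ys \<subseteq> set (low P S)" "vob L ` set (low P S) \<subseteq> Obj C"
      by (auto simp: low_def img_def)
    from L.regroup_arr[OF this] show "?r S \<in> Arr C" "src C (?r S) = tens C (map (vob L) (low P S))"
      "tgt C (?r S) = tens C (map (\<lambda>x. vtens C L (P x)) S)" by (simp_all add: vtens_def comp_def)
  qed
  have V: "set S \<subseteq> V H" if "S \<in> set Ss" for S
    using Ss that by (auto simp: var_block_def)
  have t': "t x \<in> Arr C" "src C (t x) = vtens C L (P x)" "tgt C (t x) = vob H x" if "x \<in> V H" for x
    using t that by (auto simp: hom_def)
  have tS: "set (map t S) \<subseteq> Arr C" "map (src C) (map t S) = map (\<lambda>x. vtens C L (P x)) S"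
    "map (tgt C) (map t S) = map (vob H) S" if "set S \<subseteq> V H" for S
    using t' that by (auto simp: subset_iff)
  have f: "\<forall>as \<in> set (map (map (\<lambda>x. vtens C L (P x))) Ss). set as \<subseteq> Obj C"
    "\<forall>as \<in> set (map (\<lambda>S. map (vob L) (low P S)) Ss). set as \<subseteq> Obj C"
    "\<forall>as \<in> set (map (map (vob H)) Ss). set as \<subseteq> Obj C"
    using V by (auto simp: low_def)
  have R: "set (map ?r Ss) \<subseteq> Arr C" "map (src C) (map ?r Ss) = map (tens C) (map (\<lambda>S. map (vob L) (low P S)) Ss)"
    "map (tgt C) (map ?r Ss) = map (tens C) (map (map (\<lambda>x. vtens C L (P x))) Ss)"
    using r by auto
  have T0: "tensm C (map t S) \<in> Arr C" "src C (tensm C (map t S)) = tens C (map (\<lambda>x. vtens C L (P x)) S)"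
    "tgt C (tensm C (map t S)) = tens C (map (vob H) S)" if "S \<in> set Ss" for S
    using L.tensm_arr[OF tS(1)[OF V[OF that]]] unfolding tS(2,3)[OF V[OF that]] by simp_all
  have TT: "set (map (tensm C) (map (map t) Ss)) \<subseteq> Arr C"
    "map (src C) (map (tensm C) (map (map t) Ss)) = map (tens C) (map (map (\<lambda>x. vtens C L (P x))) Ss)"
    "map (tgt C) (map (tensm C) (map (map t) Ss)) = map (tens C) (map (map (vob H)) Ss)"
    using T0 by auto
  have c: "concat (map (map (\<lambda>x. vtens C L (P x))) Ss) = map (\<lambda>x. vtens C L (P x)) (concat Ss)"
    by (simp add: map_concat)
  have m: "map (map (tgt C)) (map (map t) Ss) = map (map (vob H)) Ss"
    "map (map (src C)) (map (map t) Ss) = map (map (\<lambda>x. vtens C L (P x))) Ss"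
    using V t' by (auto simp: subset_iff)
  have cs: "set (concat Ss) \<subseteq> V H" using V by auto
  have nat: "tensm C (map t (concat Ss)) \<cdot> flat C (map (map (\<lambda>x. vtens C L (P x))) Ss) =
      flat C (map (map (vob H)) Ss) \<cdot> tensm C (map (tensm C) (map (map t) Ss))"
  proof -
    have "\<forall>fs \<in> set (map (map t) Ss). set fs \<subseteq> Arr C" using V tS(1) by auto
    from L.flat_nat[OF this] show ?thesis unfolding m by (simp add: map_concat)
  qed
  note typing = L.tensm_arr[OF R(1), unfolded R] L.tensm_arr[OF TT(1), unfolded TT]
    L.flat_arr[OF f(1), unfolded c] L.flat_arr[OF f(2)] L.flat_arr[OF f(3)]
    L.tensm_arr[OF tS(1)[OF cs], unfolded tS(2,3)[OF cs]]
  have "tensm C (map t (concat Ss)) \<cdot> far (fcm_model C L) (query_iso P Ss) \<cdot>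
        flat C (map (\<lambda>S. map (vob L) (low P S)) Ss) =
      tensm C (map t (concat Ss)) \<cdot> flat C (map (map (\<lambda>x. vtens C L (P x))) Ss) \<cdot> tensm C (map ?r Ss)"
    unfolding far_query_iso[OF assms(1,2)] using typing L.flat_inverse(2)[OF f(2)] by (simp del: map_map)
  also have "\<dots> = flat C (map (map (vob H)) Ss) \<cdot> tensm C (map (tensm C) (map (map t) Ss)) \<cdot> tensm C (map ?r Ss)"
    using typing by (subst L.pull[OF nat]) (simp_all del: map_map)
  also have "tensm C (map (tensm C) (map (map t) Ss)) \<cdot> tensm C (map ?r Ss) =
      tensm C (map (\<lambda>S. tensm C (map t S) \<cdot> ?r S) Ss)"
    unfolding map_map comp_def
    by (rule L.tensm_map_cmp) (use r T0 in auto)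
  finally show ?thesis .
qed

text \<open>The second equation is what naturality at the generator of \<open>q\<close> amounts to.
  Precomposed with \<open>flat\<close> of the lower input blocks it becomes, by
  \<open>tensm_query_iso\<close> at outputs and inputs, the first equation followed by
  \<open>flat\<close> of the upper output blocks; both maps are isomorphisms and cancel.\<close>

lemma abstraction_equation:
  assumes "disjoint_images P" and q: "q \<in> gens (CF H)"
    and t: "\<forall>x \<in> V H. t x \<in> hom C (vtens C L (P x)) (vob H x)"
  shows "tensm C (map (\<lambda>(Y, X). tau_set C L H P t Y) q) \<cdot> cf_channel C L (img_query P q) =
      cf_channel C H q \<cdot> tensm C (map (\<lambda>(Y, X). tau_set C L H P t X) q) \<longleftrightarrow>
    tensm C (map t (concat (blocks_out H q))) \<cdot> far (fcm_model C L) (query_iso P (blocks_out H q)) \<cdot>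
        L.query_channel (img_query P q) =
      H.query_channel q \<cdot> tensm C (map t (concat (blocks_in H q))) \<cdot>
        far (fcm_model C L) (query_iso P (blocks_in H q))"
    (is "?To \<cdot> ?cL = ?cH \<cdot> ?Ti \<longleftrightarrow> ?to \<cdot> ?io \<cdot> ?qL = ?qH \<cdot> ?ti \<cdot> ?ii")
proof -
  let ?q' = "img_query P q"
  let ?fo = "flat C (map (map (vob H)) (blocks_out H q))" and ?fi = "flat C (map (map (vob H)) (blocks_in H q))"
  let ?ui = "unflat C (map (map (vob H)) (blocks_in H q))"
  let ?lo = "flat C (map (map (vob L)) (blocks_out L ?q'))" and ?li = "flat C (map (map (vob L)) (blocks_in L ?q'))"
  let ?lu = "unflat C (map (map (vob L)) (blocks_in L ?q'))"
  have q': "?q' \<in> gens (CF L)" using assms(1) q by (rule img_query_gens)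
  have Bo: "map (\<lambda>S. map (vob L) (low P S)) (blocks_out H q) = map (map (vob L)) (blocks_out L ?q')"
    and Bi: "map (\<lambda>S. map (vob L) (low P S)) (blocks_in H q) = map (map (vob L)) (blocks_in L ?q')"
    using q by (simp_all add: blocks_img_query)
  let ?s = "\<lambda>S. tensm C (map t S) \<cdot> regroup C (vob L) (low P S) (map (\<lambda>x. lst L (P x)) S)"
  have qD: "Y \<subseteq> V H" "X \<subseteq> V H" if "(Y, X) \<in> set q" for Y X
    using q that by auto
  have To: "?To = tensm C (map ?s (blocks_out H q))" and Ti: "?Ti = tensm C (map ?s (blocks_in H q))"
    using qD by (auto simp: blocks_out_def blocks_in_def tau_set_lst intro!: arg_cong[where f = "tensm C"])
  have ko: "?to \<cdot> ?io \<cdot> ?lo = ?fo \<cdot> ?To"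
    using tensm_query_iso[OF assms(1) var_blocks(2)[of q] t] unfolding Bo To .
  have ki: "?ti \<cdot> ?ii \<cdot> ?li = ?fi \<cdot> ?Ti"
    using tensm_query_iso[OF assms(1) var_blocks(1)[of q] t] unfolding Bi Ti .
  have t': "t x \<in> Arr C" "src C (t x) = vtens C L (P x)" "tgt C (t x) = vob H x" if "x \<in> V H" for x
    using t that by (auto simp: hom_def)
  have tS: "set (map t xs) \<subseteq> Arr C" "map (src C) (map t xs) = map (\<lambda>x. vtens C L (P x)) xs"
    "map (tgt C) (map t xs) = map (vob H) xs" if "set xs \<subseteq> V H" for xs
    using t' that by (auto simp: subset_iff)
  have tt: "tensm C (map t xs) \<in> Arr C" "src C (tensm C (map t xs)) = tens C (map (\<lambda>x. vtens C L (P x)) xs)"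
    "tgt C (tensm C (map t xs)) = tens C (map (vob H) xs)" if "set xs \<subseteq> V H" for xs
    using L.tensm_arr[OF tS(1)[OF that]] unfolding tS(2,3)[OF that] by simp_all
  have ts: "tau_set C L H P t X \<in> Arr C" "src C (tau_set C L H P t X) = vtens C L (img P X)"
    "tgt C (tau_set C L H P t X) = vtens C H X" if "X \<subseteq> V H" for X
  proof -
    have X: "X \<inter> V H = X" using that by auto
    have "\<forall>ys \<in> set (map (\<lambda>x. lst L (P x)) (lst H X)). set ys \<subseteq> set (lst L (img P X))"
      "vob L ` set (lst L (img P X)) \<subseteq> Obj C"
      by (auto simp: img_def)
    note r = L.regroup_arr[OF this]
    show "tau_set C L H P t X \<in> Arr C" "src C (tau_set C L H P t X) = vtens C L (img P X)"
      "tgt C (tau_set C L H P t X) = vtens C H X"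
      unfolding tau_set_def using r tt[of "lst H X"] that by (simp_all add: vtens_def comp_def)
  qed
  have sub: "set (map (\<lambda>(Y, X). tau_set C L H P t Y) q) \<subseteq> Arr C"
    "set (map (\<lambda>(Y, X). tau_set C L H P t X) q) \<subseteq> Arr C"
    using qD ts by auto
  have st: "map (src C) (map (\<lambda>(Y, X). tau_set C L H P t Y) q) = map (\<lambda>(Y, X). vtens C L Y) ?q'"
    "map (tgt C) (map (\<lambda>(Y, X). tau_set C L H P t Y) q) = map (\<lambda>(Y, X). vtens C H Y) q"
    "map (src C) (map (\<lambda>(Y, X). tau_set C L H P t X) q) = map (\<lambda>(Y, X). vtens C L X) ?q'"
    "map (tgt C) (map (\<lambda>(Y, X). tau_set C L H P t X) q) = map (\<lambda>(Y, X). vtens C H X) q"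
    using qD ts by (auto simp: img_query_def)
  note T = L.tensm_arr[OF sub(1), unfolded st] L.tensm_arr[OF sub(2), unfolded st]
  note cL = L.cf_channel_arr[of ?q'] and cH = H.cf_channel_arr[of q]
  have c: "concat (map (map (vob M)) (blocks_in M r)) = map (vob M) (concat (blocks_in M r))"
    "concat (map (map (vob M)) (blocks_out M r)) = map (vob M) (concat (blocks_out M r))" for M :: "('x, 'o, 'm) fcm" and r
    by (simp_all add: map_concat)
  note fl = L.flat_arr[OF H.blocks_obj(1)[of q], unfolded H.tens_blocks c]
    L.flat_arr[OF H.blocks_obj(2)[of q], unfolded H.tens_blocks c]
    L.flat_arr[OF L.blocks_obj(1)[of ?q'], unfolded L.tens_blocks c]
    L.flat_arr[OF L.blocks_obj(2)[of ?q'], unfolded L.tens_blocks c]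
  note inv = L.flat_inverse[OF H.blocks_obj(1)[of q], unfolded H.tens_blocks c]
    L.flat_inverse[OF L.blocks_obj(1)[of ?q'], unfolded L.tens_blocks c]
  have io: "?io \<in> Arr C" "src C ?io = tens C (map (vob L) (concat (blocks_out L ?q')))"
    "tgt C ?io = tens C (map (\<lambda>x. vtens C L (P x)) (concat (blocks_out H q)))"
    and ii: "?ii \<in> Arr C" "src C ?ii = tens C (map (vob L) (concat (blocks_in L ?q')))"
    "tgt C ?ii = tens C (map (\<lambda>x. vtens C L (P x)) (concat (blocks_in H q)))"
  proof -
    have o: "set (map (\<lambda>x. wlist (lst L (P x))) xs) \<subseteq> Obj QL" for xs by auto
    have v: "map (fob (fcm_model C L)) (map (\<lambda>x. wlist (lst L (P x))) xs) = map (\<lambda>x. vtens C L (P x)) xs" for xs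
      by (simp add: vtens_def)
    note e = query_iso_arr[OF assms(1) var_blocks(2)[of q]] query_iso_arr[OF assms(1) var_blocks(1)[of q]]
    show "?io \<in> Arr C" "src C ?io = tens C (map (vob L) (concat (blocks_out L ?q')))"
      "tgt C ?io = tens C (map (\<lambda>x. vtens C L (P x)) (concat (blocks_out H q)))"
      using e set_blocks(2)[of L ?q'] lm.fob_tens[OF o, unfolded v, of "concat (blocks_out H q)"]
      by (simp_all add: blocks_img_query[OF q] del: map_map set_concat)
    show "?ii \<in> Arr C" "src C ?ii = tens C (map (vob L) (concat (blocks_in L ?q')))"
      "tgt C ?ii = tens C (map (\<lambda>x. vtens C L (P x)) (concat (blocks_in H q)))"
      using e set_blocks(1)[of L ?q'] lm.fob_tens[OF o, unfolded v, of "concat (blocks_in H q)"]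
      by (simp_all add: blocks_img_query[OF q] del: map_map set_concat)
  qed
  note typing = T cL cH fl io ii tt[OF set_blocks(1)[of H q]] tt[OF set_blocks(2)[of H q]]
  have left: "(?to \<cdot> ?io \<cdot> ?qL) \<cdot> ?li = ?fo \<cdot> ?To \<cdot> ?cL"
  proof -
    have "(?to \<cdot> ?io \<cdot> ?qL) \<cdot> ?li = (?to \<cdot> ?io \<cdot> ?lo) \<cdot> ?cL"
      unfolding L.query_channel_def using typing inv q q' by (simp del: map_map set_concat)
    then show ?thesis unfolding ko using typing q q' by (simp del: map_map set_concat)
  qed
  have right: "(?qH \<cdot> ?ti \<cdot> ?ii) \<cdot> ?li = ?fo \<cdot> ?cH \<cdot> ?Ti"
  proof -
    have "(?qH \<cdot> ?ti \<cdot> ?ii) \<cdot> ?li = ?fo \<cdot> ?cH \<cdot> ?ui \<cdot> ?ti \<cdot> ?ii \<cdot> ?li"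
      unfolding H.query_channel_def using typing q q' by (simp del: map_map set_concat)
    also have "\<dots> = ?fo \<cdot> ?cH \<cdot> ?Ti"
      unfolding ki using typing q q' L.pull[OF inv(2), of ?Ti] by (simp del: map_map set_concat)
    finally show ?thesis .
  qed
  have iso: "L.iso ?li" "L.iso ?fo" by (rule L.iso_flat; simp del: set_map map_map)+
  have qc: "?qL \<in> Arr C" "src C ?qL = tens C (map (vob L) (concat (blocks_in L ?q')))"
    "tgt C ?qL = tens C (map (vob L) (concat (blocks_out L ?q')))"
    "?qH \<in> Arr C" "src C ?qH = tens C (map (vob H) (concat (blocks_in H q)))"
    "tgt C ?qH = tens C (map (vob H) (concat (blocks_out H q)))"
    unfolding L.query_channel_def H.query_channel_def using typing q q' by (simp_all del: map_map set_concat)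
  show ?thesis
  proof
    assume "?To \<cdot> ?cL = ?cH \<cdot> ?Ti"
    then have "(?to \<cdot> ?io \<cdot> ?qL) \<cdot> ?li = (?qH \<cdot> ?ti \<cdot> ?ii) \<cdot> ?li"
      unfolding left right by simp
    then show "?to \<cdot> ?io \<cdot> ?qL = ?qH \<cdot> ?ti \<cdot> ?ii"
      by (rule L.iso_epi[OF _ iso(1)]) (use typing qc in \<open>simp_all del: map_map set_concat\<close>)
  next
    assume "?to \<cdot> ?io \<cdot> ?qL = ?qH \<cdot> ?ti \<cdot> ?ii"
    then have "?fo \<cdot> ?To \<cdot> ?cL = ?fo \<cdot> ?cH \<cdot> ?Ti"
      unfolding left[symmetric] right[symmetric] by simp
    then show "?To \<cdot> ?cL = ?cH \<cdot> ?Ti"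
      by (rule L.iso_mono[OF _ iso(2)]) (use typing q q' in \<open>simp_all del: map_map set_concat\<close>)
  qed
qed

end

lemma distinct_concat_mapD:
  assumes "distinct (concat (map f xs))" "x \<in> set xs" "y \<in> set xs" "x \<noteq> y"
  shows "set (f x) \<inter> set (f y) = {}"
  using assms by (induction xs) auto

lemma blocks_subset:
  "\<forall>S \<in> set (blocks_in M q). set S \<subseteq> V M" "\<forall>S \<in> set (blocks_out M q). set S \<subseteq> V M"
  by (auto simp: blocks_in_def blocks_out_def)

lemma wevalm_wlist: "wevalm C t (wlist xs) = tensm C (map t xs)"
  by (induction xs) auto

context fcm_pair
begin

lemma img_iso_eq:
  assumes "\<forall>S \<in> set Ss. \<forall>x \<in> set S. fob \<pi> (WVar x) = wlist (lst L (P x))"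
  shows "img_iso L H P \<pi> Ss = fcoh QH QL \<pi> (map WVar (concat Ss)) \<cdot>\<^bsub>QL\<^esub> query_iso P Ss"
proof -
  have m: "map (map (\<lambda>x. fob \<pi> (WVar x))) Ss = map (map (\<lambda>x. wlist (lst L (P x)))) Ss"
    using assms by simp
  show ?thesis
    by (simp add: m img_iso_def query_iso_def block_iso_def[abs_def] low_def Let_def)
qed

lemma gen_arr_L [simp]:
  assumes "disjoint_images P" "q \<in> gens (CF H)"
  shows "gen_arr (CF L) (img_query P q) \<in> Arr QL"
    "src QL (gen_arr (CF L) (img_query P q)) = wlist (concat (map (low P) (blocks_in H q)))"
    "tgt QL (gen_arr (CF L) (img_query P q)) = wlist (concat (map (low P) (blocks_out H q)))"
  using L.gen_arr_CF_hom[OF img_query_gens[OF assms]] blocks_img_query[OF assms(2)]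
  by (auto simp: hom_def)

lemma gen_arr_H [simp]:
  assumes "q \<in> gens (CF H)"
  shows "gen_arr (CF H) q \<in> Arr QH" "src QH (gen_arr (CF H) q) = wlist (concat (blocks_in H q))"
    "tgt QH (gen_arr (CF H) q) = wlist (concat (blocks_out H q))"
  using H.gen_arr_CF_hom[OF assms] by (auto simp: hom_def)

text \<open>Restriction to variables determines \<open>P\<close> on \<open>V H\<close> only, so
  everything built from \<open>P\<close> must be insensitive to its other values.\<close>

lemma img_cong: "\<forall>x \<in> V H. P x = P' x \<Longrightarrow> X \<subseteq> V H \<Longrightarrow> img P X = img P' X"
  by (auto simp: img_def)

lemma img_query_cong:
  assumes "\<forall>x \<in> V H. P x = P' x" "q \<in> gens (CF H)"
  shows "img_query P q = img_query P' q"
  using assms(2) img_cong[OF assms(1)] by (auto simp: img_query_def)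

lemma query_iso_cong:
  assumes "\<forall>x \<in> V H. P x = P' x" "\<forall>S \<in> set Ss. set S \<subseteq> V H"
  shows "query_iso P Ss = query_iso P' Ss"
proof -
  have "map (\<lambda>x. lst L (P x)) S = map (\<lambda>x. lst L (P' x)) S"
    "map (\<lambda>x. wlist (lst L (P x))) S = map (\<lambda>x. wlist (lst L (P' x))) S" if "S \<in> set Ss" for S
    using that assms by (auto simp: subset_iff)
  then show ?thesis
    using img_cong[OF assms(1)] assms(2) by (simp add: query_iso_def block_iso_def low_def cong: map_cong)
qed

lemma set_blocks_simps [simp]:
  "\<Union> (set ` set (blocks_in H q)) \<subseteq> V H" "\<Union> (set ` set (blocks_out H q)) \<subseteq> V H"
  using set_blocks[of H q] by auto

end

section \<open>From downward abstractions to counterfactual abstractions\<close>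

locale cf_functor = fcm_pair C L H + p: markov_functor_between "free_markov (CF H)" "free_markov (CF L)" \<pi>
  for C :: "('o, 'm) mcat" (structure) and L :: "('v, 'o, 'm) fcm" and H :: "('w, 'o, 'm) fcm" and \<pi> +
  fixes P :: "'w \<Rightarrow> 'v set"
  assumes preserves: "preserves_cf_queries L H P \<pi>"
begin

lemma fob_var [simp]: "x \<in> V H \<Longrightarrow> fob \<pi> (WVar x) = wlist (lst L (P x))"
  using preserves by (simp add: preserves_cf_queries_def)

declare free_ten_unt [where S = "CF H", simp]

lemma structure_arr [simp]:
  "v \<in> Obj QH \<Longrightarrow> w \<in> Obj QH \<Longrightarrow> src QL (fmu \<pi> v w) = fob \<pi> v \<otimes>\<^bsub>QL\<^esub> fob \<pi> w"
  "v \<in> Obj QH \<Longrightarrow> w \<in> Obj QH \<Longrightarrow> tgt QL (fmu \<pi> v w) = fob \<pi> (WTen v w)"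
  "tgt QL (fnu \<pi>) = fob \<pi> WUnit"
  using p.fmu_arr[of v w] p.fnu_arr by simp_all

lemma disjoint [simp]: "disjoint_images P"
  unfolding disjoint_images_def
proof (intro conjI ballI impI)
  fix x y assume xy: "x \<in> V H" "y \<in> V H" "x \<noteq> y"
  have sub: "P x \<subseteq> V L" "P y \<subseteq> V L"
    using preserves xy by (auto simp: preserves_cf_queries_def)
  \<comment> \<open>The instance at the set of all variables contains every pair of blocks.\<close>
  have "distinct (concat (map (\<lambda>x. lst L (P x)) (lst H (V H))))"
    using preserves by (simp add: preserves_cf_queries_def)
  from distinct_concat_mapD[OF this, of x y] sub xy show "P x \<inter> P y = {}" by auto
next
  fix x assume "x \<in> V H"
  then show "P x \<subseteq> V L" using preserves by (simp add: preserves_cf_queries_def)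
qed

lemma fcoh_arr [simp]:
  assumes "set xs \<subseteq> V H"
  shows "fcoh QH QL \<pi> (map WVar xs) \<in> Arr QL"
    "src QL (fcoh QH QL \<pi> (map WVar xs)) = tens QL (map (\<lambda>x. wlist (lst L (P x))) xs)"
    "tgt QL (fcoh QH QL \<pi> (map WVar xs)) = fob \<pi> (wlist xs)"
    "lm.src.iso (fcoh QH QL \<pi> (map WVar xs))" "lm.src.det (fcoh QH QL \<pi> (map WVar xs))"
proof -
  have o: "set (map WVar xs) \<subseteq> Obj QH" using assms by auto
  have m: "map (fob \<pi>) (map WVar xs) = map (\<lambda>x. wlist (lst L (P x))) xs" using assms by auto
  show "fcoh QH QL \<pi> (map WVar xs) \<in> Arr QL"
    "src QL (fcoh QH QL \<pi> (map WVar xs)) = tens QL (map (\<lambda>x. wlist (lst L (P x))) xs)"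
    "tgt QL (fcoh QH QL \<pi> (map WVar xs)) = fob \<pi> (wlist xs)"
    "lm.src.iso (fcoh QH QL \<pi> (map WVar xs))" "lm.src.det (fcoh QH QL \<pi> (map WVar xs))"
    using p.fcoh_arr[OF o] p.iso_det_fcoh[OF o] unfolding m by simp_all
qed

lemma preserves_gen:
  assumes q: "q \<in> gens (CF H)"
  shows "far \<pi> (gen_arr (CF H) q) \<cdot>\<^bsub>QL\<^esub> fcoh QH QL \<pi> (map WVar (concat (blocks_in H q))) \<cdot>\<^bsub>QL\<^esub>
      query_iso P (blocks_in H q) =
    fcoh QH QL \<pi> (map WVar (concat (blocks_out H q))) \<cdot>\<^bsub>QL\<^esub> query_iso P (blocks_out H q) \<cdot>\<^bsub>QL\<^esub>
      gen_arr (CF L) (img_query P q)"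
proof -
  have b: "\<forall>S \<in> set (blocks_in H q). \<forall>x \<in> set S. fob \<pi> (WVar x) = wlist (lst L (P x))"
    "\<forall>S \<in> set (blocks_out H q). \<forall>x \<in> set S. fob \<pi> (WVar x) = wlist (lst L (P x))"
    using blocks_subset[of H q] by (auto simp: subset_iff)
  have "far \<pi> (gen_arr (CF H) q) \<cdot>\<^bsub>QL\<^esub> img_iso L H P \<pi> (blocks_in H q) =
      img_iso L H P \<pi> (blocks_out H q) \<cdot>\<^bsub>QL\<^esub> gen_arr (CF L) (img_query P q)"
    using preserves q unfolding preserves_cf_queries_def by blast
  then show ?thesis using q by (simp add: img_iso_eq[OF b(1)] img_iso_eq[OF b(2)])
qed

text \<open>Since \<open>P x\<close> lies in \<open>V L\<close>, it is the set of letters of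
  \<open>wlist (lst L (P x))\<close>. Hence \<open>\<pi>\<close> determines the witness
  \<open>P\<close> on \<open>V H\<close>.\<close>

lemma restrict_to_vars_fst: "fst (restrict_to_vars H (\<pi>, \<tau>)) = restrict P (V H)"
  using disjoint by (fastforce simp: restrict_to_vars_def disjoint_images_def)

end

locale cf_downward = cf_functor C L H \<pi> P
  for C :: "('o, 'm) mcat" (structure) and L :: "('v, 'o, 'm) fcm" and H :: "('w, 'o, 'm) fcm" and \<pi> P +
  fixes \<tau> :: "'w word \<Rightarrow> 'm"
  assumes natural: "markov_nat (free_markov (CF H)) C
      (fcomp (free_markov (CF H)) C (fcm_model C L) \<pi>) (fcm_model C H) \<tau>"
    and epic_tau: "w \<in> Obj (free_markov (CF H)) \<Longrightarrow> epic C (\<tau> w)"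
begin

lemma tau_arr [simp]:
  assumes "w \<in> Obj QH"
  shows "\<tau> w \<in> Arr C" "src C (\<tau> w) = fob (fcm_model C L) (fob \<pi> w)" "tgt C (\<tau> w) = fob (fcm_model C H) w"
    "L.det (\<tau> w)"
  using markov_nat.nat_hom[OF natural assms] markov_nat.nat_det[OF natural assms] assms
  unfolding L.det_def by (auto simp: hom_def fcomp_def)

text \<open>Both models are strict, so the structure map of the composite functor is the image of
  that of \<open>\<pi>\<close>.\<close>

lemma tau_WTen:
  assumes "v \<in> Obj QH" "w \<in> Obj QH"
  shows "\<tau> (WTen v w) \<cdot> far (fcm_model C L) (fmu \<pi> v w) = \<tau> v \<boxtimes> \<tau> w"
  using markov_nat.nat_fmu[OF natural assms] assms by (simp add: fcomp_def)

lemma tau_WUnit: "\<tau> WUnit \<cdot> far (fcm_model C L) (fnu \<pi>) = idt C (unt C)"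
  using markov_nat.nat_fnu[OF natural] by (simp add: fcomp_def)

lemma tau_fcoh:
  assumes "set xs \<subseteq> V H"
  shows "\<tau> (wlist xs) \<cdot> far (fcm_model C L) (fcoh QH QL \<pi> (map WVar xs)) = tensm C (map (\<lambda>x. \<tau> (WVar x)) xs)"
  using assms
proof (induction xs)
  case Nil
  then show ?case using tau_WUnit by simp
next
  case (Cons x xs)
  then have [simp]: "x \<in> V H" "set xs \<subseteq> V H" by auto
  show ?case using Cons.IH by (simp add: L.pull[OF tau_WTen])
qed

text \<open>Epicness is assumed of the components of \<open>\<tau>\<close> but has to be shown for
  tensors of its values on variables; the two differ by an isomorphism built from the structure maps
  of \<open>\<pi>\<close>.\<close>

lemma tau_wevalm:
  assumes "set_word w \<subseteq> V H"
  shows "\<exists>i. L.iso i \<and> tgt C i = src C (\<tau> w) \<and> \<tau> w \<cdot> i = wevalm C (\<lambda>x. \<tau> (WVar x)) w"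
  using assms
proof (induction w)
  case WUnit
  show ?case using tau_WUnit by (intro exI[of _ "far (fcm_model C L) (fnu \<pi>)"]) simp
next
  case (WVar x)
  then show ?case by (intro exI[of _ "idt C (src C (\<tau> (WVar x)))"]) simp
next
  case (WTen v w)
  then obtain i j where i: "L.iso i" "tgt C i = src C (\<tau> v)" "\<tau> v \<cdot> i = wevalm C (\<lambda>x. \<tau> (WVar x)) v"
    and j: "L.iso j" "tgt C j = src C (\<tau> w)" "\<tau> w \<cdot> j = wevalm C (\<lambda>x. \<tau> (WVar x)) w"
    by auto
  have o: "v \<in> Obj QH" "w \<in> Obj QH" using WTen.prems by (simp_all add: free_markov_simps words_def)
  show ?case
    using i j o
    by (intro exI[of _ "far (fcm_model C L) (fmu \<pi> v w) \<cdot> (i \<boxtimes> j)"]) (simp add: L.pull[OF tau_WTen])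
qed

lemma tau_var_hom: "\<forall>x \<in> V H. \<tau> (WVar x) \<in> hom C (vtens C L (P x)) (vob H x)"
  by (simp add: hom_def vtens_def)

text \<open>Naturality of \<open>\<tau>\<close> at the generator, precomposed with the images of
  \<open>fcoh\<close> and \<open>query_iso\<close>: the query condition replaces the image of the
  generator, and \<open>tau_fcoh\<close> absorbs both coherence maps.\<close>

lemma query_equation:
  assumes q: "q \<in> gens (CF H)"
  shows "tensm C (map (\<lambda>x. \<tau> (WVar x)) (concat (blocks_out H q))) \<cdot>
      far (fcm_model C L) (query_iso P (blocks_out H q)) \<cdot> L.query_channel (img_query P q) =
    H.query_channel q \<cdot> tensm C (map (\<lambda>x. \<tau> (WVar x)) (concat (blocks_in H q))) \<cdot>
      far (fcm_model C L) (query_iso P (blocks_in H q))"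
proof -
  let ?wi = "wlist (concat (blocks_in H q))" and ?wo = "wlist (concat (blocks_out H q))"
  let ?ci = "fcoh QH QL \<pi> (map WVar (concat (blocks_in H q)))"
    and ?co = "fcoh QH QL \<pi> (map WVar (concat (blocks_out H q)))"
    and ?ii = "query_iso P (blocks_in H q)" and ?io = "query_iso P (blocks_out H q)"
    and ?g = "gen_arr (CF H) q" and ?g' = "gen_arr (CF L) (img_query P q)" and ?l = "far (fcm_model C L)"
  have gq: "?l ?g' = L.query_channel (img_query P q)" "far (fcm_model C H) ?g = H.query_channel q"
    by (rule L.fcm_model_gen_arr[OF img_query_gens[OF disjoint q]] H.fcm_model_gen_arr[OF q])+
  note fc = fcoh_arr[OF set_blocks(1)[of H q]] fcoh_arr[OF set_blocks(2)[of H q]]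
  note tf = tau_fcoh[OF set_blocks(1)[of H q]] tau_fcoh[OF set_blocks(2)[of H q]]
  note qi = query_iso_arr[OF disjoint var_blocks(1)[of q]] query_iso_arr[OF disjoint var_blocks(2)[of q]]
  have wo: "?wi \<in> Obj QH" "?wo \<in> Obj QH" using set_blocks[of H q] by simp_all
  have pg: "?l (far \<pi> ?g) \<cdot> ?l ?ci \<cdot> ?l ?ii = ?l ?co \<cdot> ?l ?io \<cdot> ?l ?g'"
  proof -
    have "?l (far \<pi> ?g \<cdot>\<^bsub>QL\<^esub> ?ci \<cdot>\<^bsub>QL\<^esub> ?ii) = ?l (?co \<cdot>\<^bsub>QL\<^esub> ?io \<cdot>\<^bsub>QL\<^esub> ?g')"
      using preserves_gen[OF q] by simp
    then show ?thesis using fc qi q wo by (simp del: set_concat)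
  qed
  have nat: "\<tau> ?wo \<cdot> ?l (far \<pi> ?g) = far (fcm_model C H) ?g \<cdot> \<tau> ?wi"
    using markov_nat.nat_natural[OF natural H.gen_arr_CF_hom[OF q]] q by (simp add: fcomp_def)
  have "tensm C (map (\<lambda>x. \<tau> (WVar x)) (concat (blocks_out H q))) \<cdot> ?l ?io \<cdot> ?l ?g' =
      \<tau> ?wo \<cdot> ?l ?co \<cdot> ?l ?io \<cdot> ?l ?g'"
    unfolding tf(2)[symmetric] using fc qi q wo by (simp del: set_concat)
  also have "\<dots> = (\<tau> ?wo \<cdot> ?l (far \<pi> ?g)) \<cdot> ?l ?ci \<cdot> ?l ?ii"
    unfolding pg[symmetric] using fc qi q wo by (simp del: set_concat)
  also have "\<dots> = far (fcm_model C H) ?g \<cdot> (\<tau> ?wi \<cdot> ?l ?ci) \<cdot> ?l ?ii"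
    unfolding nat using fc qi q wo by (simp del: set_concat)
  also have "\<dots> = far (fcm_model C H) ?g \<cdot> tensm C (map (\<lambda>x. \<tau> (WVar x)) (concat (blocks_in H q))) \<cdot> ?l ?ii"
    unfolding tf(1) ..
  finally show ?thesis unfolding gq .
qed

lemma restrict_in_cf_abstractions: "restrict_to_vars H (\<pi>, \<tau>) \<in> cf_abstractions C L H"
proof -
  \<comment> \<open>Restricted because \<open>cf_abstractions\<close> asks for extensional
    functions.\<close>
  define t where "t = restrict (\<lambda>x. \<tau> (WVar x)) (V H)"
  define P' where "P' = restrict P (V H)"
  have r: "restrict_to_vars H (\<pi>, \<tau>) = (P', t)"
    using restrict_to_vars_fst[of \<tau>] by (simp add: P'_def t_def restrict_to_vars_def)
  have d: "disjoint_images P'"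
    using disjoint by (simp add: disjoint_images_def P'_def)
  have t: "\<forall>x \<in> V H. t x \<in> hom C (vtens C L (P' x)) (vob H x)"
    using tau_var_hom by (simp add: t_def P'_def)
  have e: "epic C (wevalm C t w)" if w: "set_word w \<subseteq> V H" for w
  proof -
    have "wevalm C t w = wevalm C (\<lambda>x. \<tau> (WVar x)) w"
      using w by (induction w) (simp_all add: t_def)
    moreover have o: "w \<in> Obj QH" using w by (simp add: free_markov_simps words_def)
    ultimately show ?thesis
      using tau_wevalm[OF w] L.epic_cmp_iso[OF epic_tau[OF o] _ tau_arr(1)[OF o]] by metis
  qed
  have P': "\<forall>x \<in> V H. P' x = P x"
    by (simp add: P'_def)
  have eq: "tensm C (map (\<lambda>(Y, X). tau_set C L H P' t Y) q) \<cdot> cf_channel C L (img_query P' q) =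
      cf_channel C H q \<cdot> tensm C (map (\<lambda>(Y, X). tau_set C L H P' t X) q)" if q: "q \<in> gens (CF H)" for q
  proof -
    have tt: "map t xs = map (\<lambda>x. \<tau> (WVar x)) xs" if "set xs \<subseteq> V H" for xs
      using that by (auto simp: t_def)
    note ll = query_iso_cong[OF P' blocks_subset(1)] query_iso_cong[OF P' blocks_subset(2)]
    show ?thesis
      unfolding abstraction_equation[OF d q t] unfolding ll img_query_cong[OF P' q] tt[OF set_blocks(1)] tt[OF set_blocks(2)]
      by (rule query_equation[OF q])
  qed
  have det: "deterministic C (t x)" if "x \<in> V H" for x
    using tau_arr(4)[of "WVar x"] that unfolding L.det_def by (simp add: t_def)
  show ?thesis
    unfolding r cf_abstractions_def
    using d t e eq det by (auto simp: P'_def t_def disjoint_images_def)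
qed

end

section \<open>The converse construction and uniqueness up to isomorphism\<close>

context fcm_pair
begin

lemma cf_downward_abstractionsE:
  assumes "(\<pi>, \<tau>) \<in> cf_downward_abstractions C L H"
  obtains P where "cf_downward C L H \<pi> P \<tau>"
proof -
  obtain P where d: "downward_abstraction C (CF L) (fcm_model C L) (CF H) (fcm_model C H) (\<pi>, \<tau>)"
    and P: "preserves_cf_queries L H P \<pi>"
    using assms by (auto simp: cf_downward_abstractions_def)
  have \<pi>: "markov_functor QH QL \<pi>"
    using d by (simp add: downward_abstraction_def)
  interpret p: markov_functor_between QH QL \<pi>
    by (intro markov_functor_between.intro markov_free \<pi>)
  have "cf_downward C L H \<pi> P \<tau>"
    using d P
    by (intro cf_downward.intro cf_functor.intro cf_functor_axioms.intro cf_downward_axioms.intro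
        fcm_pair_axioms p.markov_functor_between_axioms) (simp_all add: downward_abstraction_def)
  then show thesis by (rule that)
qed

text \<open>
  Every counterfactual abstraction extends to the strict functor given by the universal property of the
  free category, with the generators conjugated by the regrouping isomorphisms.
\<close>

lemma cf_abstraction_extends:
  assumes Pt: "(P, t) \<in> cf_abstractions C L H"
  obtains \<pi> \<tau> where "(\<pi>, \<tau>) \<in> cf_downward_abstractions C L H" "strict_functor QH QL \<pi>"
    "restrict_to_vars H (\<pi>, \<tau>) = (P, t)"
proof -
  have ext: "P \<in> extensional (V H)" "t \<in> extensional (V H)"
    and d [simp]: "disjoint_images P"
    and t: "\<forall>x \<in> V H. t x \<in> hom C (vtens C L (P x)) (vob H x)" "\<And>x. x \<in> V H \<Longrightarrow> deterministic C (t x)"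
    and e: "\<And>w. set_word w \<subseteq> V H \<Longrightarrow> epic C (wevalm C t w)"
    and eq: "\<And>q. q \<in> gens (CF H) \<Longrightarrow>
      tensm C (map (\<lambda>(Y, X). tau_set C L H P t Y) q) \<cdot> cf_channel C L (img_query P q) =
      cf_channel C H q \<cdot> tensm C (map (\<lambda>(Y, X). tau_set C L H P t X) q)"
    using Pt by (auto simp: cf_abstractions_def disjoint_images_def)
  define pob where "pob x = wlist (lst L (P x))" for x
  define pch where "pch q = query_iso P (blocks_out H q) \<cdot>\<^bsub>QL\<^esub> gen_arr (CF L) (img_query P q) \<cdot>\<^bsub>QL\<^esub>
      lm.src.inv_arr (query_iso P (blocks_in H q))" for q
  define \<pi> where "\<pi> = model_of (CF H) QL pob pch"
  define \<tau> where "\<tau> = restrict (wevalm C t) (words (CF H))"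
  have pob: "map (\<lambda>x. wlist (lst L (P x))) xs = map pob xs" for xs by (simp add: pob_def)
  have pob_obj: "pob ` A \<subseteq> Obj QL" for A by (auto simp: pob_def)
  have pch: "pch q \<in> hom QL (tens QL (map pob (concat (blocks_in H q)))) (tens QL (map pob (concat (blocks_out H q))))"
    if "q \<in> gens (CF H)" for q
    using that by (simp add: hom_def pch_def pob del: set_concat)
  interpret m: free_model QL "CF H" pob pch
    by unfold_locales (use pch pob_obj in simp_all)
  interpret p: strict_markov_functor QH QL \<pi>
    unfolding \<pi>_def by (rule m.strict_model_of)
  let ?F = "fcomp QH C (fcm_model C L) \<pi>"
  interpret f: strict_markov_functor QH C ?F
    by (rule strict_fcomp) unfold_locales
  have obj: "w \<in> Obj QH \<longleftrightarrow> set_word w \<subseteq> V H" for w by (simp add: free_markov_simps words_def)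
  have pi_var: "fob \<pi> (WVar x) = wlist (lst L (P x))" if "x \<in> V H" for x
    using that by (simp add: \<pi>_def model_of_def pob_def)
  have pi_gen: "far \<pi> (gen_arr (CF H) q) = pch q" if "q \<in> gens (CF H)" for q
    unfolding \<pi>_def using that set_blocks[of H q] by (intro m.model_of_gen_arr) simp_all
  \<comment> \<open>\<open>\<pi>\<close> is strict, so its coherence maps are identities and
    \<open>img_iso\<close> reduces to \<open>query_iso\<close>.\<close>
  have fcoh: "fcoh QH QL \<pi> (map WVar xs) = idt QL (tens QL (map pob xs))" if "set xs \<subseteq> V H" for xs
  proof -
    have "set (map WVar xs) \<subseteq> Obj QH" "map (fob \<pi>) (map WVar xs) = map pob xs"
      using that by (auto simp: pi_var pob_def)
    with p.fcoh_strict show ?thesis by metis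
  qed
  have iso: "img_iso L H P \<pi> (blocks_in H q) = query_iso P (blocks_in H q)"
    "img_iso L H P \<pi> (blocks_out H q) = query_iso P (blocks_out H q)" for q
  proof -
    have b: "\<forall>S \<in> set (blocks_in H q). \<forall>x \<in> set S. fob \<pi> (WVar x) = wlist (lst L (P x))"
      "\<forall>S \<in> set (blocks_out H q). \<forall>x \<in> set S. fob \<pi> (WVar x) = wlist (lst L (P x))"
      using blocks_subset[of H q] by (auto simp: subset_iff pi_var)
    show "img_iso L H P \<pi> (blocks_in H q) = query_iso P (blocks_in H q)"
      "img_iso L H P \<pi> (blocks_out H q) = query_iso P (blocks_out H q)"
      unfolding img_iso_eq[OF b(1)] img_iso_eq[OF b(2)] fcoh[OF set_blocks(1)] fcoh[OF set_blocks(2)]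
      by (simp_all add: pob del: set_concat)
  qed
  have preserves: "preserves_cf_queries L H P \<pi>"
    unfolding preserves_cf_queries_def
  proof (intro conjI ballI allI impI)
    fix S assume "S \<subseteq> V H"
    then show "distinct (concat (map (\<lambda>x. lst L (P x)) (lst H S)))"
      using d by (intro distinct_concat_lst) (auto simp: disjoint_images_def)
  next
    fix q assume q: "q \<in> gens (CF H)"
    \<comment> \<open>The inverse in \<open>pch\<close> cancels against \<open>img_iso\<close> of
      the inputs.\<close>
    show "far \<pi> (gen_arr (CF H) q) \<cdot>\<^bsub>QL\<^esub> img_iso L H P \<pi> (blocks_in H q) =
        img_iso L H P \<pi> (blocks_out H q) \<cdot>\<^bsub>QL\<^esub> gen_arr (CF L) (img_query P q)"
      unfolding iso pi_gen[OF q] pch_def using q by simp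
  qed (use d in \<open>auto simp: disjoint_images_def pi_var\<close>)
  have te: "wevalm C t w \<in> Arr C \<and> src C (wevalm C t w) = fob ?F w \<and>
      tgt C (wevalm C t w) = fob (fcm_model C H) w \<and> L.det (wevalm C t w)" if "w \<in> Obj QH" for w
    using that
  proof (induction w)
    case WUnit
    then show ?case using f.strict_simps(3) hm.strict_simps(3) by (simp add: free_ten_unt)
  next
    case (WVar x)
    then have "fob ?F (WVar x) = vtens C L (P x)" by (simp add: fcomp_def pi_var vtens_def)
    with WVar t show ?case by (auto simp: hom_def L.det_def)
  next
    case (WTen v w)
    then show ?case using f.strict_simps(1)[of v w] hm.strict_simps(1)[of v w] by (simp add: free_ten_unt)
  qed
  have natural: "markov_nat QH C ?F (fcm_model C H) \<tau>"
  proof (rule markov_nat_freeI)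
    have o: "w \<in> words (CF H) \<Longrightarrow> w \<in> Obj QH" for w by (simp add: free_markov_simps)
    show "\<tau> w \<in> hom C (fob ?F w) (fob (fcm_model C H) w)" if "w \<in> words (CF H)" for w
      using te[OF o[OF that]] that by (simp add: hom_def \<tau>_def)
    show "deterministic C (\<tau> w)" if "w \<in> words (CF H)" for w
      using te[OF o[OF that]] that unfolding L.det_def by (simp add: \<tau>_def)
    show "\<tau> (WTen v w) \<cdot> fmu ?F v w = fmu (fcm_model C H) v w \<cdot> (\<tau> v \<boxtimes> \<tau> w)"
      if "v \<in> words (CF H)" "w \<in> words (CF H)" for v w
      using te[OF o[OF that(1)]] te[OF o[OF that(2)]] that o by (simp add: \<tau>_def)
    show "\<tau> WUnit \<cdot> fnu ?F = fnu (fcm_model C H)"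
      by (simp add: \<tau>_def)
    fix q assume "q \<in> gens (CF H)"
    then have q: "q \<in> gens (CF H)" .
    let ?l = "far (fcm_model C L)" and ?ii = "query_iso P (blocks_in H q)" and ?io = "query_iso P (blocks_out H q)"
    have wl: "\<tau> (wlist xs) = tensm C (map t xs)" if "set xs \<subseteq> V H" for xs
      using that by (simp add: \<tau>_def wevalm_wlist)
    have wt: "tensm C (map t xs) \<in> Arr C" "src C (tensm C (map t xs)) = fob (fcm_model C L) (tens QL (map pob xs))"
      "tgt C (tensm C (map t xs)) = fob (fcm_model C H) (wlist xs)" if "set xs \<subseteq> V H" for xs
    proof -
      have w: "wlist xs \<in> Obj QH" using that by simp
      have "fob \<pi> (wlist xs) = tens QL (map pob xs)"
        using that by (simp add: \<pi>_def model_of_def weval_wlist)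
      then have "fob ?F (wlist xs) = fob (fcm_model C L) (tens QL (map pob xs))"
        using w by (simp add: fcomp_def)
      with te[OF w] show "tensm C (map t xs) \<in> Arr C" "src C (tensm C (map t xs)) = fob (fcm_model C L) (tens QL (map pob xs))"
        "tgt C (tensm C (map t xs)) = fob (fcm_model C H) (wlist xs)" by (simp_all add: wevalm_wlist)
    qed
    note wt' = wt[OF set_blocks(1)[of H q]] wt[OF set_blocks(2)[of H q]]
    note qi = query_iso_arr[OF d var_blocks(1)[of q], unfolded pob] query_iso_arr[OF d var_blocks(2)[of q], unfolded pob]
    have g: "?l (gen_arr (CF L) (img_query P q)) = L.query_channel (img_query P q)"
      "far (fcm_model C H) (gen_arr (CF H) q) = H.query_channel q"
      by (rule L.fcm_model_gen_arr[OF img_query_gens[OF d q]] H.fcm_model_gen_arr[OF q])+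
    \<comment> \<open>The equation assumed of \<open>(P, t)\<close> enters here, for each generator
      separately.\<close>
    have main: "tensm C (map t (concat (blocks_out H q))) \<cdot> ?l ?io \<cdot> ?l (gen_arr (CF L) (img_query P q)) =
        far (fcm_model C H) (gen_arr (CF H) q) \<cdot> tensm C (map t (concat (blocks_in H q))) \<cdot> ?l ?ii"
      using eq[OF q] unfolding abstraction_equation[OF d q t(1)] g .
    have inv: "?l ?ii \<cdot> ?l (lm.src.inv_arr ?ii) = idt C (fob (fcm_model C L) (tens QL (map pob (concat (blocks_in H q)))))"
    proof -
      have "tens QL (map pob xs) \<in> Obj QL" for xs
        using pob_obj by (intro lm.src.tens_obj) simp
      with qi show ?thesis by (subst lm.far_compose[symmetric]) (simp_all del: set_concat)
    qed
    have "far ?F (gen_arr (CF H) q) = ?l ?io \<cdot> ?l (gen_arr (CF L) (img_query P q)) \<cdot> ?l (lm.src.inv_arr ?ii)"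
      using q qi by (simp add: fcomp_def pi_gen pch_def del: set_concat)
    then have "\<tau> (wlist (concat (blocks_out H q))) \<cdot> far ?F (gen_arr (CF H) q) =
        (tensm C (map t (concat (blocks_out H q))) \<cdot> ?l ?io \<cdot> ?l (gen_arr (CF L) (img_query P q))) \<cdot>
          ?l (lm.src.inv_arr ?ii)"
      unfolding wl[OF set_blocks(2)] using q qi wt' by (simp del: set_concat)
    also have "\<dots> = far (fcm_model C H) (gen_arr (CF H) q) \<cdot> tensm C (map t (concat (blocks_in H q)))"
      unfolding main using q qi wt' inv by (simp del: set_concat)
    finally show "\<tau> (wlist (outs (CF H) q)) \<cdot> far ?F (gen_arr (CF H) q) =
        far (fcm_model C H) (gen_arr (CF H) q) \<cdot> \<tau> (wlist (ins (CF H) q))"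
      using wl[OF set_blocks(1)] by simp
  qed (use f.markov_functor_axioms hm.markov_functor_axioms L.markov_axioms in \<open>simp_all add: \<tau>_def\<close>)
  have epic: "epic C (\<tau> w)" if "w \<in> Obj QH" for w
    using e[of w] that obj[of w] by (simp add: \<tau>_def words_def)
  have "downward_abstraction C (CF L) (fcm_model C L) (CF H) (fcm_model C H) (\<pi>, \<tau>)"
    unfolding downward_abstraction_def prod.case
  proof (intro conjI ballI)
    fix q assume q: "q \<in> gens (CF H)"
    let ?a = "lm.src.inv_arr (query_iso P (blocks_in H q))" and ?b = "query_iso P (blocks_out H q)"
    have w: "fob \<pi> (wlist xs) = tens QL (map pob xs)" if "set xs \<subseteq> V H" for xs
      using that by (simp add: \<pi>_def model_of_def weval_wlist)
    note qi = query_iso_arr[OF d var_blocks(1)[of q], unfolded pob] query_iso_arr[OF d var_blocks(2)[of q], unfolded pob]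
    have a: "?a \<in> hom QL (fob \<pi> (wlist (ins (CF H) q))) (wlist (ins (CF L) (img_query P q)))"
      using qi w[OF set_blocks(1)] by (simp add: hom_def blocks_img_query[OF q] del: set_concat)
    have b: "?b \<in> hom QL (wlist (outs (CF L) (img_query P q))) (fob \<pi> (wlist (outs (CF H) q)))"
      using qi w[OF set_blocks(2)] by (simp add: hom_def blocks_img_query[OF q] del: set_concat)
    have ab: "iso_arr QL ?a \<and> deterministic QL ?a \<and> iso_arr QL ?b \<and> deterministic QL ?b"
    proof -
      have "lm.src.iso ?a" "lm.src.det ?a" "lm.src.iso ?b" "lm.src.det ?b" using qi by simp_all
      then show ?thesis unfolding lm.src.iso_def lm.src.det_def by blast
    qed
    have "far \<pi> (gen_arr (CF H) q) = ?b \<cdot>\<^bsub>QL\<^esub> gen_arr (CF L) (img_query P q) \<cdot>\<^bsub>QL\<^esub> ?a"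
      by (simp only: pi_gen[OF q] pch_def)
    with a b ab img_query_gens[OF d q]
    show "\<exists>q'\<in>gens (CF L). \<exists>a\<in>hom QL (fob \<pi> (wlist (ins (CF H) q))) (wlist (ins (CF L) q')).
        \<exists>b\<in>hom QL (wlist (outs (CF L) q')) (fob \<pi> (wlist (outs (CF H) q))).
          iso_arr QL a \<and> deterministic QL a \<and> iso_arr QL b \<and> deterministic QL b \<and>
          far \<pi> (gen_arr (CF H) q) = b \<cdot>\<^bsub>QL\<^esub> gen_arr (CF L) q' \<cdot>\<^bsub>QL\<^esub> a"
      by blast
  qed (use natural epic lm.markov_functor_axioms hm.markov_functor_axioms p.markov_functor_axioms in simp_all)
  then have "(\<pi>, \<tau>) \<in> cf_downward_abstractions C L H"
    using preserves by (auto simp: cf_downward_abstractions_def)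
  moreover have "restrict_to_vars H (\<pi>, \<tau>) = (P, t)"
  proof -
    interpret cf_functor C L H \<pi> P by unfold_locales (rule preserves)
    have "fst (restrict_to_vars H (\<pi>, \<tau>)) = P"
      unfolding restrict_to_vars_fst using ext(1) by (rule extensional_restrict)
    moreover have "restrict (\<lambda>x. \<tau> (WVar x)) (V H) = t"
      using ext(2) by (auto simp: \<tau>_def restrict_def extensional_def fun_eq_iff)
    ultimately show ?thesis by (simp add: restrict_to_vars_def)
  qed
  ultimately show thesis using p.strict that by blast
qed

text \<open>An identity that is a component of a transformation from \<open>\<pi>\<close> to
  \<open>\<pi>'\<close> forces equal objects at variables; compatibility with \<open>\<tau>\<close>
  and \<open>\<tau>'\<close> then gives equal channels there.\<close>

lemma same_abstraction_restrict:
  assumes "D \<in> cf_downward_abstractions C L H" "D' \<in> cf_downward_abstractions C L H" "same_abstraction C L H D D'"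
  shows "restrict_to_vars H D = restrict_to_vars H D'"
proof -
  obtain \<pi> \<tau> \<pi>' \<tau>' where D: "D = (\<pi>, \<tau>)" "D' = (\<pi>', \<tau>')" by fastforce
  obtain P where "cf_downward C L H \<pi> P \<tau>" using assms(1) D by (auto elim: cf_downward_abstractionsE)
  then interpret d: cf_downward C L H \<pi> P \<tau> .
  obtain P' where "cf_downward C L H \<pi>' P' \<tau>'" using assms(2) D by (auto elim: cf_downward_abstractionsE)
  then interpret d': cf_downward C L H \<pi>' P' \<tau>' .
  obtain \<alpha> where a: "markov_nat QH QL \<pi> \<pi>' \<alpha>" "\<forall>x \<in> V H. \<alpha> (WVar x) = idt QL (fob \<pi> (WVar x))"
    "\<forall>w \<in> Obj QH. \<tau>' w \<cdot> far (fcm_model C L) (\<alpha> w) = \<tau> w"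
    using assms(3) unfolding same_abstraction_def D by auto
  have "fob \<pi> (WVar x) = fob \<pi>' (WVar x) \<and> \<tau> (WVar x) = \<tau>' (WVar x)" if x: "x \<in> V H" for x
  proof -
    have "\<alpha> (WVar x) \<in> hom QL (fob \<pi> (WVar x)) (fob \<pi>' (WVar x))"
      using markov_nat.nat_hom[OF a(1), of "WVar x"] x by simp
    then have f: "fob \<pi> (WVar x) = fob \<pi>' (WVar x)"
      using x a(2) by (simp add: hom_def)
    have "\<tau>' (WVar x) \<cdot> far (fcm_model C L) (\<alpha> (WVar x)) = \<tau> (WVar x)" using a(3) x by simp
    then show ?thesis using f x a(2) d.fob_var[OF x] d'.fob_var[OF x] by simp
  qed
  then show ?thesis by (auto simp: D restrict_to_vars_def fun_eq_iff)
qed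

text \<open>The isomorphism is \<open>transport\<close>. Both functors send a generator to the same
  query of \<open>L\<close>, conjugated by their own coherence maps and a common
  \<open>query_iso\<close>, so naturality follows once \<open>transport_fcoh\<close> exchanges the
  coherence maps.\<close>

lemma restrict_same_abstraction:
  assumes "cf_downward C L H \<pi> P \<tau>" "cf_downward C L H \<pi>' P' \<tau>'"
    and r: "restrict_to_vars H (\<pi>, \<tau>) = restrict_to_vars H (\<pi>', \<tau>')"
  shows "same_abstraction C L H (\<pi>, \<tau>) (\<pi>', \<tau>')"
proof -
  interpret d: cf_downward C L H \<pi> P \<tau> by fact
  interpret d': cf_downward C L H \<pi>' P' \<tau>' by fact
  have PP: "P x = P' x" "\<tau> (WVar x) = \<tau>' (WVar x)" if "x \<in> V H" for x
  proof -
    have "restrict P (V H) = restrict P' (V H)"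
      using r d.restrict_to_vars_fst[of \<tau>] d'.restrict_to_vars_fst[of \<tau>'] by simp
    then show "P x = P' x" using that by (metis restrict_apply')
    have "restrict (\<lambda>x. \<tau> (WVar x)) (V H) = restrict (\<lambda>x. \<tau>' (WVar x)) (V H)"
      using r by (simp add: restrict_to_vars_def)
    then show "\<tau> (WVar x) = \<tau>' (WVar x)" using that by (metis restrict_apply')
  qed
  interpret fp: free_functor_pair "CF H" QL \<pi> \<pi>'
    by unfold_locales (use PP in simp)
  let ?T = "transport QL \<pi> \<pi>'"
  have T: "?T w \<in> Arr QL" "src QL (?T w) = fob \<pi> w" "tgt QL (?T w) = fob \<pi>' w"
    "lm.src.iso (?T w)" "lm.src.det (?T w)" if "w \<in> Obj QH" for w
    using fp.transport_arr[OF that] by simp_all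
  have P: "\<forall>x \<in> V H. P x = P' x"
    using PP by simp
  have natural: "markov_nat QH QL \<pi> \<pi>' (restrict ?T (words (CF H)))"
  proof (rule fp.transport_natural)
    fix q assume "q \<in> gens (CF H)"
    then have q: "q \<in> gens (CF H)" .
    let ?xi = "concat (blocks_in H q)" and ?xo = "concat (blocks_out H q)"
    let ?ci = "fcoh QH QL \<pi> (map WVar ?xi)" and ?co = "fcoh QH QL \<pi> (map WVar ?xo)"
      and ?ci' = "fcoh QH QL \<pi>' (map WVar ?xi)" and ?co' = "fcoh QH QL \<pi>' (map WVar ?xo)"
      and ?ii = "query_iso P (blocks_in H q)" and ?io = "query_iso P (blocks_out H q)"
      and ?g = "gen_arr (CF H) q" and ?g' = "gen_arr (CF L) (img_query P q)"
    have w: "wlist ?xi \<in> Obj QH" "wlist ?xo \<in> Obj QH" using set_blocks[of H q] by simp_all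
    note typing = T[OF w(1)] T[OF w(2)] d.fcoh_arr[OF set_blocks(1)[of H q]] d.fcoh_arr[OF set_blocks(2)[of H q]]
      query_iso_arr[OF d.disjoint var_blocks(1)[of q]] query_iso_arr[OF d.disjoint var_blocks(2)[of q]]
    have tf: "?T (wlist ?xi) \<cdot>\<^bsub>QL\<^esub> ?ci = ?ci'" "?T (wlist ?xo) \<cdot>\<^bsub>QL\<^esub> ?co = ?co'"
      using set_blocks[of H q] by (intro fp.transport_fcoh; simp)+
    have g: "far \<pi> ?g \<cdot>\<^bsub>QL\<^esub> ?ci \<cdot>\<^bsub>QL\<^esub> ?ii = ?co \<cdot>\<^bsub>QL\<^esub> ?io \<cdot>\<^bsub>QL\<^esub> ?g'"
      "far \<pi>' ?g \<cdot>\<^bsub>QL\<^esub> ?ci' \<cdot>\<^bsub>QL\<^esub> ?ii = ?co' \<cdot>\<^bsub>QL\<^esub> ?io \<cdot>\<^bsub>QL\<^esub> ?g'"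
      using d.preserves_gen[OF q] d'.preserves_gen[OF q]
        query_iso_cong[OF P blocks_subset(1)] query_iso_cong[OF P blocks_subset(2)] img_query_cong[OF P q]
      by simp_all
    have "(?T (wlist ?xo) \<cdot>\<^bsub>QL\<^esub> far \<pi> ?g) \<cdot>\<^bsub>QL\<^esub> ?ci \<cdot>\<^bsub>QL\<^esub> ?ii = ?T (wlist ?xo) \<cdot>\<^bsub>QL\<^esub> ?co \<cdot>\<^bsub>QL\<^esub> ?io \<cdot>\<^bsub>QL\<^esub> ?g'"
      unfolding g(1)[symmetric] using typing q by (simp del: set_concat)
    also have "\<dots> = ?co' \<cdot>\<^bsub>QL\<^esub> ?io \<cdot>\<^bsub>QL\<^esub> ?g'"
      unfolding tf(2)[symmetric] using typing q by (simp del: set_concat)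
    also have "\<dots> = (far \<pi>' ?g \<cdot>\<^bsub>QL\<^esub> ?T (wlist ?xi)) \<cdot>\<^bsub>QL\<^esub> ?ci \<cdot>\<^bsub>QL\<^esub> ?ii"
      unfolding g(2)[symmetric] tf(1)[symmetric] using typing q by (simp del: set_concat)
    finally have "?T (wlist ?xo) \<cdot>\<^bsub>QL\<^esub> far \<pi> ?g = far \<pi>' ?g \<cdot>\<^bsub>QL\<^esub> ?T (wlist ?xi)"
      by (rule lm.src.iso_epi) (use typing q in \<open>simp_all del: set_concat\<close>)
    then show "?T (wlist (outs (CF H) q)) \<cdot>\<^bsub>QL\<^esub> far \<pi> ?g = far \<pi>' ?g \<cdot>\<^bsub>QL\<^esub> ?T (wlist (ins (CF H) q))"
      by simp
  qed
  \<comment> \<open>Composed with the structure map of \<open>\<pi>\<close>, both sides become the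
    tensor of the components at the two factors, or the identity of the unit; the structure map then
    cancels.\<close>
  have tau: "\<tau>' w \<cdot> far (fcm_model C L) (?T w) = \<tau> w" if "w \<in> Obj QH" for w
    using that
  proof (induction w)
    case WUnit
    have "(\<tau>' WUnit \<cdot> far (fcm_model C L) (?T WUnit)) \<cdot> far (fcm_model C L) (fnu \<pi>) =
        \<tau>' WUnit \<cdot> far (fcm_model C L) (?T WUnit \<cdot>\<^bsub>QL\<^esub> fnu \<pi>)"
      using T[of WUnit] by (simp del: transport.simps)
    also have "\<dots> = \<tau> WUnit \<cdot> far (fcm_model C L) (fnu \<pi>)"
      unfolding fp.transport_fnu d.tau_WUnit d'.tau_WUnit ..
    finally show ?case
      by (rule L.iso_epi) (use T[of WUnit] in \<open>simp_all del: transport.simps\<close>)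
  next
    case (WVar x)
    then show ?case using PP by simp
  next
    case (WTen v w)
    then have o [simp]: "v \<in> Obj QH" "w \<in> Obj QH" by simp_all
    have "(\<tau>' (WTen v w) \<cdot> far (fcm_model C L) (?T (WTen v w))) \<cdot> far (fcm_model C L) (fmu \<pi> v w) =
        \<tau>' (WTen v w) \<cdot> far (fcm_model C L) (?T (WTen v w) \<cdot>\<^bsub>QL\<^esub> fmu \<pi> v w)"
      using T[of "WTen v w"] by (simp del: transport.simps)
    also have "\<dots> = (\<tau>' (WTen v w) \<cdot> far (fcm_model C L) (fmu \<pi>' v w)) \<cdot>
        (far (fcm_model C L) (?T v) \<boxtimes> far (fcm_model C L) (?T w))"
      unfolding fp.transport_fmu[OF o] using T[OF o(1)] T[OF o(2)] by (simp del: transport.simps)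
    also have "\<dots> = \<tau> (WTen v w) \<cdot> far (fcm_model C L) (fmu \<pi> v w)"
      unfolding d.tau_WTen[OF o] d'.tau_WTen[OF o] using WTen T[OF o(1)] T[OF o(2)] by (simp del: transport.simps)
    finally show ?case
      by (rule L.iso_epi) (use T[of "WTen v w"] in \<open>simp_all del: transport.simps\<close>)
  qed
  have "iso_arr QL (?T w)" if "w \<in> Obj QH" for w
    using T(4)[OF that] unfolding lm.src.iso_def by blast
  then show ?thesis
    unfolding same_abstraction_def prod.case
    using natural tau by (intro exI[of _ "restrict ?T (words (CF H))"]) (auto simp: free_markov_simps(1))
qed

text \<open>Monoidality determines the comparison on words from its values on variables, so with
  identities as structure maps it is an identity everywhere. Naturality then says that the functors
  agree on morphisms.\<close>

lemma strict_same_abstraction_eq: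
  assumes "cf_downward C L H \<pi> P \<tau>" "cf_downward C L H \<pi>' P' \<tau>'"
    and s: "strict_functor QH QL \<pi>" "strict_functor QH QL \<pi>'"
    and same: "same_abstraction C L H (\<pi>, \<tau>) (\<pi>', \<tau>')"
  shows "(\<pi>, \<tau>) = (\<pi>', \<tau>')"
proof -
  interpret d: cf_downward C L H \<pi> P \<tau> by fact
  interpret d': cf_downward C L H \<pi>' P' \<tau>' by fact
  interpret p: strict_markov_functor QH QL \<pi> by unfold_locales (rule s)
  interpret p': strict_markov_functor QH QL \<pi>' by unfold_locales (rule s)
  obtain \<alpha> where a: "markov_nat QH QL \<pi> \<pi>' \<alpha>" "\<forall>x \<in> V H. \<alpha> (WVar x) = idt QL (fob \<pi> (WVar x))"
    "\<forall>w \<in> Obj QH. \<tau>' w \<cdot> far (fcm_model C L) (\<alpha> w) = \<tau> w"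
    using same unfolding same_abstraction_def by auto
  interpret a: markov_nat QH QL \<pi> \<pi>' \<alpha> by (rule a(1))
  have hom: "\<alpha> w \<in> Arr QL" "src QL (\<alpha> w) = fob \<pi> w" "tgt QL (\<alpha> w) = fob \<pi>' w" if "w \<in> Obj QH" for w
    using a.nat_hom[OF that] by (auto simp: hom_def)
  have id: "\<alpha> w = idt QL (fob \<pi> w)" if "w \<in> Obj QH" for w
    using that
  proof (induction w)
    case WUnit
    show ?case using a.nat_fnu hom[of WUnit] p.strict_simps(3) by simp
  next
    case (WTen v w)
    then have o: "v \<in> Obj QH" "w \<in> Obj QH" by simp_all
    show ?case using a.nat_fmu[OF o] hom[OF o(1)] hom[OF o(2)] hom[of "WTen v w"] o WTen.IH
        p.strict_simps(1,2)[OF o] p'.strict_simps(1,2)[OF o] by simp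
  qed (use a(2) in simp)
  have fob: "fob \<pi> w = fob \<pi>' w" if "w \<in> Obj QH" for w
    using hom(3)[OF that] id[OF that] that by simp
  have far: "far \<pi> f = far \<pi>' f" if f: "f \<in> Arr QH" for f
    using a.nat_natural[OF hm.src.homI[OF f refl refl]] f id fob by simp
  have "fob \<pi> = fob \<pi>'"
    using d.p.fob_ext d'.p.fob_ext fob by (rule extensionalityI)
  moreover have "far \<pi> = far \<pi>'"
    using d.p.far_ext d'.p.far_ext far by (rule extensionalityI)
  \<comment> \<open>Outside the domain both sides are \<open>undefined\<close>.\<close>
  moreover have "fmu \<pi> v w = fmu \<pi>' v w" for v w
    by (cases "v \<in> Obj QH \<and> w \<in> Obj QH") (auto simp: fob d.p.fmu_ext d'.p.fmu_ext)
  moreover have "\<tau> = \<tau>'"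
  proof (rule extensionalityI)
    show "\<tau> w = \<tau>' w" if "w \<in> Obj QH" for w
      using a(3) id[OF that] that fob[OF that] by auto
  qed (use markov_nat.nat_ext[OF d.natural] markov_nat.nat_ext[OF d'.natural] in auto)
  ultimately show ?thesis
    by (auto simp: fun_eq_iff intro!: mfun.equality)
qed

end

text \<open>\<open>\<pi>\<close> is strong, so its values on words other than variables are fixed
  only up to isomorphism, and restriction to variables need not be injective on the nose. The
  bijection is therefore stated in two ways: as surjectivity together with the identification of the
  fibres with the classes of \<open>same_abstraction\<close>, and as a plain bijection on strict
  representatives.\<close>

theorem proposition36:
  fixes C :: "('o, 'm) mcat"
    and L :: "('v, 'o, 'm) fcm"
    and H :: "('w, 'o, 'm) fcm"
  assumes "markov_category C"
    and "functional_causal_model C L"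
    and "functional_causal_model C H"
  shows "restrict_to_vars H ` cf_downward_abstractions C L H = cf_abstractions C L H
    \<and> (\<forall>D \<in> cf_downward_abstractions C L H. \<forall>D' \<in> cf_downward_abstractions C L H.
         restrict_to_vars H D = restrict_to_vars H D' \<longleftrightarrow> same_abstraction C L H D D')
    \<and> bij_betw (restrict_to_vars H)
         {(\<pi>, \<tau>) \<in> cf_downward_abstractions C L H.
            strict_functor (free_markov (CF H)) (free_markov (CF L)) \<pi>}
         (cf_abstractions C L H)"
proof -
  interpret fcm_pair C L H
    by unfold_locales (use assms in simp_all)
  let ?D = "cf_downward_abstractions C L H" and ?r = "restrict_to_vars H"
  let ?S = "{(\<pi>, \<tau>) \<in> ?D. strict_functor QH QL \<pi>}"
  have into: "?r D \<in> cf_abstractions C L H" if "D \<in> ?D" for D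
    using that by (cases D) (auto elim!: cf_downward_abstractionsE intro: cf_downward.restrict_in_cf_abstractions)
  have onto: "\<exists>D \<in> ?S. ?r D = Pt" if "Pt \<in> cf_abstractions C L H" for Pt
    using that by (cases Pt) (auto elim!: cf_abstraction_extends)
  have same: "?r D = ?r D' \<longleftrightarrow> same_abstraction C L H D D'" if D: "D \<in> ?D" "D' \<in> ?D" for D D'
  proof
    assume "?r D = ?r D'"
    then show "same_abstraction C L H D D'"
      using D by (cases D; cases D') (auto elim!: cf_downward_abstractionsE intro: restrict_same_abstraction)
  qed (rule same_abstraction_restrict[OF D])
  have "inj_on ?r ?S"
  proof (rule inj_onI)
    fix D D' assume D: "D \<in> ?S" "D' \<in> ?S" and "?r D = ?r D'"
    then have "same_abstraction C L H D D'" using same by blast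
    with D show "D = D'"
      by (cases D; cases D') (auto elim!: cf_downward_abstractionsE dest: strict_same_abstraction_eq)
  qed
  moreover have "?r ` ?S = cf_abstractions C L H"
    using into onto by blast
  moreover have "?r ` ?D = cf_abstractions C L H"
    using into onto by blast
  ultimately show ?thesis
    using same unfolding bij_betw_def by blast
qed

end
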